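(* Let $0<p<q<\infty$ and let $g$ be an analytic function in $\mathbb{D}$. (a) If $\frac1p-\frac1q\le1$, then the following are equivalent: (i) $T_g:\mathcal{D}^p_{p-1}\to H^q$ is bounded; (ii) $T_g:H^p\to H^q$ is bounded; (iii) $g\in\Lambda\left(\frac1p-\frac1q\right)$. (b) If $\frac1p-\frac1q>1$, then $T_g:\mathcal{D}^p_{p-1}\to H^q$ is bounded if and only if $g$ is constant.
   Context: $\mathbb{D}=\{z\in\mathbb{C}:|z|<1\}$, $\mathbb{T}=\partial\mathbb{D}$, $\mathcal{H}(\mathbb{D})$ is the space of analytic functions in $\mathbb{D}$, and $dA(z)=\frac{dx\,dy}{\pi}$. For $0<p<\infty$, the Hardy space $H^p$ consists of $f\in\mathcal{H}(\mathbb{D})$ with $\|f\|_{H^p}=\lim_{r\to1^-}\left(\frac{1}{2\pi}\int_0^{2\pi}|f(re^{i\theta})|^p\,d\theta\right)^{1/p}<\infty$. The Dirichlet-type space $\mathcal{D}^p_{p-1}$ consists of $f\in\mathcal{H}(\mathbb{D})$ with $\|f\|_{\mathcal{D}^p_{p-1}}^p=\int_{\mathbb{D}}|f'(z)|^p(1-|z|^2)^{p-1}\,dA(z)+|f(0)|^p<\infty$. For $g\in\mathcal{H}(\mathbb{D})$, $T_g(f)(z)=\int_0^z f(\zeta)g'(\zeta)\,d\zeta$, $z\in\mathbb{D}$. The operator $T_g:X\to Y$ is bounded if there is a constant $C$ with $\|T_g(f)\|_Y\le C\|f\|_X$ for all $f\in X$. For $0<\alpha\le1$, the Lipschitz space $\Lambda(\alpha)$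 consists of those $g\in\mathcal{H}(\mathbb{D})$ that extend continuously to $\overline{\mathbb{D}}$ and whose boundary values satisfy $$\sup_{\theta\in[0,2\pi],\,0<t<1}\frac{|g(e^{i(\theta+t)})-g(e^{i\theta})|}{t^\alpha}<\infty.$$ *)

theory Defs
  imports "HOL-Complex_Analysis.Complex_Analysis"
begin

text \<open>
  Functions on the unit disc are total functions \<^typ>\<open>complex \<Rightarrow> complex\<close>; only their
  values on \<^term>\<open>ball (0::complex) 1\<close> enter the definitions below.
\<close>

definition hardy_mean :: "real \<Rightarrow> (complex \<Rightarrow> complex) \<Rightarrow> real \<Rightarrow> real" where
  "hardy_mean p f r =
    (1 / (2 * pi) *
      integral {0..2 * pi} (\<lambda>\<theta>. norm (f (complex_of_real r * cis \<theta>)) powr p)) powr (1 / p)"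

text \<open>Finiteness of the norm is existence of a real limit of the means.\<close>

definition hardy_space :: "real \<Rightarrow> (complex \<Rightarrow> complex) set" where
  "hardy_space p =
    {f. f holomorphic_on ball 0 1 \<and> (\<exists>L. (hardy_mean p f \<longlongrightarrow> L) (at_left 1))}"

definition hardy_norm :: "real \<Rightarrow> (complex \<Rightarrow> complex) \<Rightarrow> real" where
  "hardy_norm p f = Lim (at_left 1) (hardy_mean p f)"

definition dirichlet_density :: "real \<Rightarrow> (complex \<Rightarrow> complex) \<Rightarrow> complex \<Rightarrow> real" where
  "dirichlet_density p f z = norm (deriv f z) powr p * (1 - (norm z)\<^sup>2) powr (p - 1)"

definition dirichlet_space :: "real \<Rightarrow> (complex \<Rightarrow> complex) set" where
  "dirichlet_space p =
    {f. f holomorphic_on ball 0 1 \<and> set_integrable lborel (ball 0 1) (dirichlet_density p f)}"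

text \<open>The factor \<open>1 / pi\<close> comes from the normalised area measure.\<close>

definition dirichlet_norm :: "real \<Rightarrow> (complex \<Rightarrow> complex) \<Rightarrow> real" where
  "dirichlet_norm p f =
    (1 / pi * (LINT z:ball 0 1|lborel. dirichlet_density p f z) + norm (f 0) powr p) powr (1 / p)"

definition T_op :: "(complex \<Rightarrow> complex) \<Rightarrow> (complex \<Rightarrow> complex) \<Rightarrow> complex \<Rightarrow> complex" where
  "T_op g f z = contour_integral (linepath 0 z) (\<lambda>\<zeta>. f \<zeta> * deriv g \<zeta>)"

text \<open>
  The norms are real-valued, with no meaning outside their spaces, so that a finite norm of the
  image has to be expressed separately, by membership in the target space.
\<close>

definition bounded_operator ::
  "'a set \<Rightarrow> ('a \<Rightarrow> real) \<Rightarrow> 'b set \<Rightarrow> ('b \<Rightarrow> real) \<Rightarrow> ('a \<Rightarrow> 'b) \<Rightarrow> bool" where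
  "bounded_operator X normX Y normY T \<longleftrightarrow>
    (\<exists>C. \<forall>f\<in>X. T f \<in> Y \<and> normY (T f) \<le> C * normX f)"

definition lipschitz_space :: "real \<Rightarrow> (complex \<Rightarrow> complex) set" where
  "lipschitz_space \<alpha> =
    {g. g holomorphic_on ball 0 1 \<and>
      (\<exists>G. continuous_on (cball 0 1) G \<and> (\<forall>z\<in>ball 0 1. G z = g z) \<and>
        bdd_above {norm (G (cis (\<theta> + t)) - G (cis \<theta>)) / t powr \<alpha> |\<theta> t.
          \<theta> \<in> {0..2 * pi} \<and> t \<in> {0<..<1}})}"

end

theory Submission
  imports Defs
begin

text \<open>
  Write \<open>\<alpha> = 1/p - 1/q > 0\<close>. Both boundedness conditions are equivalent to the growth condition
  \<open>|g'(z)| \<le> K (1 - |z|)^(\<alpha> - 1)\<close>. For \<open>\<alpha> \<le> 1\<close> that is the Hardy--Littlewood description of the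
  Lipschitz space; for \<open>\<alpha> > 1\<close> the bound tends to \<open>0\<close> at the circle, so that \<open>g' = 0\<close> by the maximum
  principle.

  \<^emph>\<open>Necessity.\<close> The functions \<open>f(z) = (1 - cnj a z)^(-m)\<close> with \<open>mp \<ge> 2\<close> have norm at most a constant
  times \<open>(1 - |a|)^(1/p - m)\<close> in both spaces (\<open>kernel_power_hardy\<close>, \<open>kernel_power_dirichlet\<close>), while
  \<open>F = T_g f\<close> satisfies \<open>f(a) g'(a) = F'(a)\<close> and \<open>|F'(a)| \<le> C \<parallel>F\<parallel> (1 - |a|)^(-1 - 1/q)\<close>
  (\<open>hardy_deriv_growth\<close>). Dividing by \<open>f(a)\<close> gives the growth condition.

  \<^emph>\<open>Sufficiency.\<close> The image is estimated on each radius separately (\<open>T_op_mean_bound\<close>). Let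
  \<open>|f| \<le> |k|^(P/p)\<close>, where \<open>k\<close> is holomorphic with finite Dirichlet integral \<open>N^P\<close> of exponent \<open>P\<close>.
  Subharmonicity of \<open>|k'|^P\<close> bounds \<open>((1 - s) |k'(s\<zeta>)|)^P\<close>, for all \<open>s\<close> at once, by the sweeping
  \<open>V(\<zeta>)\<close> of the Dirichlet density to the circle with the Poisson kernel, and the mean of \<open>V\<close> over
  the circle is the Dirichlet integral itself. Subharmonicity also gives
  \<open>|k'(z)| \<le> C N (1 - |z|)^(-1 - 1/P)\<close>. With these two bounds for \<open>k'\<close>, the integral of \<open>f g'\<close> along
  the radius is split at a point depending on \<open>V(\<zeta>)\<close>, as in Hedberg's proof of the Sobolev
  inequality; the result is a bound for \<open>|T_g f(r\<zeta>)|^q\<close> that is affine in \<open>V(\<zeta>)\<close>, hence integrable.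

  For the Dirichlet-type space one takes \<open>k = f\<close> and \<open>P = p\<close>. For the Hardy space one takes \<open>P = 2\<close>:
  dividing out the zeros of \<open>f\<close> in a disc by a Blaschke product and raising the quotient to the power
  \<open>p/2\<close> yields \<open>k\<close> with \<open>|f|^p \<le> |k|\<^sup>2\<close>, with equality on the bounding circle (\<open>power_majorant\<close>), and
  Parseval's identity bounds the Dirichlet integral of \<open>k\<close> by the mean of \<open>|k|\<^sup>2 = |f|^p\<close> over that
  circle. The same \<open>k\<close> also yields monotonicity of the integral means and the
  sub-mean-value inequality for \<open>|f|^p\<close> with arbitrary \<open>p > 0\<close>.
\<close>

section \<open>Parseval's identity on the circle\<close>

text \<open>
  The \<open>p\<close>-th power of \<open>hardy_mean\<close>: subharmonicity of \<open>|f|^p\<close> is a statement about this quantity rather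
  than about its root.
\<close>

definition circle_mean :: "real \<Rightarrow> (complex \<Rightarrow> complex) \<Rightarrow> real \<Rightarrow> real" where
  "circle_mean p f r =
    1 / (2 * pi) * integral {0..2 * pi} (\<lambda>\<theta>. norm (f (complex_of_real r * cis \<theta>)) powr p)"

lemma has_integral_cis_period:
  fixes k :: int
  shows "((\<lambda>\<theta>. cis (of_int k * \<theta>)) has_integral (if k = 0 then 2 * pi else 0)) {0..2 * pi}"
proof (cases "k = 0")
  case True
  then show ?thesis
    using has_integral_const_real[of "1::complex" 0 "2 * pi"] by (simp add: scaleR_conv_of_real)
next
  case False
  have "((\<lambda>\<theta>. cis (of_int k * \<theta>)) has_integral
      cis (of_int k * (2 * pi)) / (\<i> * of_int k) - cis (of_int k * 0) / (\<i> * of_int k)) {0..2 * pi}"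
  proof (rule fundamental_theorem_of_calculus)
    fix x :: real
    assume "x \<in> {0..2 * pi}"
    have "((\<lambda>\<theta>. exp (\<i> * of_int k * of_real \<theta>) / (\<i> * of_int k)) has_vector_derivative
        exp (\<i> * of_int k * of_real x)) (at x within {0..2 * pi})"
      using False by (auto intro!: derivative_eq_intros has_vector_derivative_real_field)
    then show "((\<lambda>\<theta>. cis (of_int k * \<theta>) / (\<i> * of_int k)) has_vector_derivative
        cis (of_int k * x)) (at x within {0..2 * pi})"
      by (simp add: cis_conv_exp mult.assoc)
  qed simp
  moreover have "cis (of_int k * (2 * pi)) = 1"
    by (metis cis_multiple_2pi Ints_of_int mult.commute)
  ultimately show ?thesis using False by simp
qed

lemma parseval_trig_polynomial:
  fixes a :: "nat \<Rightarrow> complex"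
  shows "((\<lambda>\<theta>. (norm (\<Sum>n<N. a n * cis (real n * \<theta>)))\<^sup>2) has_integral
    2 * pi * (\<Sum>n<N. (norm (a n))\<^sup>2)) {0..2 * pi}"
proof -
  have eq: "(norm (\<Sum>n<N. a n * cis (real n * \<theta>)))\<^sup>2 =
      Re (\<Sum>i<N. \<Sum>j<N. a i * cnj (a j) * cis (of_int (int i - int j) * \<theta>))" for \<theta>
  proof -
    have "complex_of_real ((norm (\<Sum>n<N. a n * cis (real n * \<theta>)))\<^sup>2) =
        (\<Sum>i<N. a i * cis (real i * \<theta>)) * cnj (\<Sum>j<N. a j * cis (real j * \<theta>))"
      by (rule complex_norm_square)
    also have "\<dots> = (\<Sum>i<N. \<Sum>j<N. a i * cnj (a j) * cis (of_int (int i - int j) * \<theta>))"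
      by (simp add: sum_product cis_cnj cis_mult algebra_simps flip: sum_distrib_left)
    finally show ?thesis by (metis Re_complex_of_real)
  qed
  have int: "((\<lambda>\<theta>. \<Sum>i<N. \<Sum>j<N. a i * cnj (a j) * cis (of_int (int i - int j) * \<theta>)) has_integral
      (\<Sum>i<N. \<Sum>j<N. a i * cnj (a j) * (if int i - int j = 0 then 2 * pi else 0))) {0..2 * pi}"
    by (intro has_integral_sum has_integral_mult_right has_integral_cis_period) auto
  have val: "(\<Sum>i<N. \<Sum>j<N. a i * cnj (a j) * (if int i - int j = 0 then 2 * pi else 0)) =
      complex_of_real (2 * pi * (\<Sum>n<N. (norm (a n))\<^sup>2))"
  proof -
    have "(\<Sum>j<N. a i * cnj (a j) * complex_of_real (if int i - int j = 0 then 2 * pi else 0)) =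
        complex_of_real (2 * pi * (norm (a i))\<^sup>2)" if "i < N" for i
    proof -
      have "(\<Sum>j<N. a i * cnj (a j) * complex_of_real (if int i - int j = 0 then 2 * pi else 0)) =
         (\<Sum>j<N. if i = j then a i * cnj (a i) * complex_of_real (2 * pi) else 0)"
        by (intro sum.cong) auto
      also have "\<dots> = a i * cnj (a i) * complex_of_real (2 * pi)" using that by simp
      also have "a i * cnj (a i) = complex_of_real ((norm (a i))\<^sup>2)"
        by (rule complex_norm_square[symmetric])
      finally show ?thesis by (metis of_real_mult mult.commute)
    qed
    then show ?thesis by (simp add: sum_distrib_left del: of_real_mult of_real_power)
  qed
  show ?thesis
    using has_integral_Re[OF int[unfolded val]] unfolding eq Re_complex_of_real .
qed

lemma parseval:
  fixes a :: "nat \<Rightarrow> complex"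
  assumes a: "summable (\<lambda>n. norm (a n))"
  shows "(\<lambda>n. (norm (a n))\<^sup>2) sums
    (1 / (2 * pi) * integral {0..2 * pi} (\<lambda>\<theta>. (norm (\<Sum>n. a n * cis (real n * \<theta>)))\<^sup>2))"
proof -
  have sm: "summable (\<lambda>n. a n * cis (real n * \<theta>))" for \<theta>
    by (rule summable_norm_cancel) (simp add: norm_mult a)
  have "(\<lambda>N. integral {0..2 * pi} (\<lambda>\<theta>. (norm (\<Sum>n<N. a n * cis (real n * \<theta>)))\<^sup>2)) \<longlonglongrightarrow>
     integral {0..2 * pi} (\<lambda>\<theta>. (norm (\<Sum>n. a n * cis (real n * \<theta>)))\<^sup>2)"
  proof (rule dominated_convergence(2))
    show "(\<lambda>\<theta>. (norm (\<Sum>n<N. a n * cis (real n * \<theta>)))\<^sup>2) integrable_on {0..2 * pi}" for N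
      using parseval_trig_polynomial by blast
    show "(\<lambda>\<theta>. (\<Sum>n. norm (a n))\<^sup>2) integrable_on {0..2 * pi}"
      by (rule integrable_const_ivl)
    show "norm ((norm (\<Sum>n<N. a n * cis (real n * \<theta>)))\<^sup>2) \<le> (\<Sum>n. norm (a n))\<^sup>2" for N \<theta>
    proof -
      have "norm (\<Sum>n<N. a n * cis (real n * \<theta>)) \<le> (\<Sum>n<N. norm (a n))"
        by (rule order_trans[OF norm_sum]) (simp add: norm_mult)
      also have "\<dots> \<le> (\<Sum>n. norm (a n))" by (rule sum_le_suminf[OF a]) auto
      finally show ?thesis by (simp add: power_mono)
    qed
    show "(\<lambda>N. (norm (\<Sum>n<N. a n * cis (real n * \<theta>)))\<^sup>2) \<longlonglongrightarrow>
        (norm (\<Sum>n. a n * cis (real n * \<theta>)))\<^sup>2" for \<theta>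
      by (intro tendsto_intros summable_LIMSEQ sm)
  qed
  then have "(\<lambda>N. 1 / (2 * pi) * (2 * pi * (\<Sum>n<N. (norm (a n))\<^sup>2))) \<longlonglongrightarrow>
     1 / (2 * pi) * integral {0..2 * pi} (\<lambda>\<theta>. (norm (\<Sum>n. a n * cis (real n * \<theta>)))\<^sup>2)"
    by (intro tendsto_mult tendsto_const) (simp add: integral_unique[OF parseval_trig_polynomial])
  then show ?thesis by (simp add: sums_def)
qed

text \<open>
  The Poisson kernel has mean one. Written with \<open>1 - c \<zeta>\<close> instead of \<open>\<zeta> - w\<close> it is Parseval's identity
  for the geometric series.
\<close>

lemma poisson_mean:
  fixes c :: complex
  assumes "norm c < 1"
  shows "((\<lambda>\<theta>. (norm (1 - c * cis \<theta>)) powr (-2)) has_integral 2 * pi / (1 - (norm c)\<^sup>2)) {0..2 * pi}"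
proof -
  have nz: "1 - c * cis \<theta> \<noteq> 0" for \<theta>
    using assms by (metis norm_cis norm_mult mult.right_neutral norm_one eq_iff_diff_eq_0 less_irrefl)
  have 1: "(\<Sum>n. c ^ n * cis (real n * \<theta>)) = 1 / (1 - c * cis \<theta>)" for \<theta>
  proof -
    have "(\<lambda>n. (c * cis \<theta>) ^ n) sums (1 / (1 - c * cis \<theta>))"
      by (rule geometric_sums) (simp add: norm_mult assms)
    moreover have "c ^ n * cis (real n * \<theta>) = (c * cis \<theta>) ^ n" for n
      by (simp add: power_mult_distrib Complex.DeMoivre)
    ultimately show ?thesis by (simp only: sums_iff)
  qed
  have "(\<lambda>n. (norm (c ^ n))\<^sup>2) sums
      (1 / (2 * pi) * integral {0..2 * pi} (\<lambda>\<theta>. (norm (\<Sum>n. c ^ n * cis (real n * \<theta>)))\<^sup>2))"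
    by (rule parseval) (simp add: norm_power assms summable_geometric)
  moreover have "(\<lambda>n. (norm (c ^ n))\<^sup>2) sums (1 / (1 - (norm c)\<^sup>2))"
    using geometric_sums[of "(norm c)\<^sup>2"] assms
    by (simp add: norm_power power_mult[symmetric] mult.commute abs_square_less_1)
  ultimately have "1 / (2 * pi) * integral {0..2 * pi} (\<lambda>\<theta>. (norm (1 / (1 - c * cis \<theta>)))\<^sup>2) = 1 / (1 - (norm c)\<^sup>2)"
    unfolding 1 using sums_unique2 by blast
  moreover have "(norm (1 / (1 - c * cis \<theta>)))\<^sup>2 = (norm (1 - c * cis \<theta>)) powr (-2)" for \<theta>
    using nz[of \<theta>] by (simp add: powr_minus norm_divide power_divide inverse_eq_divide)
  ultimately have "integral {0..2 * pi} (\<lambda>\<theta>. (norm (1 - c * cis \<theta>)) powr (-2)) = 2 * pi / (1 - (norm c)\<^sup>2)"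
    by (simp add: field_simps)
  moreover have "(\<lambda>\<theta>. (norm (1 - c * cis \<theta>)) powr (-2)) integrable_on {0..2 * pi}"
    by (rule integrable_continuous_real) (use nz in \<open>auto intro!: continuous_intros\<close>)
  ultimately show ?thesis by (metis integrable_integral)
qed

section \<open>Rotations and radial integrals\<close>

text \<open>
  The change of variables by an orthogonal map is known for the coordinate space of dimension two,
  and the coordinate map carries Lebesgue measure to Lebesgue measure because it carries boxes to
  boxes.
\<close>

lemma lborel_complex_rotation:
  fixes c :: complex
  assumes c: "norm c = 1"
  shows "distr lborel borel (\<lambda>z. c * z) = (lborel :: complex measure)"
proof -
  define \<phi> :: "real^2 \<Rightarrow> complex" where "\<phi> x = Complex (x $ 1) (x $ 2)" for x
  define T :: "real^2 \<Rightarrow> real^2" where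
    "T x = vector [Re c * x $ 1 - Im c * x $ 2, Im c * x $ 1 + Re c * x $ 2]" for x
  have \<phi>_cont: "continuous_on UNIV \<phi>"
    unfolding \<phi>_def Complex_eq by (intro continuous_intros)
  have lin: "linear T"
    by (rule linearI) (simp_all add: T_def vec_eq_iff forall_2 algebra_simps)
  have T_cont: "continuous_on UNIV T"
    by (rule linear_continuous_on) (simp add: lin linear_conv_bounded_linear[symmetric])
  have [measurable]: "\<phi> \<in> borel_measurable borel" "T \<in> borel_measurable borel"
    by (rule borel_measurable_continuous_onI[OF \<phi>_cont], rule borel_measurable_continuous_onI[OF T_cont])
  have c2: "(Re c)\<^sup>2 + (Im c)\<^sup>2 = 1" using c by (simp add: cmod_def)
  have orth: "orthogonal_transformation T"
    unfolding orthogonal_transformation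
  proof (intro conjI lin allI)
    fix v
    have "(norm (T v))\<^sup>2 = ((Re c)\<^sup>2 + (Im c)\<^sup>2) * (norm v)\<^sup>2"
      by (simp add: norm_vec_def L2_set_def UNIV_2 T_def sum_nonneg)
        (simp add: power2_eq_square algebra_simps)
    then have "(norm (T v))\<^sup>2 = (norm v)\<^sup>2" by (simp add: c2)
    then show "norm (T v) = norm v" by simp
  qed
  have Basis2: "(Basis :: (real^2) set) = {axis 1 1, axis 2 1}"
    by (auto simp: Basis_vec_def UNIV_2)
  have 1: "distr lborel borel \<phi> = (lborel :: complex measure)"
  proof (rule lborel_eqI[symmetric])
    fix l u :: complex
    assume le: "\<And>b. b \<in> Basis \<Longrightarrow> l \<bullet> b \<le> u \<bullet> b"
    have "\<phi> -` box l u = box (vector [Re l, Im l]) (vector [Re u, Im u])"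
      by (auto simp: \<phi>_def box_def Basis_complex_def axis_def inner_vec_def UNIV_2 Basis_vec_def)
    moreover have "emeasure lborel (box (vector [Re l, Im l]) (vector [Re u, Im u]) :: (real^2) set)
        = (\<Prod>b\<in>Basis. (u - l) \<bullet> b)"
    proof (subst emeasure_lborel_box)
      show "(vector [Re l, Im l] :: real^2) \<bullet> b \<le> vector [Re u, Im u] \<bullet> b" if "b \<in> Basis" for b
        using that le[of 1] le[of \<i>]
        by (auto simp: Basis_vec_def inner_vec_def UNIV_2 axis_def Basis_complex_def)
      have [simp]: "axis 1 1 \<noteq> (axis 2 1 :: real^2)" by (simp add: axis_eq_axis)
      show "ennreal (\<Prod>b\<in>Basis. (vector [Re u, Im u] - vector [Re l, Im l] :: real^2) \<bullet> b) =
          ennreal (\<Prod>b\<in>Basis. (u - l) \<bullet> b)"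
        by (simp add: Basis2 Basis_complex_def inner_axis)
    qed
    ultimately show "emeasure (distr lborel borel \<phi>) (box l u) = (\<Prod>b\<in>Basis. (u - l) \<bullet> b)"
      by (simp add: emeasure_distr)
  qed simp
  have 2: "distr lborel borel T = (lborel :: (real^2) measure)"
  proof (rule lborel_eqI[symmetric])
    fix l u :: "real^2"
    assume le: "\<And>b. b \<in> Basis \<Longrightarrow> l \<bullet> b \<le> u \<bullet> b"
    have bij: "bij T" using orth by (rule orthogonal_transformation_bij)
    have o': "orthogonal_transformation (inv T)" using orth by (rule orthogonal_transformation_inv)
    have img: "T -` box l u = inv T ` box l u" by (rule bij_vimage_eq_inv_image[OF bij])
    have L: "inv T ` box l u \<in> lmeasurable" by (rule measurable_orthogonal_image[OF o']) simp
    have "emeasure lborel (T -` box l u) = emeasure lebesgue (T -` box l u)" 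
      by (simp add: measurable_sets_borel[of T borel])
    also have "\<dots> = emeasure lebesgue (box l u)"
      unfolding img using L measure_orthogonal_image[OF o', of "box l u"]
      by (simp add: emeasure_eq_measure2)
    also have "\<dots> = (\<Prod>b\<in>Basis. (u - l) \<bullet> b)" using le by (simp add: emeasure_lborel_box)
    finally show "emeasure (distr lborel borel T) (box l u) = (\<Prod>b\<in>Basis. (u - l) \<bullet> b)"
      by (simp add: emeasure_distr)
  qed simp
  have "distr lborel borel (\<lambda>z. c * z) = distr (distr lborel borel \<phi>) borel (\<lambda>z. c * z)"
    by (simp add: 1)
  also have "\<dots> = distr lborel borel ((\<lambda>z. c * z) \<circ> \<phi>)" by (rule distr_distr) auto
  also have "(\<lambda>z. c * z) \<circ> \<phi> = \<phi> \<circ> T"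
    by (auto simp: fun_eq_iff \<phi>_def T_def complex_eq_iff)
  also have "distr lborel borel (\<phi> \<circ> T) = distr (distr lborel borel T) borel \<phi>"
    by (rule distr_distr[symmetric]) auto
  also have "\<dots> = lborel" by (simp add: 1 2)
  finally show ?thesis .
qed

text \<open>
  Together with the next lemma this does the work of polar coordinates: an area integral is the
  area integral of the circular means of the integrand, and these depend on the modulus only.
\<close>

lemma nn_integral_rotation_average:
  fixes f :: "complex \<Rightarrow> ennreal"
  assumes [measurable]: "f \<in> borel_measurable borel"
  shows "(\<integral>\<^sup>+z. (\<integral>\<^sup>+\<theta>\<in>{0..2*pi}. f (z * cis \<theta>) \<partial>lborel) \<partial>lborel) = ennreal (2 * pi) * (\<integral>\<^sup>+z. f z \<partial>lborel)"
proof -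
  have [measurable]: "cis \<in> borel_measurable borel"
    by (intro borel_measurable_continuous_onI continuous_intros)
  have rot: "(\<integral>\<^sup>+z. f (z * cis \<theta>) \<partial>lborel) = (\<integral>\<^sup>+z. f z \<partial>lborel)" for \<theta>
  proof -
    have "(\<integral>\<^sup>+z. f z \<partial>lborel) = (\<integral>\<^sup>+z. f z \<partial>distr lborel borel (\<lambda>z. cis \<theta> * z))"
      by (simp add: lborel_complex_rotation)
    also have "\<dots> = (\<integral>\<^sup>+z. f (cis \<theta> * z) \<partial>lborel)" by (rule nn_integral_distr) auto
    finally show ?thesis by (simp add: mult.commute)
  qed
  have "(\<integral>\<^sup>+z. (\<integral>\<^sup>+\<theta>. f (z * cis \<theta>) * indicator {0..2*pi} \<theta> \<partial>lborel) \<partial>lborel)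
      = (\<integral>\<^sup>+\<theta>. (\<integral>\<^sup>+z. f (z * cis \<theta>) * indicator {0..2*pi} \<theta> \<partial>lborel) \<partial>lborel)"
    by (rule lborel_pair.Fubini'[symmetric]) measurable
  also have "\<dots> = (\<integral>\<^sup>+\<theta>. (\<integral>\<^sup>+z. f z \<partial>lborel) * indicator {0..2*pi} \<theta> \<partial>lborel)"
    by (simp add: nn_integral_multc rot)
  also have "\<dots> = ennreal (2 * pi) * (\<integral>\<^sup>+z. f z \<partial>lborel)"
    by (simp add: nn_integral_cmult mult.commute)
  finally show ?thesis .
qed

text \<open>
  Under \<open>w \<mapsto> |w|\<^sup>2\<close> the area measure of the disc becomes \<open>\<pi>\<close> times Lebesgue measure on the unit
  interval, because the annulus \<open>x < |w|\<^sup>2 < 1\<close> has area \<open>\<pi> (1 - x)\<close>.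
\<close>

lemma nn_integral_radial:
  fixes \<phi> :: "real \<Rightarrow> ennreal"
  assumes [measurable]: "\<phi> \<in> borel_measurable borel"
  shows "(\<integral>\<^sup>+w\<in>ball 0 1. \<phi> ((norm (w::complex))\<^sup>2) \<partial>lborel) = ennreal pi * (\<integral>\<^sup>+t\<in>{0<..<1}. \<phi> t \<partial>lborel)"
proof -
  define M where "M = distr (density lborel (indicator (ball (0::complex) 1))) borel (\<lambda>w. (norm w)\<^sup>2)"
  define N where "N = density lborel (\<lambda>t::real. ennreal pi * indicator {0<..<1} t)"
  have ball: "emeasure lborel (ball (0::complex) 1) = ennreal pi"
    by (simp add: emeasure_ball unit_ball_vol_2)
  have M: "emeasure M A = emeasure lborel ({w. (norm w)\<^sup>2 \<in> A} \<inter> ball (0::complex) 1)"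
    if [measurable]: "A \<in> sets borel" for A
  proof -
    have [measurable]: "{w::complex. (norm w)\<^sup>2 \<in> A} \<in> sets borel"
      using measurable_sets_borel[of "\<lambda>w::complex. (norm w)\<^sup>2" borel A] by (simp add: vimage_def)
    have "emeasure M A = emeasure (density lborel (indicator (ball (0::complex) 1))) {w. (norm w)\<^sup>2 \<in> A}"
      unfolding M_def by (subst emeasure_distr) (simp_all add: vimage_def)
    also have "\<dots> = (\<integral>\<^sup>+w. indicator (ball (0::complex) 1) w * indicator {w. (norm w)\<^sup>2 \<in> A} w \<partial>lborel)"
      by (rule emeasure_density) (auto intro: borel_measurable_indicator)
    also have "\<dots> = (\<integral>\<^sup>+w. indicator ({w. (norm w)\<^sup>2 \<in> A} \<inter> ball (0::complex) 1) w \<partial>lborel)"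
      by (intro nn_integral_cong) (simp split: split_indicator)
    finally show ?thesis by (subst (asm) nn_integral_indicator) measurable
  qed
  have N: "emeasure N A = ennreal pi * emeasure lborel ({0<..<1} \<inter> A)"
    if [measurable]: "A \<in> sets borel" for A
  proof -
    have "emeasure N A = (\<integral>\<^sup>+t. ennreal pi * indicator {0<..<1} t * indicator A t \<partial>lborel)"
      unfolding N_def by (rule emeasure_density) measurable
    also have "\<dots> = (\<integral>\<^sup>+t. ennreal pi * indicator ({0<..<1} \<inter> A) t \<partial>lborel)"
      by (intro nn_integral_cong) (simp split: split_indicator)
    also have "\<dots> = ennreal pi * emeasure lborel ({0<..<1} \<inter> A)"
      by (rule nn_integral_cmult_indicator) measurable
    finally show ?thesis .
  qed
  have "M = N"
  proof (rule measure_eqI_lessThan)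
    show "sets M = sets borel" "sets N = sets borel" by (simp_all add: M_def N_def)
    show "emeasure M {x<..} = emeasure N {x<..}" for x
    proof -
      consider "x < 0" | "0 \<le> x" "x < 1" | "1 \<le> x" by linarith
      then show ?thesis
      proof cases
        case 1
        then have "{w. (norm w)\<^sup>2 \<in> {x<..}} \<inter> ball (0::complex) 1 = ball 0 1"
          by (auto intro: less_le_trans[OF _ zero_le_power2])
        moreover have "{0<..<1} \<inter> {x<..} = {0<..<1}" using 1 by auto
        ultimately show ?thesis by (simp add: M N ball)
      next
        case 2
        have "sqrt x < norm w \<longleftrightarrow> x < (norm w)\<^sup>2" for w :: complex
          using real_sqrt_less_iff[of x "(norm w)\<^sup>2"] by (simp del: real_sqrt_less_iff)
        note h = this
        have eq: "{w. (norm w)\<^sup>2 \<in> {x<..}} \<inter> ball (0::complex) 1 = ball 0 1 - cball 0 (sqrt x)"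
          unfolding set_eq_iff Int_iff mem_Collect_eq greaterThan_iff Diff_iff mem_ball_0 mem_cball_0 not_le h
          by blast
        have "emeasure lborel (ball 0 1 - cball (0::complex) (sqrt x)) = ennreal (pi - pi * x)"
        proof (subst emeasure_Diff)
          have "sqrt x < 1" using 2 by simp
          then show "cball (0::complex) (sqrt x) \<subseteq> ball 0 1"
            by (simp add: cball_subset_ball_iff)
          have "emeasure lborel (cball (0::complex) (sqrt x)) = ennreal (pi * x)"
            using 2 by (simp add: emeasure_cball unit_ball_vol_2)
          then show "emeasure lborel (ball (0::complex) 1) - emeasure lborel (cball (0::complex) (sqrt x)) =
              ennreal (pi - pi * x)" "emeasure lborel (cball (0::complex) (sqrt x)) \<noteq> \<infinity>"
            using 2 by (simp_all add: ball ennreal_minus)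
        qed simp_all
        moreover have "{0<..<1} \<inter> {x<..} = {x<..<1}" using 2 by auto
        ultimately show ?thesis using 2
          by (simp add: M N eq[simplified] ennreal_mult'[symmetric] algebra_simps)
      next
        case 3
        then have "{w. (norm w)\<^sup>2 \<in> {x<..}} \<inter> ball (0::complex) 1 = {}"
          using power_le_one[OF norm_ge_zero, where n = 2] by (smt (verit) disjoint_iff IntE mem_Collect_eq greaterThan_iff mem_ball_0)
        moreover have "{0<..<1} \<inter> {x<..} = {}" using 3 by auto
        ultimately show ?thesis by (simp add: M N)
      qed
    qed
    show "emeasure M {x<..} < \<infinity>" for x
      by (subst M, simp) (rule le_less_trans[OF emeasure_mono[of _ "ball 0 1"]], auto simp: ball)
  qed
  have "(\<integral>\<^sup>+w\<in>ball 0 1. \<phi> ((norm (w::complex))\<^sup>2) \<partial>lborel) = (\<integral>\<^sup>+t. \<phi> t \<partial>M)"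
    unfolding M_def
    by (subst nn_integral_distr, measurable, subst nn_integral_density)
      (auto intro: borel_measurable_indicator simp: mult.commute)
  also have "\<dots> = (\<integral>\<^sup>+t. \<phi> t \<partial>N)" by (simp add: \<open>M = N\<close>)
  also have "\<dots> = (\<integral>\<^sup>+t. ennreal pi * (\<phi> t * indicator {0<..<1} t) \<partial>lborel)"
    unfolding N_def by (subst nn_integral_density) (auto simp: mult_ac)
  also have "\<dots> = ennreal pi * (\<integral>\<^sup>+t\<in>{0<..<1}. \<phi> t \<partial>lborel)"
    by (rule nn_integral_cmult) measurable
  finally show ?thesis .
qed

section \<open>Zero-free majorants\<close>

lemma norm_blaschke:
  fixes a w :: complex
  shows "(norm (1 - cnj a * w))\<^sup>2 - (norm (w - a))\<^sup>2 = (1 - (norm a)\<^sup>2) * (1 - (norm w)\<^sup>2)"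
  unfolding cmod_power2 by (simp add: power2_eq_square algebra_simps)

text \<open>
  Division by a finite Blaschke product, one zero (with its full multiplicity) at a time: the factor
  \<open>(w - a) / (1 - cnj a w)\<close> has modulus at most one in the disc and one on the circle, so that
  the quotient dominates and agrees in modulus on the circle. Zeros on the circle itself cannot be
  removed in this way, whence the hypothesis on their location.
\<close>

lemma zero_free_majorant:
  assumes "finite Z" and "1 < R" and "f holomorphic_on ball 0 R"
    and "{z \<in> cball 0 1. f z = 0} = Z" and "Z \<subseteq> ball 0 1"
  shows "\<exists>h. h holomorphic_on ball 0 R \<and> (\<forall>z\<in>cball 0 1. h z \<noteq> 0 \<and> norm (f z) \<le> norm (h z)) \<and>
    (\<forall>z\<in>sphere 0 1. norm (f z) = norm (h z))"
  using assms
proof (induction Z arbitrary: f rule: finite_induct)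
  case empty
  then show ?case by (intro exI[of _ f]) auto
next
  case (insert a Z)
  have a: "a \<in> cball 0 1" "f a = 0" "norm a < 1" using insert.prems by auto
  then have aR: "a \<in> ball 0 R" using \<open>1 < R\<close> by auto
  have one: "(1::complex) \<in> ball 0 R" "f 1 \<noteq> 0"
  proof -
    show "(1::complex) \<in> ball 0 R" using \<open>1 < R\<close> by simp
    have "1 \<notin> {z \<in> cball 0 1. f z = 0}" using insert.prems(3,4) by auto
    then show "f 1 \<noteq> 0" by simp
  qed
  obtain n g r where r: "r > 0" "cball a r \<subseteq> ball 0 R" "g holomorphic_on cball a r"
    and g: "\<And>w. w \<in> cball a r \<Longrightarrow> f w = g w * (w - a) ^ n \<and> g w \<noteq> 0"
    using zorder_exist_zero[OF insert.prems(2) open_ball connected_ball aR] one by meson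
  \<comment> \<open>The quotient by \<open>(w - a)^n\<close>, completed across \<open>a\<close> by the local factor \<open>g\<close>.\<close>
  define h where "h w = (if w \<in> ball a r then g w else f w / (w - a) ^ n)" for w
  have fh: "f w = h w * (w - a) ^ n" if "w \<in> ball 0 R" for w
    using g[of w] r(1) by (auto simp: h_def)
  have "h holomorphic_on ball a r \<union> (ball 0 R - {a})"
  proof (rule holomorphic_on_Un)
    show "h holomorphic_on ball a r"
      using holomorphic_on_subset[OF r(3) ball_subset_cball] by (rule holomorphic_transform) (simp add: h_def)
    have "(\<lambda>w. f w / (w - a) ^ n) holomorphic_on ball 0 R - {a}"
      using insert.prems(2) by (auto intro!: holomorphic_intros intro: holomorphic_on_subset)
    then show "h holomorphic_on ball 0 R - {a}"
      by (rule holomorphic_transform) (use g in \<open>auto simp: h_def\<close>)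
  qed auto
  moreover have "ball a r \<union> (ball 0 R - {a}) = ball 0 R" using r aR by auto
  ultimately have holh: "h holomorphic_on ball 0 R" by simp
  define F where "F w = h w * (1 - cnj a * w) ^ n" for w
  have nz: "1 - cnj a * w \<noteq> 0" if "w \<in> cball 0 1" for w
  proof
    assume "1 - cnj a * w = 0"
    then have "norm a * norm w = 1"
      by (metis complex_mod_cnj eq_iff_diff_eq_0 norm_mult norm_one)
    moreover have "norm a * norm w \<le> norm a * 1" using that by (intro mult_left_mono) auto
    ultimately show False using a by simp
  qed
  have ha: "h a \<noteq> 0" using g[of a] r(1) by (simp add: h_def)
  have "{z \<in> cball 0 1. F z = 0} = Z"
  proof -
    have "F z = 0 \<longleftrightarrow> f z = 0 \<and> z \<noteq> a" if "z \<in> cball 0 1" for z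
      using fh[of z] nz[OF that] ha that \<open>1 < R\<close> by (auto simp: F_def)
    then have "{z \<in> cball 0 1. F z = 0} = {z \<in> cball 0 1. f z = 0} - {a}" by auto
    then show ?thesis using insert by simp
  qed
  moreover have "F holomorphic_on ball 0 R"
    unfolding F_def by (intro holomorphic_intros holh)
  ultimately obtain k where k: "k holomorphic_on ball 0 R"
    "\<And>z. z \<in> cball 0 1 \<Longrightarrow> k z \<noteq> 0 \<and> norm (F z) \<le> norm (k z)"
    "\<And>z. z \<in> sphere 0 1 \<Longrightarrow> norm (F z) = norm (k z)"
    using insert.IH[OF \<open>1 < R\<close>, of F] insert.prems by blast
  have le: "norm (w - a) \<le> norm (1 - cnj a * w)" if "w \<in> cball 0 1" for w
  proof -
    have "(norm a)\<^sup>2 \<le> 1" "(norm w)\<^sup>2 \<le> 1"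
      using that a by (simp_all add: power_le_one)
    then have "0 \<le> (1 - (norm a)\<^sup>2) * (1 - (norm w)\<^sup>2)" by simp
    then have "(norm (w - a))\<^sup>2 \<le> (norm (1 - cnj a * w))\<^sup>2" using norm_blaschke[of a w] by linarith
    then show ?thesis by (rule power2_le_imp_le) simp
  qed
  have eq: "norm (w - a) = norm (1 - cnj a * w)" if "w \<in> sphere 0 1" for w
  proof -
    have "(norm (w - a))\<^sup>2 = (norm (1 - cnj a * w))\<^sup>2"
      using norm_blaschke[of a w] that by (simp del: power2_eq_iff)
    then show ?thesis by (metis norm_ge_zero power2_eq_imp_eq)
  qed
  have fF: "norm (f z) \<le> norm (F z)" if "z \<in> cball 0 1" for z
    using fh[of z] le[OF that] that \<open>1 < R\<close>
    by (auto simp: F_def norm_mult norm_power intro!: mult_left_mono power_mono)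
  have fF': "norm (f z) = norm (F z)" if "z \<in> sphere 0 1" for z
    using fh[of z] eq[OF that] that \<open>1 < R\<close> by (auto simp: F_def norm_mult norm_power)
  show ?case
    using k fF fF' by (intro exI[of _ k] conjI ballI) (blast intro: order_trans | simp)+
qed

text \<open>
  The zero-free quotient has no zeros in a slightly larger disc either, by compactness, so that it has
  a holomorphic logarithm \<open>L\<close> there, and \<open>k = exp (p L / 2)\<close>.
\<close>

lemma power_majorant:
  assumes "1 < R" and f: "f holomorphic_on ball 0 R" and nz: "\<And>z. z \<in> sphere 0 1 \<Longrightarrow> f z \<noteq> 0"
    and "0 < p"
  shows "\<exists>k \<rho>. 1 < \<rho> \<and> k holomorphic_on ball 0 \<rho> \<and>
    (\<forall>z\<in>cball 0 1. norm (f z) powr p \<le> (norm (k z))\<^sup>2) \<and>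
    (\<forall>z\<in>sphere 0 1. norm (f z) powr p = (norm (k z))\<^sup>2)"
proof -
  have sub: "cball 0 1 \<subseteq> ball (0::complex) R" using \<open>1 < R\<close> by auto
  have "\<not> f constant_on ball 0 R \<or> {z \<in> cball 0 1. f z = 0} = {}"
  proof (rule disjCI)
    assume "\<not> {z \<in> cball 0 1. f z = 0} = {}"
    then obtain z where "z \<in> ball 0 R" "f z = 0" using sub by auto
    moreover have "(1::complex) \<in> ball 0 R" "f 1 \<noteq> 0" using nz[of 1] \<open>1 < R\<close> by auto
    ultimately show "\<not> f constant_on ball 0 R" by (metis constant_on_def)
  qed
  then have fin: "finite {z \<in> cball 0 1. f z = 0}"
    using holomorphic_compact_finite_zeros[OF f open_ball connected_ball compact_cball sub] finite.emptyI by metis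
  have Zin: "{z \<in> cball 0 1. f z = 0} \<subseteq> ball 0 1"
    using nz by (auto simp: less_le)
  obtain h where h: "h holomorphic_on ball 0 R" "\<And>z. z \<in> cball 0 1 \<Longrightarrow> h z \<noteq> 0 \<and> norm (f z) \<le> norm (h z)"
    "\<And>z. z \<in> sphere 0 1 \<Longrightarrow> norm (f z) = norm (h z)"
    using zero_free_majorant[OF fin \<open>1 < R\<close> f refl Zin] by blast
  have op: "open {z \<in> ball 0 R. h z \<noteq> 0}"
    using continuous_open_preimage[OF holomorphic_on_imp_continuous_on[OF h(1)] open_ball, of "-{0}"]
    by (simp add: vimage_def Int_def open_Compl)
  have "cball 0 1 \<subseteq> {z \<in> ball 0 R. h z \<noteq> 0}" using h(2) sub by auto
  then obtain e where e: "e > 0" "(\<Union>x\<in>cball 0 1. ball x e) \<subseteq> {z \<in> ball 0 R. h z \<noteq> 0}"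
    using compact_subset_open_imp_ball_epsilon_subset[OF compact_cball op] by blast
  have ball_e: "z \<in> {z \<in> ball 0 R. h z \<noteq> 0}" if z: "z \<in> ball 0 (1 + e)" for z
  proof (cases "norm z \<le> 1")
    case True
    then show ?thesis using h(2)[of z] sub by auto
  next
    case False
    define x where "x = z / norm z"
    have "norm (x - z) = norm z - 1"
    proof -
      have "x - z = of_real (1 / norm z - 1) * z"
        using False by (auto simp: x_def field_simps)
      then have "norm (x - z) = \<bar>1 / norm z - 1\<bar> * norm z" by (simp only: norm_mult norm_of_real)
      moreover have "1 / norm z < 1" "norm z > 0" using False by (auto simp: divide_simps)
      ultimately show ?thesis by (simp add: algebra_simps)
    qed
    then have "z \<in> ball x e" using z by (simp add: dist_norm)
    moreover have "x \<in> cball 0 1" by (simp add: x_def norm_divide)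
    ultimately show ?thesis using e by blast
  qed
  have "h holomorphic_on ball 0 (1 + e)"
    using h(1) by (rule holomorphic_on_subset) (use ball_e in blast)
  then obtain L where L: "L holomorphic_on ball 0 (1 + e)" "\<And>z. z \<in> ball 0 (1 + e) \<Longrightarrow> h z = exp (L z)"
  proof (rule contractible_imp_holomorphic_log)
    show "contractible (ball (0::complex) (1 + e))" by (simp add: convex_imp_contractible)
    show "h z \<noteq> 0" if "z \<in> ball 0 (1 + e)" for z using ball_e[OF that] by simp
  qed blast
  define k where "k z = exp (of_real (p / 2) * L z)" for z
  have k: "(norm (k z))\<^sup>2 = norm (h z) powr p" if "z \<in> cball 0 1" for z
  proof -
    have "z \<in> ball 0 (1 + e)" using that e by auto
    then have "norm (h z) = exp (Re (L z))" using L by simp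
    then have "norm (h z) powr p = exp (p * Re (L z))" by (simp add: powr_def)
    moreover have "norm (k z) = exp (p / 2 * Re (L z))" by (simp add: k_def)
    then have "(norm (k z))\<^sup>2 = exp (p / 2 * Re (L z) + p / 2 * Re (L z))"
      unfolding exp_add by (simp add: power2_eq_square)
    ultimately show ?thesis by simp
  qed
  have "k holomorphic_on ball 0 (1 + e)"
    unfolding k_def by (intro holomorphic_intros L)
  moreover have "\<forall>z\<in>cball 0 1. norm (f z) powr p \<le> (norm (k z))\<^sup>2"
    using k h(2) \<open>0 < p\<close> by (auto intro!: powr_mono2)
  moreover have "\<forall>z\<in>sphere 0 1. norm (f z) powr p = (norm (k z))\<^sup>2"
    using k h(3) by auto
  ultimately show ?thesis using e by (intro exI[of _ k] exI[of _ "1 + e"]) auto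
qed

text \<open>
  The circles that carry zeros of \<open>f\<close> are exceptional: only finitely many of them meet a compact
  part of the disc. Every radius is therefore a limit from the right of radii for which the
  majorant exists, which suffices for inequalities between quantities continuous in the radius.
\<close>

lemma eventually_power_majorant:
  assumes f: "f holomorphic_on ball 0 1" and "0 < p" and r: "0 \<le> r" "r < 1"
  shows "\<forall>\<^sub>F R in at_right r. r < R \<and> R < 1 \<and> (\<exists>k \<rho>. 1 < \<rho> \<and> k holomorphic_on ball 0 \<rho> \<and>
    (\<forall>z\<in>cball 0 1. norm (f (of_real R * z)) powr p \<le> (norm (k z))\<^sup>2) \<and>
    (\<forall>z\<in>sphere 0 1. norm (f (of_real R * z)) powr p = (norm (k z))\<^sup>2))"
proof -
  obtain b where b: "r < b" "b < 1" using r dense by blast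
  have near: "\<forall>\<^sub>F R in at_right r. R \<in> {r<..<b}" using b(1) by (rule eventually_at_right_real)
  show ?thesis
  proof (cases "f constant_on ball 0 1")
    case True
    then obtain c where c: "\<And>z. z \<in> ball 0 1 \<Longrightarrow> f z = c" by (auto simp: constant_on_def)
    show ?thesis
      using near
    proof eventually_elim
      case (elim R)
      have "norm (of_real R * z) < 1" if "z \<in> cball 0 1" for z :: complex
        using mult_mono[of R b "norm z" 1] that elim b r by (auto simp: norm_mult)
      then have eq: "f (of_real R * z) = c" if "z \<in> cball 0 1" for z
        using that c by simp
      have "(norm (complex_of_real (norm c powr (p / 2))))\<^sup>2 = norm c powr p"
        by (simp add: power2_eq_square powr_add[symmetric])
      then show ?case
        using elim b eq
        by (intro conjI exI[of _ "\<lambda>_. complex_of_real (norm c powr (p / 2))"] exI[of _ 2]) auto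
    qed
  next
    case False
    have "cball 0 b \<subseteq> ball (0::complex) 1" using b by auto
    then have fin: "finite {z \<in> cball 0 b. f z = 0}"
      using holomorphic_compact_finite_zeros[OF f open_ball connected_ball compact_cball _ False] by blast
    have "\<forall>\<^sub>F R in at_right r. \<forall>x\<in>norm ` {z \<in> cball 0 b. f z = 0}. R \<noteq> x"
      by (rule eventually_ball_finite) (use fin in \<open>auto intro: eventually_neq_at_within\<close>)
    with near show ?thesis
    proof eventually_elim
      case (elim R)
      have R: "0 < R" "r < R" "R < b" "R < 1" using elim b r by auto
      have "(\<lambda>z. f (of_real R * z)) holomorphic_on ball 0 (1 / R)"
        using R by (intro holomorphic_on_compose_gen[OF _ f, unfolded o_def] holomorphic_intros)
          (auto simp: norm_mult field_simps)
      moreover have "f (of_real R * z) \<noteq> 0" if "z \<in> sphere 0 1" for z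
      proof -
        have "norm (of_real R * z) = R" using that R by (simp add: norm_mult)
        moreover from this have "of_real R * z \<in> cball 0 b" using R by simp
        ultimately show ?thesis using elim(2) by (metis (mono_tags, lifting) image_eqI mem_Collect_eq)
      qed
      ultimately show ?case
        using power_majorant[of "1 / R" "\<lambda>z. f (of_real R * z)" p] R \<open>0 < p\<close> by auto
    qed
  qed
qed

section \<open>Integral means of holomorphic functions\<close>

text \<open>
  Convergence in a disc of radius larger than one makes the coefficients absolutely summable, as
  Parseval's identity requires.
\<close>

lemma disc_power_series:
  fixes k :: "complex \<Rightarrow> complex"
  assumes "1 < \<rho>" and k: "k holomorphic_on ball 0 \<rho>"
  shows "\<exists>a. summable (\<lambda>n. norm (a n)) \<and> (\<forall>z\<in>cball 0 1. (\<lambda>n. a n * z ^ n) sums k z) \<and>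
    (\<forall>n. a n = (deriv ^^ n) k 0 / fact n)"
proof -
  define a where "a n = (deriv ^^ n) k 0 / fact n" for n
  have sums: "(\<lambda>n. a n * z ^ n) sums k z" if "z \<in> ball 0 \<rho>" for z
    using holomorphic_power_series[OF k that] by (simp add: a_def)
  obtain t where t: "1 < t" "t < \<rho>" using \<open>1 < \<rho>\<close> dense by blast
  have "summable (\<lambda>n. a n * of_real t ^ n)"
    by (rule sums_summable[OF sums]) (use t in simp)
  then have "summable (\<lambda>n. norm (a n * 1 ^ n))"
    by (rule powser_insidea) (use t in simp)
  moreover have "\<forall>z\<in>cball 0 1. (\<lambda>n. a n * z ^ n) sums k z"
    using sums \<open>1 < \<rho>\<close> by auto
  ultimately show ?thesis by (intro exI[of _ a]) (simp add: a_def)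
qed

lemma parseval_disc:
  fixes k :: "complex \<Rightarrow> complex"
  assumes a: "summable (\<lambda>n. norm (a n))" and k: "\<And>z. z \<in> cball 0 1 \<Longrightarrow> (\<lambda>n. a n * z ^ n) sums k z"
    and w: "norm w \<le> 1"
  shows "(\<lambda>n. (norm (a n))\<^sup>2 * (norm w)\<^sup>2 ^ n) sums
    (1 / (2 * pi) * integral {0..2 * pi} (\<lambda>\<theta>. (norm (k (w * cis \<theta>)))\<^sup>2))"
proof -
  have "summable (\<lambda>n. norm (a n * w ^ n))"
  proof (rule summable_comparison_test[OF _ a], intro exI allI impI)
    fix n
    have "norm (a n) * norm w ^ n \<le> norm (a n) * 1"
      by (intro mult_left_mono power_le_one) (use w in auto)
    then show "norm (norm (a n * w ^ n)) \<le> norm (a n)" by (simp add: norm_mult norm_power)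
  qed
  then have "(\<lambda>n. (norm (a n * w ^ n))\<^sup>2) sums
    (1 / (2 * pi) * integral {0..2 * pi} (\<lambda>\<theta>. (norm (\<Sum>n. a n * w ^ n * cis (real n * \<theta>)))\<^sup>2))"
    by (rule parseval)
  moreover have "(\<Sum>n. a n * w ^ n * cis (real n * \<theta>)) = k (w * cis \<theta>)" for \<theta>
    using sums_unique[OF k[of "w * cis \<theta>"]] w
    by (simp add: norm_mult power_mult_distrib Complex.DeMoivre mult.assoc)
  moreover have "(norm (a n * w ^ n))\<^sup>2 = (norm (a n))\<^sup>2 * (norm w)\<^sup>2 ^ n" for n
    by (simp add: norm_mult norm_power power_mult_distrib power_mult[symmetric] mult.commute)
  ultimately show ?thesis by simp
qed

text \<open>
  Cauchy--Schwarz against the geometric series.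
\<close>

lemma power_series_growth:
  fixes a :: "nat \<Rightarrow> complex"
  assumes S: "(\<lambda>n. (norm (a n))\<^sup>2) sums S" and z: "norm z < 1" and k: "(\<lambda>n. a n * z ^ n) sums k"
  shows "(norm k)\<^sup>2 * (1 - (norm z)\<^sup>2) \<le> S"
proof -
  have z2: "(norm z)\<^sup>2 < 1" using z by (simp add: abs_square_less_1)
  have geo: "(\<lambda>n. ((norm z)\<^sup>2) ^ n) sums (1 / (1 - (norm z)\<^sup>2))"
    using geometric_sums[of "(norm z)\<^sup>2"] z2 by simp
  have "(norm (\<Sum>n<N. a n * z ^ n))\<^sup>2 \<le> S * (1 / (1 - (norm z)\<^sup>2))" for N
  proof -
    have "(norm (\<Sum>n<N. a n * z ^ n))\<^sup>2 \<le> (\<Sum>n<N. norm (a n) * norm z ^ n)\<^sup>2"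
      by (intro power_mono order_trans[OF norm_sum]) (auto simp: norm_mult norm_power)
    also have "\<dots> \<le> (\<Sum>n<N. (norm (a n))\<^sup>2) * (\<Sum>n<N. (norm z ^ n)\<^sup>2)"
      by (rule Cauchy_Schwarz_ineq_sum)
    also have "\<dots> \<le> S * (1 / (1 - (norm z)\<^sup>2))"
    proof (rule mult_mono)
      show "(\<Sum>n<N. (norm (a n))\<^sup>2) \<le> S"
        using sum_le_suminf[OF sums_summable[OF S], of "{..<N}"] sums_unique[OF S] by simp
      have "(\<Sum>n<N. ((norm z)\<^sup>2) ^ n) \<le> 1 / (1 - (norm z)\<^sup>2)"
        using sum_le_suminf[OF sums_summable[OF geo], of "{..<N}"] sums_unique[OF geo] by simp
      then show "(\<Sum>n<N. (norm z ^ n)\<^sup>2) \<le> 1 / (1 - (norm z)\<^sup>2)"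
        by (simp add: power_mult[symmetric] mult.commute)
      show "0 \<le> S" using sums_le[OF _ sums_zero S] by simp
    qed (auto intro: sum_nonneg)
    finally show ?thesis .
  qed
  moreover have "(\<lambda>N. (norm (\<Sum>n<N. a n * z ^ n))\<^sup>2) \<longlonglongrightarrow> (norm k)\<^sup>2"
    using k unfolding sums_def by (intro tendsto_intros)
  ultimately have "(norm k)\<^sup>2 \<le> S * (1 / (1 - (norm z)\<^sup>2))"
    by (intro LIMSEQ_le_const2) auto
  then show ?thesis using z2 by (simp add: field_simps)
qed

lemma continuous_on_circle_mean:
  assumes "continuous_on (ball 0 1) f" and "0 < p"
  shows "continuous_on {0..<1} (circle_mean p f)"
proof -
  have "continuous_on ({0..<1} \<times> cbox 0 (2 * pi)) (\<lambda>(r, \<theta>). norm (f (complex_of_real r * cis \<theta>)) powr p)"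
    unfolding case_prod_beta
    by (intro continuous_on_powr' continuous_on_norm continuous_on_compose2[OF assms(1)] continuous_intros)
      (use \<open>0 < p\<close> in \<open>auto simp: norm_mult\<close>)
  then have "continuous_on {0..<1} (\<lambda>r. integral (cbox 0 (2 * pi)) (\<lambda>\<theta>. norm (f (complex_of_real r * cis \<theta>)) powr p))"
    by (rule integral_continuous_on_param)
  then show ?thesis unfolding circle_mean_def[abs_def] by (intro continuous_intros) simp
qed

lemma circle_mean_tendsto_right:
  assumes "f holomorphic_on ball 0 1" and "0 < p" and "0 \<le> r" "r < 1"
  shows "(circle_mean p f \<longlongrightarrow> circle_mean p f r) (at_right r)"
proof -
  have "(circle_mean p f \<longlongrightarrow> circle_mean p f r) (at r within {0..<1})"
    using continuous_on_circle_mean[OF holomorphic_on_imp_continuous_on[OF assms(1)] assms(2)] assms(3,4)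
    by (auto simp: continuous_on_def)
  then have "(circle_mean p f \<longlongrightarrow> circle_mean p f r) (at r within {r..(1 + r) / 2})"
    by (rule tendsto_within_subset) (use assms in auto)
  then show ?thesis using assms(4) by (simp add: at_within_Icc_at_right)
qed

lemma integrable_circle:
  assumes "continuous_on (ball 0 1) f" and "0 < p" and "norm w < 1"
  shows "(\<lambda>\<theta>. norm (f (w * cis \<theta>)) powr p) integrable_on {0..2 * pi}"
  by (intro integrable_continuous_real continuous_on_powr' continuous_on_norm
      continuous_on_compose2[OF assms(1)] continuous_intros)
    (use assms in \<open>auto simp: norm_mult\<close>)

text \<open>
  For a radius \<open>R\<close> with a majorant \<open>k\<close>, the mean of \<open>|f|^p\<close> on the circle of radius \<open>R\<close> is the sum of the
  squared moduli of the Taylor coefficients of \<open>k\<close>. On smaller circles that sum acquires factors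
  less than one, and at single points it is estimated by Cauchy--Schwarz.
\<close>

lemma eventually_mean_bounds:
  assumes f: "f holomorphic_on ball 0 1" and p: "0 < p" and r: "0 \<le> r" "r < 1"
  shows "\<forall>\<^sub>F R in at_right r. r < R \<and> R < 1 \<and>
    (\<forall>s. 0 \<le> s \<and> s \<le> 1 \<longrightarrow> circle_mean p f (R * s) \<le> circle_mean p f R) \<and>
    (\<forall>z. norm z < 1 \<longrightarrow> norm (f (of_real R * z)) powr p * (1 - (norm z)\<^sup>2) \<le> circle_mean p f R)"
  using eventually_power_majorant[OF f p r]
proof eventually_elim
  case (elim R)
  then obtain k \<rho> where \<rho>: "1 < \<rho>" and k: "k holomorphic_on ball 0 \<rho>"
    and le: "\<And>z. z \<in> cball 0 1 \<Longrightarrow> norm (f (of_real R * z)) powr p \<le> (norm (k z))\<^sup>2"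
    and eq: "\<And>z. z \<in> sphere 0 1 \<Longrightarrow> norm (f (of_real R * z)) powr p = (norm (k z))\<^sup>2" by blast
  have R: "0 < R" "r < R" "R < 1" using elim r by auto
  obtain a where a: "summable (\<lambda>n. norm (a n))" "\<And>z. z \<in> cball 0 1 \<Longrightarrow> (\<lambda>n. a n * z ^ n) sums k z"
    using disc_power_series[OF \<rho> k] by blast
  have kcont: "continuous_on (cball 0 1) k"
    using holomorphic_on_imp_continuous_on[OF k] by (rule continuous_on_subset) (use \<rho> in auto)
  note P = parseval_disc[OF a]
  have S: "(\<lambda>n. (norm (a n))\<^sup>2) sums circle_mean p f R"
    using P[of 1] eq by (simp add: circle_mean_def norm_mult)
  have "circle_mean p f (R * s) \<le> circle_mean p f R" if s: "0 \<le> s" "s \<le> 1" for s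
  proof -
    have "circle_mean p f (R * s) \<le>
        1 / (2 * pi) * integral {0..2 * pi} (\<lambda>\<theta>. (norm (k (of_real s * cis \<theta>)))\<^sup>2)"
      unfolding circle_mean_def
    proof (intro mult_left_mono integral_le)
      show "(\<lambda>\<theta>. norm (f (of_real (R * s) * cis \<theta>)) powr p) integrable_on {0..2 * pi}"
        using R s le_less_trans[OF mult_left_le[of s R], of 1]
        by (intro integrable_circle[OF holomorphic_on_imp_continuous_on[OF f] p]) (auto simp: norm_mult)
      show "(\<lambda>\<theta>. (norm (k (of_real s * cis \<theta>)))\<^sup>2) integrable_on {0..2 * pi}"
        by (intro integrable_continuous_real continuous_intros continuous_on_compose2[OF kcont])
          (use s in \<open>auto simp: norm_mult\<close>)
      show "norm (f (of_real (R * s) * cis \<theta>)) powr p \<le> (norm (k (of_real s * cis \<theta>)))\<^sup>2" for \<theta>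
        using le[of "of_real s * cis \<theta>"] s by (simp add: norm_mult mult.assoc)
    qed auto
    also have "\<dots> \<le> circle_mean p f R"
    proof (rule sums_le[OF _ P[of "of_real s"] S])
      show "(norm (a n))\<^sup>2 * (norm (complex_of_real s))\<^sup>2 ^ n \<le> (norm (a n))\<^sup>2" for n
        using s by (intro mult_left_le power_le_one) auto
    qed (use s in auto)
    finally show ?thesis .
  qed
  moreover have "norm (f (of_real R * z)) powr p * (1 - (norm z)\<^sup>2) \<le> circle_mean p f R" if z: "norm z < 1" for z
  proof -
    have "0 \<le> 1 - (norm z)\<^sup>2" using z by (simp add: power_le_one)
    then have "norm (f (of_real R * z)) powr p * (1 - (norm z)\<^sup>2) \<le> (norm (k z))\<^sup>2 * (1 - (norm z)\<^sup>2)"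
      using z by (intro mult_right_mono le) auto
    also have "\<dots> \<le> circle_mean p f R"
      by (rule power_series_growth[OF S z a(2)]) (use z in simp)
    finally show ?thesis .
  qed
  ultimately show ?case using R by blast
qed

lemma circle_mean_mono:
  assumes f: "f holomorphic_on ball 0 1" and p: "0 < p" and "0 \<le> s" "s \<le> r" "r < 1"
  shows "circle_mean p f s \<le> circle_mean p f r"
proof (rule tendsto_lowerbound[OF circle_mean_tendsto_right[OF f p]])
  have "\<forall>\<^sub>F R in at_right r. r < R \<and> (\<forall>s. 0 \<le> s \<and> s \<le> 1 \<longrightarrow> circle_mean p f (R * s) \<le> circle_mean p f R)"
    by (rule eventually_mono[OF eventually_mean_bounds[OF f p]]) (use assms in auto)
  then show "\<forall>\<^sub>F R in at_right r. circle_mean p f s \<le> circle_mean p f R"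
  proof eventually_elim
    case (elim R)
    then show ?case using elim[THEN conjunct2, rule_format, of "s / R"] assms(3,4) by simp
  qed
qed (use assms in auto)

text \<open>
  The pointwise estimate behind the growth of Hardy functions, obtained for exceptional
  radii by letting \<open>R\<close> decrease to \<open>r\<close>.
\<close>

lemma circle_mean_growth:
  assumes f: "f holomorphic_on ball 0 1" and p: "0 < p" and "norm w < r" "r < 1"
  shows "norm (f w) powr p * (1 - (norm w / r)\<^sup>2) \<le> circle_mean p f r"
proof (rule tendsto_le)
  have r: "0 \<le> r" "0 < r" using assms(3) norm_ge_zero[of w] by linarith+
  show "(circle_mean p f \<longlongrightarrow> circle_mean p f r) (at_right r)"
    by (rule circle_mean_tendsto_right[OF f p r(1) assms(4)])
  show "((\<lambda>R. norm (f w) powr p * (1 - (norm w / R)\<^sup>2)) \<longlongrightarrow> norm (f w) powr p * (1 - (norm w / r)\<^sup>2)) (at_right r)"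
    using r by (intro tendsto_intros) auto
  show "\<forall>\<^sub>F R in at_right r. norm (f w) powr p * (1 - (norm w / R)\<^sup>2) \<le> circle_mean p f R"
    using eventually_mean_bounds[OF f p r(1) assms(4)]
  proof eventually_elim
    case (elim R)
    then have "norm (w / of_real R) < 1" using assms(3) r by (simp add: norm_divide)
    then have "norm (f (of_real R * (w / of_real R))) powr p * (1 - (norm (w / of_real R))\<^sup>2) \<le> circle_mean p f R"
      using elim by blast
    then show ?case using elim r by (simp add: norm_divide)
  qed
qed simp

text \<open>
  Monotonicity of the means of \<open>w \<mapsto> f(z + \<rho> sgn u w)\<close>, compared at radius \<open>0\<close> and at radius
  \<open>|u| / \<rho>\<close>.
\<close>

lemma submean_circle:
  assumes f: "f holomorphic_on ball z \<rho>" and p: "0 < p" and u: "norm u < \<rho>"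
  shows "2 * pi * norm (f z) powr p \<le> integral {0..2 * pi} (\<lambda>\<theta>. norm (f (z + u * cis \<theta>)) powr p)"
proof (cases "u = 0")
  case True
  then show ?thesis by simp
next
  case False
  have \<rho>: "0 < \<rho>" using u norm_ge_zero[of u] by linarith
  define h where "h w = f (z + of_real \<rho> * sgn u * w)" for w
  have "h holomorphic_on ball 0 1"
    unfolding h_def
    by (intro holomorphic_on_compose_gen[OF _ f, unfolded o_def] holomorphic_intros)
      (use False \<rho> in \<open>auto simp: dist_norm norm_mult norm_sgn\<close>)
  then have "circle_mean p h 0 \<le> circle_mean p h (norm u / \<rho>)"
    by (rule circle_mean_mono) (use p u \<rho> in auto)
  moreover have "of_real \<rho> * sgn u * (complex_of_real (norm u / \<rho>) * cis \<theta>) = u * cis \<theta>" for \<theta>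
    using False \<rho> by (simp add: sgn_eq)
  ultimately show ?thesis by (simp add: circle_mean_def h_def divide_right_mono field_simps)
qed

section \<open>Sub-mean-value inequality for area, and the Dirichlet integral\<close>

lemma measurable_indicator_continuous:
  assumes "continuous_on A h" and "A \<in> sets borel"
  shows "(\<lambda>w. ennreal (h w) * indicator A w) \<in> borel_measurable borel"
proof -
  have "(\<lambda>w. indicator A w *\<^sub>R h w) \<in> borel_measurable borel"
    by (rule borel_measurable_continuous_on_indicator[OF assms(2,1)])
  then have "(\<lambda>w. ennreal (indicator A w *\<^sub>R h w)) \<in> borel_measurable borel" by measurable
  moreover have "ennreal (indicator A w *\<^sub>R h w) = ennreal (h w) * indicator A w" for w
    by (simp split: split_indicator)
  ultimately show ?thesis by simp
qed

lemma nn_integral_interval: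
  fixes g :: "real \<Rightarrow> real"
  assumes "continuous_on {a..b} g" and "\<And>x. x \<in> {a..b} \<Longrightarrow> 0 \<le> g x"
  shows "(\<integral>\<^sup>+x\<in>{a..b}. ennreal (g x) \<partial>lborel) = ennreal (integral {a..b} g)"
  by (rule nn_integral_has_integral_lebesgue'[OF assms(2) integrable_integral])
    (auto intro: integrable_continuous_real assms(1))

text \<open>
  Averaging over rotations for a density that is the product of a continuous and a radial factor; the
  radial factor is not affected by the average.
\<close>

lemma nn_integral_circle_average:
  fixes h :: "complex \<Rightarrow> real" and \<Phi> :: "real \<Rightarrow> ennreal"
  assumes h: "continuous_on (ball 0 R) h" and nn: "\<And>w. w \<in> ball 0 R \<Longrightarrow> 0 \<le> h w"
    and [measurable]: "\<Phi> \<in> borel_measurable borel"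
  shows "ennreal (2 * pi) * (\<integral>\<^sup>+w\<in>ball 0 R. ennreal (h w) * \<Phi> (norm w) \<partial>lborel) =
    (\<integral>\<^sup>+w\<in>ball 0 R. ennreal (integral {0..2 * pi} (\<lambda>\<theta>. h (w * cis \<theta>))) * \<Phi> (norm w) \<partial>lborel)"
proof -
  have [measurable]: "(\<lambda>w. ennreal (h w) * indicator (ball 0 R) w) \<in> borel_measurable borel"
    by (rule measurable_indicator_continuous[OF h]) simp
  have *: "ennreal (h w) * \<Phi> (norm w) * indicator (ball 0 R) w = ennreal (h w) * indicator (ball 0 R) w * \<Phi> (norm w)" for w
    by (simp add: mult_ac)
  have "(\<lambda>w. ennreal (h w) * \<Phi> (norm w) * indicator (ball 0 R) w) \<in> borel_measurable borel"
    unfolding * by measurable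
  note avg = nn_integral_rotation_average[OF this, symmetric]
  have inner: "(\<integral>\<^sup>+\<theta>\<in>{0..2*pi}. ennreal (h (w * cis \<theta>)) * \<Phi> (norm (w * cis \<theta>)) * indicator (ball 0 R) (w * cis \<theta>) \<partial>lborel) =
      ennreal (integral {0..2 * pi} (\<lambda>\<theta>. h (w * cis \<theta>))) * \<Phi> (norm w) * indicator (ball 0 R) w" for w
  proof (cases "w \<in> ball 0 R")
    case True
    have cont: "continuous_on {0..2*pi} (\<lambda>\<theta>. h (w * cis \<theta>))"
      by (intro continuous_on_compose2[OF h] continuous_intros) (use True in \<open>auto simp: norm_mult\<close>)
    have eq: "ennreal (h (w * cis \<theta>)) * \<Phi> (norm (w * cis \<theta>)) * indicator (ball 0 R) (w * cis \<theta>) * indicator {0..2*pi} \<theta>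
        = ennreal (h (w * cis \<theta>)) * indicator {0..2*pi} \<theta> * \<Phi> (norm w)" for \<theta>
      using True by (simp add: norm_mult mult_ac split: split_indicator)
    have [measurable]: "(\<lambda>\<theta>. ennreal (h (w * cis \<theta>)) * indicator {0..2*pi} \<theta>) \<in> borel_measurable borel"
      by (rule measurable_indicator_continuous[OF cont]) simp
    have "(\<integral>\<^sup>+\<theta>. ennreal (h (w * cis \<theta>)) * indicator {0..2*pi} \<theta> * \<Phi> (norm w) \<partial>lborel) =
       (\<integral>\<^sup>+\<theta>. ennreal (h (w * cis \<theta>)) * indicator {0..2*pi} \<theta> \<partial>lborel) * \<Phi> (norm w)"
      by (rule nn_integral_multc) measurable
    also have "\<dots> = ennreal (integral {0..2*pi} (\<lambda>\<theta>. h (w * cis \<theta>))) * \<Phi> (norm w)"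
      by (subst nn_integral_interval[OF cont]) (use True nn in \<open>auto simp: norm_mult\<close>)
    finally show ?thesis using True by (simp only: eq) simp
  next
    case False
    then show ?thesis by (simp add: norm_mult)
  qed
  show ?thesis unfolding avg inner ..
qed

text \<open>
  After averaging over rotations about \<open>z\<close>, every circular mean is at least the value at the centre.
\<close>

lemma submean_area:
  assumes f: "f holomorphic_on ball z \<rho>" and p: "0 < p" and \<rho>: "0 < \<rho>"
  shows "ennreal (pi * \<rho>\<^sup>2 * norm (f z) powr p) \<le> (\<integral>\<^sup>+w\<in>ball z \<rho>. ennreal (norm (f w) powr p) \<partial>lborel)"
proof -
  have cont: "continuous_on (ball z \<rho>) f" using f by (rule holomorphic_on_imp_continuous_on)
  have c1: "continuous_on (ball z \<rho>) (\<lambda>w. norm (f w) powr p)"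
    by (intro continuous_on_powr' continuous_intros cont) (use p in auto)
  have c2: "continuous_on (ball 0 \<rho>) (\<lambda>u. norm (f (z + u)) powr p)"
    by (intro continuous_on_compose2[OF c1] continuous_intros) (auto simp: dist_norm)
  have "(\<integral>\<^sup>+w\<in>ball z \<rho>. ennreal (norm (f w) powr p) \<partial>lborel) =
      (\<integral>\<^sup>+w. ennreal (norm (f w) powr p) * indicator (ball z \<rho>) w \<partial>distr lborel borel ((+) z))"
    by (simp add: lborel_distr_plus)
  also have "\<dots> = (\<integral>\<^sup>+u. ennreal (norm (f (z + u)) powr p) * indicator (ball z \<rho>) (z + u) \<partial>lborel)"
    by (rule nn_integral_distr) (use measurable_indicator_continuous[OF c1] in auto)
  also have "\<dots> = (\<integral>\<^sup>+u\<in>ball 0 \<rho>. ennreal (norm (f (z + u)) powr p) * 1 \<partial>lborel)"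
    by (intro nn_integral_cong) (auto simp: dist_norm split: split_indicator)
  finally have eq: "(\<integral>\<^sup>+w\<in>ball z \<rho>. ennreal (norm (f w) powr p) \<partial>lborel) =
    (\<integral>\<^sup>+u\<in>ball 0 \<rho>. ennreal (norm (f (z + u)) powr p) * 1 \<partial>lborel)" .
  have "ennreal (2 * pi) * ennreal (pi * \<rho>\<^sup>2 * norm (f z) powr p)
      = (\<integral>\<^sup>+u\<in>ball 0 \<rho>. ennreal (2 * pi * norm (f z) powr p) \<partial>(lborel :: complex measure))"
    using \<rho> by (subst nn_integral_cmult_indicator)
      (auto simp: emeasure_ball unit_ball_vol_2 ennreal_mult[symmetric] mult_ac)
  also have "\<dots> \<le> (\<integral>\<^sup>+u\<in>ball 0 \<rho>. ennreal (integral {0..2 * pi} (\<lambda>\<theta>. norm (f (z + u * cis \<theta>)) powr p)) * 1 \<partial>lborel)"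
    by (intro nn_integral_mono) (auto split: split_indicator intro!: ennreal_leI submean_circle[OF f p])
  also have "\<dots> = ennreal (2 * pi) * (\<integral>\<^sup>+u\<in>ball 0 \<rho>. ennreal (norm (f (z + u)) powr p) * 1 \<partial>lborel)"
    by (rule nn_integral_circle_average[OF c2, symmetric]) auto
  finally show ?thesis unfolding eq
    by (subst (asm) ennreal_mult_le_mult_iff) auto
qed

lemma nn_integral_beta_weight:
  "(\<integral>\<^sup>+t\<in>{0<..<1}. ennreal (t ^ n * (1 - t)) \<partial>lborel) \<le> ennreal (1 / (real n + 1)\<^sup>2)"
proof -
  have "((\<lambda>t::real. t ^ n * (1 - t)) has_integral
      (1 ^ Suc n / (real n + 1) - 1 ^ Suc (Suc n) / (real n + 2)) - (0 ^ Suc n / (real n + 1) - 0 ^ Suc (Suc n) / (real n + 2))) {0..1}"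
  proof (rule fundamental_theorem_of_calculus)
    fix x :: real assume "x \<in> {0..1}"
    have D: "((\<lambda>t. t ^ Suc m / (real m + 1)) has_real_derivative x ^ m) (at x within {0..1})" for m
      by (rule DERIV_cong[OF DERIV_cdivide[OF DERIV_pow]]) (simp add: add.commute)
    have "((\<lambda>t. t ^ Suc n / (real n + 1) - t ^ Suc (Suc n) / (real n + 2)) has_real_derivative x ^ n - x ^ Suc n)
        (at x within {0..1})"
      using DERIV_diff[OF D[of n] D[of "Suc n"]] by (simp add: add.commute add.left_commute del: power_Suc)
    then show "((\<lambda>t. t ^ Suc n / (real n + 1) - t ^ Suc (Suc n) / (real n + 2)) has_vector_derivative x ^ n * (1 - x)) (at x within {0..1})"
      by (simp add: has_real_derivative_iff_has_vector_derivative algebra_simps)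
  qed simp
  then have "(\<integral>\<^sup>+t\<in>{0..1}. ennreal (t ^ n * (1 - t)) \<partial>lborel) = ennreal (1 / (real n + 1) - 1 / (real n + 2))"
    by (subst nn_integral_has_integral_lebesgue') auto
  moreover have "(\<integral>\<^sup>+t\<in>{0<..<1}. ennreal (t ^ n * (1 - t)) \<partial>lborel) \<le> (\<integral>\<^sup>+t\<in>{0..1}. ennreal (t ^ n * (1 - t)) \<partial>lborel)"
    by (intro nn_integral_mono) (auto split: split_indicator)
  moreover have "1 / (real n + 1) - 1 / (real n + 2) \<le> 1 / (real n + 1)\<^sup>2"
  proof -
    have "1 / (real n + 1) - 1 / (real n + 2) = 1 / ((real n + 1) * (real n + 2))" by (simp add: field_simps)
    also have "\<dots> \<le> 1 / ((real n + 1) * (real n + 1))" by (intro divide_left_mono mult_left_mono) auto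
    finally show ?thesis by (simp add: power2_eq_square)
  qed
  ultimately show ?thesis by (metis (no_types, lifting) ennreal_leI order_trans order.refl)
qed

text \<open>
  By Parseval's identity for \<open>k'\<close> on each circle, the coefficient \<open>a\<close> of order \<open>n + 1\<close> contributes
  \<open>(n + 1)\<^sup>2 |a|\<^sup>2\<close> times a radial integral that is at most \<open>\<pi> / (n + 1)\<^sup>2\<close>. Summation gives back the sum
  of the squared coefficients, which is the mean of \<open>|k|\<^sup>2\<close>.
\<close>

lemma dirichlet_integral_le_hardy:
  assumes "1 < \<rho>" and k: "k holomorphic_on ball 0 \<rho>"
  shows "(\<integral>\<^sup>+w\<in>ball 0 1. ennreal ((norm (deriv k w))\<^sup>2 * (1 - (norm w)\<^sup>2)) \<partial>lborel)
    \<le> ennreal (1 / 2 * integral {0..2 * pi} (\<lambda>\<theta>. (norm (k (cis \<theta>)))\<^sup>2))"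
proof -
  have k': "deriv k holomorphic_on ball 0 \<rho>" using k by (rule holomorphic_deriv) simp
  obtain a where a: "summable (\<lambda>n. norm (a n))" "\<And>z. z \<in> cball 0 1 \<Longrightarrow> (\<lambda>n. a n * z ^ n) sums k z"
      "\<And>n. a n = (deriv ^^ n) k 0 / fact n"
    using disc_power_series[OF assms] by blast
  obtain b where b: "summable (\<lambda>n. norm (b n))" "\<And>z. z \<in> cball 0 1 \<Longrightarrow> (\<lambda>n. b n * z ^ n) sums deriv k z"
      "\<And>n. b n = (deriv ^^ n) (deriv k) 0 / fact n"
    using disc_power_series[OF assms(1) k'] by blast
  have ba: "b n = of_nat (Suc n) * a (Suc n)" for n
    unfolding a(3) b(3) by (simp add: funpow_Suc_right del: funpow.simps of_nat_Suc)
  have S: "(\<lambda>n. (norm (a n))\<^sup>2) sums (1 / (2 * pi) * integral {0..2 * pi} (\<lambda>\<theta>. (norm (k (cis \<theta>)))\<^sup>2))" (is "_ sums ?S")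
    using parseval_disc[OF a(1,2), of 1] by simp
  have cont: "continuous_on (ball 0 1) (\<lambda>w. (norm (deriv k w))\<^sup>2)"
    using holomorphic_on_imp_continuous_on[OF k'] \<open>1 < \<rho>\<close>
    by (auto intro!: continuous_intros elim: continuous_on_subset)
  define J where "J w = integral {0..2 * pi} (\<lambda>\<theta>. (norm (deriv k (w * cis \<theta>)))\<^sup>2)" for w
  have J: "ennreal (J w) * ennreal (1 - (norm w)\<^sup>2) * indicator (ball 0 1) w =
      (\<Sum>n. ennreal (2 * pi * (norm (b n))\<^sup>2) * (ennreal (((norm w)\<^sup>2) ^ n * (1 - (norm w)\<^sup>2)) * indicator (ball 0 1) w))" for w
  proof (cases "w \<in> ball 0 1")
    case True
    then have w: "norm w \<le> 1" "(norm w)\<^sup>2 \<le> 1" by (auto simp: power_le_one)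
    have "(\<lambda>n. (norm (b n))\<^sup>2 * (norm w)\<^sup>2 ^ n) sums (1 / (2 * pi) * J w)"
      unfolding J_def by (rule parseval_disc[OF b(1,2) w(1)])
    from sums_mult[OF this, of "2 * pi * (1 - (norm w)\<^sup>2)"]
    have "(\<lambda>n. 2 * pi * (norm (b n))\<^sup>2 * (((norm w)\<^sup>2) ^ n * (1 - (norm w)\<^sup>2))) sums
        (2 * pi * (1 - (norm w)\<^sup>2) * (1 / (2 * pi) * J w))"
      by (simp only: mult_ac)
    moreover have "2 * pi * (1 - (norm w)\<^sup>2) * (1 / (2 * pi) * J w) = J w * (1 - (norm w)\<^sup>2)"
      by (simp add: field_simps)
    ultimately have "(\<lambda>n. 2 * pi * (norm (b n))\<^sup>2 * (((norm w)\<^sup>2) ^ n * (1 - (norm w)\<^sup>2))) sums (J w * (1 - (norm w)\<^sup>2))"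
      by (simp only:)
    then have "(\<Sum>n. ennreal (2 * pi * (norm (b n))\<^sup>2 * (((norm w)\<^sup>2) ^ n * (1 - (norm w)\<^sup>2)))) = ennreal (J w * (1 - (norm w)\<^sup>2))"
      using w by (intro suminf_ennreal_eq) simp_all
    then show ?thesis using True w by (simp add: ennreal_mult'')
  next
    case False
    then show ?thesis by simp
  qed
  have bound: "(\<integral>\<^sup>+w\<in>ball 0 1. ennreal (((norm (w::complex))\<^sup>2) ^ n * (1 - (norm w)\<^sup>2)) \<partial>lborel) \<le> ennreal (pi / (real n + 1)\<^sup>2)" for n
  proof -
    have "(\<integral>\<^sup>+w\<in>ball 0 1. ennreal (((norm (w::complex))\<^sup>2) ^ n * (1 - (norm w)\<^sup>2)) \<partial>lborel) =
        ennreal pi * (\<integral>\<^sup>+t\<in>{0<..<1}. ennreal (t ^ n * (1 - t)) \<partial>lborel)"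
      by (rule nn_integral_radial) measurable
    also have "\<dots> \<le> ennreal pi * ennreal (1 / (real n + 1)\<^sup>2)"
      by (intro mult_left_mono nn_integral_beta_weight) simp
    finally show ?thesis by (simp add: ennreal_mult'[symmetric])
  qed
  have "ennreal (2 * pi) * (\<integral>\<^sup>+w\<in>ball 0 1. ennreal ((norm (deriv k w))\<^sup>2) * ennreal (1 - (norm w)\<^sup>2) \<partial>lborel)
      = (\<integral>\<^sup>+w\<in>ball 0 1. ennreal (J w) * ennreal (1 - (norm w)\<^sup>2) \<partial>lborel)"
    unfolding J_def by (rule nn_integral_circle_average[OF cont, where \<Phi> = "\<lambda>x. ennreal (1 - x\<^sup>2)"]) auto
  also have "\<dots> = (\<Sum>n. \<integral>\<^sup>+w. ennreal (2 * pi * (norm (b n))\<^sup>2) * (ennreal (((norm (w::complex))\<^sup>2) ^ n * (1 - (norm w)\<^sup>2)) * indicator (ball 0 1) w) \<partial>lborel)"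
    unfolding J by (rule nn_integral_suminf) (auto intro!: borel_measurable_times_ennreal borel_measurable_indicator)
  also have "\<dots> = (\<Sum>n. ennreal (2 * pi * (norm (b n))\<^sup>2) * (\<integral>\<^sup>+w\<in>ball 0 1. ennreal (((norm (w::complex))\<^sup>2) ^ n * (1 - (norm w)\<^sup>2)) \<partial>lborel))"
    by (intro suminf_cong nn_integral_cmult) (auto intro!: borel_measurable_times_ennreal borel_measurable_indicator)
  also have "\<dots> \<le> (\<Sum>n. ennreal (2 * pi * pi * (norm (a (Suc n)))\<^sup>2))"
  proof (intro suminf_le allI)
    fix n
    have "ennreal (2 * pi * (norm (b n))\<^sup>2) * (\<integral>\<^sup>+w\<in>ball 0 1. ennreal (((norm (w::complex))\<^sup>2) ^ n * (1 - (norm w)\<^sup>2)) \<partial>lborel)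
        \<le> ennreal (2 * pi * (norm (b n))\<^sup>2) * ennreal (pi / (real n + 1)\<^sup>2)"
      by (intro mult_left_mono bound) simp
    also have "\<dots> = ennreal (2 * pi * pi * (norm (a (Suc n)))\<^sup>2)"
      by (simp add: ba norm_mult power_mult_distrib ennreal_mult'[symmetric] add.commute del: of_nat_Suc)
        (simp add: field_simps)
    finally show "ennreal (2 * pi * (norm (b n))\<^sup>2) * (\<integral>\<^sup>+w\<in>ball 0 1. ennreal (((norm (w::complex))\<^sup>2) ^ n * (1 - (norm w)\<^sup>2)) \<partial>lborel)
        \<le> ennreal (2 * pi * pi * (norm (a (Suc n)))\<^sup>2)" .
  qed auto
  also have "\<dots> \<le> ennreal (2 * pi * pi * ?S)"
  proof -
    have "(\<lambda>n. (norm (a (Suc n)))\<^sup>2) sums (?S - (norm (a 0))\<^sup>2)"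
      using sums_Suc_iff[of "\<lambda>n. (norm (a n))\<^sup>2"] S by simp
    from sums_mult[OF this, of "2 * pi * pi"]
    have "(\<lambda>n. 2 * pi * pi * (norm (a (Suc n)))\<^sup>2) sums (2 * pi * pi * (?S - (norm (a 0))\<^sup>2))" by simp
    then have "(\<Sum>n. ennreal (2 * pi * pi * (norm (a (Suc n)))\<^sup>2)) = ennreal (2 * pi * pi * (?S - (norm (a 0))\<^sup>2))"
      by (intro suminf_ennreal_eq) auto
    also have "\<dots> \<le> ennreal (2 * pi * pi * ?S)"
      by (intro ennreal_leI mult_left_mono) auto
    finally show ?thesis .
  qed
  also have "\<dots> = ennreal (2 * pi) * ennreal (1 / 2 * integral {0..2 * pi} (\<lambda>\<theta>. (norm (k (cis \<theta>)))\<^sup>2))"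
    by (simp add: ennreal_mult'[symmetric] field_simps)
  finally have "(\<integral>\<^sup>+w\<in>ball 0 1. ennreal ((norm (deriv k w))\<^sup>2) * ennreal (1 - (norm w)\<^sup>2) \<partial>lborel)
    \<le> ennreal (1 / 2 * integral {0..2 * pi} (\<lambda>\<theta>. (norm (k (cis \<theta>)))\<^sup>2))"
    by (subst (asm) ennreal_mult_le_mult_iff) auto
  then show ?thesis by (simp add: ennreal_mult')
qed

section \<open>Growth in Hardy spaces\<close>

lemma hardy_mean_eq: "hardy_mean p f r = circle_mean p f r powr (1 / p)"
  by (simp add: hardy_mean_def circle_mean_def)

lemma circle_mean_nonneg: "0 \<le> circle_mean p f r"
  unfolding circle_mean_def
  by (cases "(\<lambda>\<theta>. norm (f (complex_of_real r * cis \<theta>)) powr p) integrable_on {0..2 * pi}")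
    (simp_all add: integral_nonneg not_integrable_integral)

lemma hardy_mean_nonneg: "0 \<le> hardy_mean p f r"
  by (simp add: hardy_mean_eq)

lemma hardy_mean_mono:
  assumes "f holomorphic_on ball 0 1" and "0 < p" and "0 \<le> s" "s \<le> r" "r < 1"
  shows "hardy_mean p f s \<le> hardy_mean p f r"
  unfolding hardy_mean_eq using assms
  by (intro powr_mono2 circle_mean_mono circle_mean_nonneg) auto

text \<open>
  The means increase with the radius, so that a bound for them already makes them converge.
\<close>

lemma hardy_spaceI:
  assumes F: "F holomorphic_on ball 0 1" and q: "0 < q"
    and B: "\<And>r. 0 < r \<Longrightarrow> r < 1 \<Longrightarrow> hardy_mean q F r \<le> B"
  shows "F \<in> hardy_space q" and "hardy_norm q F \<le> B"
proof -
  define L where "L = (SUP r\<in>{0<..<1}. hardy_mean q F r)"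
  have bdd: "bdd_above (hardy_mean q F ` {0<..<1})" using B by (intro bdd_aboveI2[where M = B]) auto
  have near: "\<forall>\<^sub>F r in at_left 1. r \<in> {s<..<1}" if "s < 1" for s :: real
    using that by (rule eventually_at_left_real)
  have lim: "(hardy_mean q F \<longlongrightarrow> L) (at_left 1)"
  proof (rule increasing_tendsto)
    show "\<forall>\<^sub>F r in at_left 1. hardy_mean q F r \<le> L"
      using near[of 0] by (auto simp: L_def intro!: cSUP_upper bdd elim!: eventually_mono)
    fix x assume "x < L"
    then obtain s where s: "0 < s" "s < 1" "x < hardy_mean q F s"
      unfolding L_def by (subst (asm) less_cSUP_iff) (use bdd in auto)
    show "\<forall>\<^sub>F r in at_left 1. x < hardy_mean q F r"
      using near[OF s(2)]
    proof eventually_elim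
      case (elim r)
      then show ?case using hardy_mean_mono[OF F q, of s r] s by simp
    qed
  qed
  then show "F \<in> hardy_space q" using F by (auto simp: hardy_space_def)
  have "hardy_norm q F = L"
    unfolding hardy_norm_def by (rule tendsto_Lim[OF _ lim]) simp
  also have "L \<le> B" unfolding L_def by (rule cSUP_least) (use B in auto)
  finally show "hardy_norm q F \<le> B" .
qed

lemma hardy_mean_le_norm:
  assumes F: "F \<in> hardy_space q" and q: "0 < q" and r: "0 \<le> r" "r < 1"
  shows "hardy_mean q F r \<le> hardy_norm q F"
proof -
  have hol: "F holomorphic_on ball 0 1" using F by (simp add: hardy_space_def)
  obtain L where lim: "(hardy_mean q F \<longlongrightarrow> L) (at_left 1)" using F by (auto simp: hardy_space_def)
  have "hardy_norm q F = L"
    unfolding hardy_norm_def by (rule tendsto_Lim[OF _ lim]) simp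
  moreover have "hardy_mean q F r \<le> L"
  proof (rule tendsto_lowerbound[OF lim])
    have "\<forall>\<^sub>F s in at_left 1. s \<in> {r<..<1}" using r(2) by (rule eventually_at_left_real)
    then show "\<forall>\<^sub>F s in at_left 1. hardy_mean q F r \<le> hardy_mean q F s"
    proof eventually_elim
      case (elim s)
      then show ?case using hardy_mean_mono[OF hol q, of r s] r by simp
    qed
  qed simp
  ultimately show ?thesis by simp
qed

lemma hardy_norm_nonneg:
  assumes "F \<in> hardy_space q" and "0 < q"
  shows "0 \<le> hardy_norm q F"
  using hardy_mean_le_norm[OF assms, of 0] hardy_mean_nonneg[of q F 0] by simp

lemma circle_mean_le_norm:
  assumes "F \<in> hardy_space q" and q: "0 < q" and "0 \<le> r" "r < 1"
  shows "circle_mean q F r \<le> hardy_norm q F powr q"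
proof -
  have "circle_mean q F r = hardy_mean q F r powr q"
    using q circle_mean_nonneg[of q F r] by (simp add: hardy_mean_eq powr_powr)
  also have "\<dots> \<le> hardy_norm q F powr q"
    using assms by (intro powr_mono2 hardy_mean_le_norm hardy_mean_nonneg) auto
  finally show ?thesis .
qed

lemma hardy_growth:
  assumes F: "F \<in> hardy_space q" and q: "0 < q" and w: "norm w < 1"
  shows "norm (F w) \<le> hardy_norm q F * (1 - norm w) powr (- (1 / q))"
proof -
  have hol: "F holomorphic_on ball 0 1" using F by (simp add: hardy_space_def)
  have "norm (F w) powr q * (1 - (norm w / 1)\<^sup>2) \<le> hardy_norm q F powr q"
  proof (rule tendsto_upperbound)
    show "((\<lambda>r. norm (F w) powr q * (1 - (norm w / r)\<^sup>2)) \<longlongrightarrow> norm (F w) powr q * (1 - (norm w / 1)\<^sup>2)) (at_left 1)"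
      by (intro tendsto_intros) auto
    have "\<forall>\<^sub>F r in at_left 1. r \<in> {norm w<..<1}" using w by (rule eventually_at_left_real)
    then show "\<forall>\<^sub>F r in at_left 1. norm (F w) powr q * (1 - (norm w / r)\<^sup>2) \<le> hardy_norm q F powr q"
    proof eventually_elim
      case (elim r)
      have "0 \<le> r" using elim norm_ge_zero[of w] by (simp del: norm_ge_zero)
      then show ?case
        using order_trans[OF circle_mean_growth[OF hol q, of w r] circle_mean_le_norm[OF F q, of r]] elim by auto
    qed
  qed simp
  moreover have "norm (F w) powr q * (1 - norm w) \<le> norm (F w) powr q * (1 - (norm w / 1)\<^sup>2)"
    using w by (intro mult_left_mono) (auto simp: power2_eq_square mult_left_le)
  ultimately have "norm (F w) powr q \<le> hardy_norm q F powr q * (1 - norm w) powr (- 1)"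
    using w by (simp add: powr_minus field_simps)
  then have "(norm (F w) powr q) powr (1 / q) \<le> (hardy_norm q F powr q * (1 - norm w) powr (- 1)) powr (1 / q)"
    using q by (intro powr_mono2) auto
  then show ?thesis
    using q hardy_norm_nonneg[OF F q] w
    by (simp add: powr_powr powr_divide powr_minus_divide)
qed

text \<open>
  Cauchy's inequality on the circle about \<open>w\<close> whose radius is half the distance to the boundary.
\<close>

lemma hardy_deriv_growth:
  assumes F: "F \<in> hardy_space q" and q: "0 < q" and w: "norm w < 1"
  shows "norm (deriv F w) \<le> hardy_norm q F * ((1 - norm w) / 2) powr (- (1 + 1 / q))"
proof -
  define d where "d = (1 - norm w) / 2"
  have d: "0 < d" "norm w + d < 1" using w by (auto simp: d_def field_simps)
  have hol: "F holomorphic_on ball 0 1" using F by (simp add: hardy_space_def)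
  have sub: "cball w d \<subseteq> ball 0 1"
  proof
    fix z assume "z \<in> cball w d"
    then have "norm z \<le> norm w + d" using norm_triangle_ineq[of w "z - w"] by (simp add: dist_norm norm_minus_commute)
    then show "z \<in> ball 0 1" using d by simp
  qed
  have "norm ((deriv ^^ 1) F w) \<le> fact 1 * (hardy_norm q F * d powr (- (1 / q))) / d ^ 1"
  proof (rule Cauchy_inequality)
    show "F holomorphic_on ball w d" "continuous_on (cball w d) F"
      using sub hol holomorphic_on_subset ball_subset_cball
      by (blast, meson holomorphic_on_imp_continuous_on continuous_on_subset)
    fix x assume x: "norm (w - x) = d"
    have "norm x \<le> norm w + d"
      using x norm_triangle_ineq[of w "x - w"] by (simp add: norm_minus_commute)
    moreover have "norm w + 2 * d = 1" by (simp add: d_def field_simps)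
    ultimately have nx: "norm x < 1" "d \<le> 1 - norm x" using d by linarith+
    have "norm (F x) \<le> hardy_norm q F * (1 - norm x) powr (- (1 / q))"
      by (rule hardy_growth[OF F q nx(1)])
    also have "\<dots> \<le> hardy_norm q F * d powr (- (1 / q))"
      using nx d q hardy_norm_nonneg[OF F q] by (intro mult_left_mono powr_mono2') auto
    finally show "norm (F x) \<le> hardy_norm q F * d powr (- (1 / q))" .
  qed (use d in auto)
  also have "fact 1 * (hardy_norm q F * d powr (- (1 / q))) / d ^ 1 = hardy_norm q F * d powr (- (1 + 1 / q))"
    using d(1) by (simp add: powr_diff powr_minus powr_add field_simps)
  finally show ?thesis by (simp add: d_def)
qed

section \<open>Test functions\<close>

text \<open>
  With \<open>u = 1 - t\<close>, the function \<open>u^p (u + \<delta>)^(-p) / (p \<delta>)\<close> is an explicit antiderivative up to sign.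
\<close>

lemma nn_integral_interval_weight:
  fixes p \<delta> :: real
  assumes "0 < p" "0 < \<delta>"
  shows "(\<integral>\<^sup>+t\<in>{0<..<1}. ennreal ((1 - t) powr (p - 1) * (1 - t + \<delta>) powr (- p - 1)) \<partial>lborel) \<le> ennreal (1 / (p * \<delta>))"
proof -
  define F where "F t = - ((1 - t) powr p * (1 - t + \<delta>) powr (- p) / (p * \<delta>))" for t :: real
  have "((\<lambda>t. (1 - t) powr (p - 1) * (1 - t + \<delta>) powr (- p - 1)) has_integral F 1 - F 0) {0..1}"
  proof (rule fundamental_theorem_of_calculus_interior)
    show "continuous_on {0..1} F"
      unfolding F_def using assms
      by (intro continuous_intros continuous_on_powr') auto
    fix x :: real assume x: "x \<in> {0<..<1}"
    define u where "u = 1 - x"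
    have u: "0 < u" "0 < u + \<delta>" using x assms by (auto simp: u_def)
    have "(F has_real_derivative - ((- p * u powr (p - 1) * (u + \<delta>) powr (- p) + u powr p * (p * (u + \<delta>) powr (- p - 1))) / (p * \<delta>))) (at x)"
      unfolding F_def using x assms
      by (auto intro!: derivative_eq_intros simp: u_def)
    moreover have "- ((- p * u powr (p - 1) * (u + \<delta>) powr (- p) + u powr p * (p * (u + \<delta>) powr (- p - 1))) / (p * \<delta>)) =
        u powr (p - 1) * (u + \<delta>) powr (- p - 1)"
    proof -
      have "u powr p = u powr (p - 1) * u" "(u + \<delta>) powr (- p) = (u + \<delta>) powr (- p - 1) * (u + \<delta>)"
        using u by (simp_all add: powr_diff)
      then have "- (- p * u powr (p - 1) * (u + \<delta>) powr (- p) + u powr p * (p * (u + \<delta>) powr (- p - 1))) =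
        (p * \<delta>) * (u powr (p - 1) * (u + \<delta>) powr (- p - 1))" by (simp add: algebra_simps)
      then show ?thesis using assms by (simp add: field_simps)
    qed
    ultimately show "(F has_vector_derivative (1 - x) powr (p - 1) * (1 - x + \<delta>) powr (- p - 1)) (at x)"
      by (simp add: has_real_derivative_iff_has_vector_derivative u_def)
  qed simp
  then have "(\<integral>\<^sup>+t\<in>{0..1}. ennreal ((1 - t) powr (p - 1) * (1 - t + \<delta>) powr (- p - 1)) \<partial>lborel) = ennreal (F 1 - F 0)"
    by (subst nn_integral_has_integral_lebesgue') auto
  moreover have "(\<integral>\<^sup>+t\<in>{0<..<1}. ennreal ((1 - t) powr (p - 1) * (1 - t + \<delta>) powr (- p - 1)) \<partial>lborel)
      \<le> (\<integral>\<^sup>+t\<in>{0..1}. ennreal ((1 - t) powr (p - 1) * (1 - t + \<delta>) powr (- p - 1)) \<partial>lborel)"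
    by (intro nn_integral_mono) (auto split: split_indicator)
  moreover have "F 1 - F 0 \<le> 1 / (p * \<delta>)"
  proof -
    have "(1 + \<delta>) powr (- p) \<le> 1" using assms powr_mono2'[of "-p" 1 "1 + \<delta>"] by simp
    then show ?thesis using assms by (simp add: F_def divide_right_mono)
  qed
  ultimately show ?thesis by (metis (no_types, lifting) ennreal_leI order_trans order.refl)
qed

text \<open>
  For \<open>s = 2\<close> this is the mean of the Poisson kernel; for larger exponents the excess is estimated
  by the minimum \<open>1 - |c|\<close> of the modulus on the circle.
\<close>

lemma kernel_circle_mean:
  fixes c :: complex
  assumes c: "norm c < 1" and s: "2 \<le> s"
  shows "integral {0..2 * pi} (\<lambda>\<theta>. norm (1 - c * cis \<theta>) powr (- s)) \<le> 2 * pi * (1 - norm c) powr (1 - s)"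
proof -
  have lower: "1 - norm c \<le> norm (1 - c * cis \<theta>)" for \<theta>
    using norm_triangle_ineq2[of 1 "c * cis \<theta>"] by (simp add: norm_mult)
  have pos: "0 < norm (1 - c * cis \<theta>)" for \<theta> using lower[of \<theta>] c by linarith
  have "integral {0..2 * pi} (\<lambda>\<theta>. norm (1 - c * cis \<theta>) powr (- s)) \<le>
      integral {0..2 * pi} (\<lambda>\<theta>. (1 - norm c) powr (2 - s) * norm (1 - c * cis \<theta>) powr (- 2))"
  proof (rule integral_le)
    show "(\<lambda>\<theta>. norm (1 - c * cis \<theta>) powr (- s)) integrable_on {0..2 * pi}"
      by (intro integrable_continuous_real continuous_intros) (use pos in \<open>auto simp: less_le\<close>)
    show "(\<lambda>\<theta>. (1 - norm c) powr (2 - s) * norm (1 - c * cis \<theta>) powr (- 2)) integrable_on {0..2 * pi}"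
      by (intro integrable_continuous_real continuous_intros) (use pos in \<open>auto simp: less_le\<close>)
    fix \<theta>
    have "norm (1 - c * cis \<theta>) powr (- s) = norm (1 - c * cis \<theta>) powr (2 - s) * norm (1 - c * cis \<theta>) powr (- 2)"
      by (simp only: powr_add[symmetric]) simp
    also have "\<dots> \<le> (1 - norm c) powr (2 - s) * norm (1 - c * cis \<theta>) powr (- 2)"
      using s c lower by (intro mult_right_mono powr_mono2') auto
    finally show "norm (1 - c * cis \<theta>) powr (- s) \<le> (1 - norm c) powr (2 - s) * norm (1 - c * cis \<theta>) powr (- 2)" .
  qed
  also have "\<dots> = (1 - norm c) powr (2 - s) * (2 * pi / (1 - (norm c)\<^sup>2))"
    by (subst integral_mult_right) (simp add: integral_unique[OF poisson_mean[OF c]])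
  also have "\<dots> \<le> (1 - norm c) powr (2 - s) * (2 * pi / (1 - norm c))"
    using c by (intro mult_left_mono divide_left_mono mult_pos_pos) (auto simp: power2_eq_square mult_left_le abs_square_less_1[unfolded power2_eq_square])
  also have "\<dots> = 2 * pi * (1 - norm c) powr (1 - s)"
    using c by (simp add: powr_diff field_simps power2_eq_square)
  finally show ?thesis .
qed


text \<open>
  The average over rotations leaves \<open>(1 - |a| |w|)^(1 - s)\<close>. Since \<open>3 (1 - |a| |w|)\<close> is at least the sum of
  \<open>1 - |w|\<^sup>2\<close> and \<open>\<delta> = 1 - |a|\<close>, and \<open>s \<ge> p + 2\<close>, the excess over the exponent \<open>-p - 1\<close> can be traded
  for powers of \<open>\<delta>\<close>, and the explicit one-dimensional integral remains.
\<close>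

lemma dirichlet_kernel_integral:
  fixes a :: complex
  assumes p: "0 < p" and s: "2 \<le> s" "p + 2 \<le> s" and a: "norm a < 1"
  shows "(\<integral>\<^sup>+w\<in>ball 0 1. ennreal (norm (1 - cnj a * w) powr (- s) * (1 - (norm w)\<^sup>2) powr (p - 1)) \<partial>lborel)
    \<le> ennreal (3 powr (s - 1) * pi / p * (1 - norm a) powr (p + 1 - s))"
proof -
  define \<delta> where "\<delta> = 1 - norm a"
  have \<delta>: "0 < \<delta>" using a by (simp add: \<delta>_def)
  define \<Phi> where "\<Phi> x = ennreal ((1 - x\<^sup>2) powr (p - 1))" for x :: real
  have [measurable]: "\<Phi> \<in> borel_measurable borel" unfolding \<Phi>_def by measurable
  have small: "norm (cnj a * w) < 1" if "w \<in> ball 0 1" for w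
    using that a mult_strict_mono'[of "norm a" 1 "norm w" 1] by (simp add: norm_mult)
  have nz: "1 - cnj a * w \<noteq> 0" if "w \<in> ball 0 1" for w
    using small[OF that] by (metis eq_iff_diff_eq_0 less_irrefl norm_one)
  have cont: "continuous_on (ball 0 1) (\<lambda>w. norm (1 - cnj a * w) powr (- s))"
    by (intro continuous_intros) (use nz in auto)
  define c where "c = 2 * pi * 3 powr (s - 1) * \<delta> powr (p + 2 - s)"
  have c: "0 \<le> c" by (simp add: c_def)
  have key: "integral {0..2 * pi} (\<lambda>\<theta>. norm (1 - cnj a * (w * cis \<theta>)) powr (- s)) * (1 - (norm w)\<^sup>2) powr (p - 1)
      \<le> c * ((1 - (norm w)\<^sup>2) powr (p - 1) * (1 - (norm w)\<^sup>2 + \<delta>) powr (- p - 1))" if w: "w \<in> ball 0 1" for w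
  proof -
    have nw: "norm w < 1" "0 \<le> 1 - (norm w)\<^sup>2" using w by (auto simp: power_le_one)
    define y where "y = 1 - (norm w)\<^sup>2 + \<delta>"
    have y: "0 < y" "\<delta> \<le> y" using nw \<delta> by (auto simp: y_def)
    have ge: "y / 3 \<le> 1 - norm a * norm w"
    proof -
      have "norm a * norm w \<le> norm a" "norm a * norm w \<le> norm w"
        using a nw by (auto simp: mult_left_le mult_left_le_one_le)
      moreover have "1 - (norm w)\<^sup>2 \<le> 2 * (1 - norm w)"
        using zero_le_power2[of "1 - norm w"] by (simp add: power2_eq_square algebra_simps)
      ultimately show ?thesis by (simp add: y_def \<delta>_def)
    qed
    have "integral {0..2 * pi} (\<lambda>\<theta>. norm (1 - cnj a * w * cis \<theta>) powr (- s)) \<le> 2 * pi * (1 - norm (cnj a * w)) powr (1 - s)"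
      by (rule kernel_circle_mean[OF small[OF w] s(1)])
    also have "\<dots> \<le> 2 * pi * (y / 3) powr (1 - s)"
      using ge y s by (intro mult_left_mono powr_mono2') (auto simp: norm_mult)
    also have "(y / 3) powr (1 - s) = 3 powr (s - 1) * y powr (p + 2 - s) * y powr (- p - 1)"
    proof -
      have "(y / 3) powr (1 - s) = y powr (1 - s) / 3 powr (1 - s)"
        using y by (simp add: powr_divide)
      moreover have "3 powr (s - 1) = 1 / 3 powr (1 - s)"
        using powr_minus_divide[of 3 "1 - s"] by simp
      moreover have "y powr (1 - s) = y powr (p + 2 - s) * y powr (- p - 1)"
        by (simp add: powr_add[symmetric])
      ultimately show ?thesis by simp
    qed
    also have "2 * pi * (3 powr (s - 1) * y powr (p + 2 - s) * y powr (- p - 1)) \<le>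
        2 * pi * (3 powr (s - 1) * \<delta> powr (p + 2 - s) * y powr (- p - 1))"
      using y s \<delta> by (intro mult_left_mono mult_right_mono powr_mono2') auto
    also have "\<dots> = c * y powr (- p - 1)" by (simp add: c_def)
    finally have "integral {0..2 * pi} (\<lambda>\<theta>. norm (1 - cnj a * w * cis \<theta>) powr (- s)) * (1 - (norm w)\<^sup>2) powr (p - 1)
      \<le> c * y powr (- p - 1) * (1 - (norm w)\<^sup>2) powr (p - 1)" by (intro mult_right_mono) auto
    then show ?thesis by (simp add: mult_ac y_def)
  qed
  have "ennreal (2 * pi) * (\<integral>\<^sup>+w\<in>ball 0 1. ennreal (norm (1 - cnj a * w) powr (- s)) * \<Phi> (norm w) \<partial>lborel)
      = (\<integral>\<^sup>+w\<in>ball 0 1. ennreal (integral {0..2 * pi} (\<lambda>\<theta>. norm (1 - cnj a * (w * cis \<theta>)) powr (- s))) * \<Phi> (norm w) \<partial>lborel)"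
    by (rule nn_integral_circle_average[OF cont]) auto
  also have "\<dots> \<le> (\<integral>\<^sup>+w. ennreal c * (ennreal ((1 - (norm (w::complex))\<^sup>2) powr (p - 1) * (1 - (norm w)\<^sup>2 + \<delta>) powr (- p - 1)) * indicator (ball 0 1) w) \<partial>lborel)"
  proof (rule nn_integral_mono)
    fix w :: complex
    show "ennreal (integral {0..2 * pi} (\<lambda>\<theta>. norm (1 - cnj a * (w * cis \<theta>)) powr (- s))) * \<Phi> (norm w) * indicator (ball 0 1) w
      \<le> ennreal c * (ennreal ((1 - (norm w)\<^sup>2) powr (p - 1) * (1 - (norm w)\<^sup>2 + \<delta>) powr (- p - 1)) * indicator (ball 0 1) w)"
    proof (cases "w \<in> ball 0 1")
      case True
      have "ennreal (integral {0..2 * pi} (\<lambda>\<theta>. norm (1 - cnj a * (w * cis \<theta>)) powr (- s))) * \<Phi> (norm w)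
        = ennreal (integral {0..2 * pi} (\<lambda>\<theta>. norm (1 - cnj a * (w * cis \<theta>)) powr (- s)) * (1 - (norm w)\<^sup>2) powr (p - 1))"
        unfolding \<Phi>_def by (rule ennreal_mult''[symmetric]) simp
      also have "\<dots> \<le> ennreal (c * ((1 - (norm w)\<^sup>2) powr (p - 1) * (1 - (norm w)\<^sup>2 + \<delta>) powr (- p - 1)))"
        by (rule ennreal_leI[OF key[OF True]])
      also have "\<dots> = ennreal c * ennreal ((1 - (norm w)\<^sup>2) powr (p - 1) * (1 - (norm w)\<^sup>2 + \<delta>) powr (- p - 1))"
        by (rule ennreal_mult'[OF c])
      finally show ?thesis using True by simp
    qed simp
  qed
  also have "\<dots> = ennreal c * (\<integral>\<^sup>+w\<in>ball 0 1. ennreal ((1 - (norm (w::complex))\<^sup>2) powr (p - 1) * (1 - (norm w)\<^sup>2 + \<delta>) powr (- p - 1)) \<partial>lborel)"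
  proof (rule nn_integral_cmult)
    have [measurable]: "indicator (ball 0 1) \<in> borel_measurable (borel :: complex measure)"
      by (rule borel_measurable_indicator) simp
    show "(\<lambda>w::complex. ennreal ((1 - (norm w)\<^sup>2) powr (p - 1) * (1 - (norm w)\<^sup>2 + \<delta>) powr (- p - 1)) * indicator (ball 0 1) w)
        \<in> borel_measurable lborel" by measurable
  qed
  also have "\<dots> = ennreal c * (ennreal pi * (\<integral>\<^sup>+t\<in>{0<..<1}. ennreal ((1 - t) powr (p - 1) * (1 - t + \<delta>) powr (- p - 1)) \<partial>lborel))"
    by (subst nn_integral_radial[where \<phi> = "\<lambda>t. ennreal ((1 - t) powr (p - 1) * (1 - t + \<delta>) powr (- p - 1))"]) auto
  also have "\<dots> \<le> ennreal c * (ennreal pi * ennreal (1 / (p * \<delta>)))"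
    by (intro mult_left_mono nn_integral_interval_weight p \<delta>) auto
  also have "\<dots> = ennreal (2 * pi) * ennreal (3 powr (s - 1) * pi / p * \<delta> powr (p + 1 - s))"
  proof -
    have "\<delta> powr (p + 2 - s) = \<delta> powr (p + 1 - s) * \<delta>"
    proof -
      have "p + 2 - s = (p + 1 - s) + 1" by simp
      then show ?thesis using \<delta> by (simp only: powr_add) simp
    qed
    then show ?thesis using p \<delta> c by (simp add: ennreal_mult'[symmetric] c_def field_simps)
  qed
  finally have "(\<integral>\<^sup>+w\<in>ball 0 1. ennreal (norm (1 - cnj a * w) powr (- s)) * \<Phi> (norm w) \<partial>lborel)
      \<le> ennreal (3 powr (s - 1) * pi / p * \<delta> powr (p + 1 - s))"
    by (subst (asm) ennreal_mult_le_mult_iff) auto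
  then show ?thesis by (simp add: \<Phi>_def \<delta>_def ennreal_mult'')
qed

text \<open>
  The test functions for necessity. An integer exponent avoids the choice of a branch, and any
  large exponent will do, since all of them scale in the same way after normalisation.
\<close>

definition kernel_power :: "nat \<Rightarrow> complex \<Rightarrow> complex \<Rightarrow> complex" where
  "kernel_power m a z = inverse ((1 - cnj a * z) ^ m)"

lemma one_minus_cnj_nonzero:
  fixes a z :: complex
  assumes "norm a < 1" "norm z < 1"
  shows "1 - cnj a * z \<noteq> 0"
proof -
  have "norm (cnj a * z) < 1"
    using mult_strict_mono'[of "norm a" 1 "norm z" 1] assms by (simp add: norm_mult)
  then show ?thesis by (metis eq_iff_diff_eq_0 less_irrefl norm_one)
qed

lemma kernel_power_holomorphic:
  assumes "norm a < 1" shows "kernel_power m a holomorphic_on ball 0 1"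
  unfolding kernel_power_def using one_minus_cnj_nonzero[OF assms]
  by (intro holomorphic_intros) auto

lemma norm_kernel_power:
  assumes "norm a < 1" "norm z < 1"
  shows "norm (kernel_power m a z) = norm (1 - cnj a * z) powr (- real m)"
  using one_minus_cnj_nonzero[OF assms]
  by (simp add: kernel_power_def norm_inverse norm_power powr_minus powr_realpow)

lemma norm_deriv_kernel_power:
  assumes "norm a < 1" "norm z < 1"
  shows "norm (deriv (kernel_power m a) z) \<le> real m * norm (1 - cnj a * z) powr (- (real m + 1))"
proof -
  have nz: "1 - cnj a * z \<noteq> 0" by (rule one_minus_cnj_nonzero[OF assms])
  have "deriv (kernel_power m a) z = of_nat m * cnj a * (1 - cnj a * z) ^ (m - 1) / ((1 - cnj a * z) ^ m)\<^sup>2"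
    unfolding kernel_power_def using nz
    by (intro DERIV_imp_deriv) (auto intro!: derivative_eq_intros simp: power2_eq_square divide_inverse)
  also have "\<dots> = of_nat m * cnj a * inverse ((1 - cnj a * z) ^ (m + 1))"
  proof -
    have "X ^ n / (X ^ Suc n)\<^sup>2 = inverse (X ^ (Suc n + 1))" if "X \<noteq> 0" for X :: complex and n
      using that by (simp add: power2_eq_square field_simps)
    from this[OF nz] show ?thesis by (cases m) (simp_all del: power_Suc add: times_divide_eq_right[symmetric])
  qed
  finally have "deriv (kernel_power m a) z = of_nat m * cnj a * inverse ((1 - cnj a * z) ^ (m + 1))" .
  have "norm (deriv (kernel_power m a) z) = real m * norm a * norm (1 - cnj a * z) powr (- (real m + 1))"
  proof -
    have "norm (1 - cnj a * z) powr (- (real m + 1)) = inverse (norm (1 - cnj a * z) ^ (m + 1))"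
      using nz powr_realpow[of "norm (1 - cnj a * z)" "m + 1"] unfolding powr_minus by (simp add: add.commute)
    then show ?thesis
      using \<open>deriv (kernel_power m a) z = of_nat m * cnj a * inverse ((1 - cnj a * z) ^ (m + 1))\<close>
      by (simp only: norm_mult norm_inverse norm_power norm_of_nat complex_mod_cnj)
  qed
  also have "\<dots> \<le> real m * norm (1 - cnj a * z) powr (- (real m + 1))"
    using assms by (intro mult_right_mono mult_left_le) auto
  finally show ?thesis .
qed

lemma kernel_power_hardy:
  assumes p: "0 < p" and m: "2 \<le> real m * p" and a: "norm a < 1"
  shows "kernel_power m a \<in> hardy_space p"
    and "hardy_norm p (kernel_power m a) \<le> (1 - norm a) powr (1 / p - real m)"
proof -
  have "hardy_mean p (kernel_power m a) r \<le> (1 - norm a) powr (1 / p - real m)" if r: "0 < r" "r < 1" for r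
  proof -
    define c where "c = cnj a * of_real r"
    have c: "norm c < 1" "norm c \<le> norm a"
      using r a mult_strict_mono'[of "norm a" 1 r 1] by (auto simp: c_def norm_mult mult_left_le)
    have "integral {0..2 * pi} (\<lambda>\<theta>. norm (kernel_power m a (of_real r * cis \<theta>)) powr p) =
        integral {0..2 * pi} (\<lambda>\<theta>. norm (1 - c * cis \<theta>) powr (- (real m * p)))"
      using r a by (simp add: norm_kernel_power norm_mult powr_powr c_def mult.assoc)
    also have "\<dots> \<le> 2 * pi * (1 - norm c) powr (1 - real m * p)"
      by (rule kernel_circle_mean[OF c(1) m])
    finally have "circle_mean p (kernel_power m a) r \<le> (1 - norm c) powr (1 - real m * p)"
      by (simp add: circle_mean_def field_simps)
    also have "\<dots> \<le> (1 - norm a) powr (1 - real m * p)"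
      using c a m by (intro powr_mono2') auto
    finally have "hardy_mean p (kernel_power m a) r \<le> ((1 - norm a) powr (1 - real m * p)) powr (1 / p)"
      unfolding hardy_mean_eq using p by (intro powr_mono2 circle_mean_nonneg) auto
    also have "\<dots> = (1 - norm a) powr (1 / p - real m)"
      using p by (simp add: powr_powr field_simps)
    finally show ?thesis .
  qed
  then show "kernel_power m a \<in> hardy_space p" "hardy_norm p (kernel_power m a) \<le> (1 - norm a) powr (1 / p - real m)"
    using hardy_spaceI[OF kernel_power_holomorphic[OF a] p] by blast+
qed

abbreviation dirichlet_energy :: "real \<Rightarrow> (complex \<Rightarrow> complex) \<Rightarrow> complex set \<Rightarrow> ennreal" where
  "dirichlet_energy p f S \<equiv> \<integral>\<^sup>+w\<in>S. ennreal (dirichlet_density p f w) \<partial>lborel"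

lemma continuous_on_dirichlet_density:
  assumes "f holomorphic_on ball 0 1" and "0 < p"
  shows "continuous_on (ball 0 1) (dirichlet_density p f)"
proof -
  have nz: "1 - (norm z)\<^sup>2 \<noteq> 0" if "z \<in> ball (0::complex) 1" for z
    using that by (simp add: abs_square_eq_1)
  show ?thesis
    unfolding dirichlet_density_def[abs_def]
    by (intro continuous_on_mult continuous_on_powr' continuous_intros
        holomorphic_on_imp_continuous_on[OF holomorphic_deriv[OF assms(1) open_ball]])
      (use nz assms in auto)
qed

lemma dirichlet_density_nonneg: "0 \<le> dirichlet_density p f z"
  by (simp add: dirichlet_density_def)

text \<open>
  Passage from estimates of area integrals in the extended nonnegative reals to membership
  in the space.
\<close>

lemma dirichlet_nn_integral:
  assumes f: "f holomorphic_on ball 0 1" and p: "0 < p"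
    and I: "dirichlet_energy p f (ball 0 1) \<le> ennreal B" and B: "0 \<le> B"
  shows "f \<in> dirichlet_space p" and "(LINT z:ball 0 1|lborel. dirichlet_density p f z) \<le> B"
proof -
  have meas: "(\<lambda>z. indicator (ball 0 1) z *\<^sub>R dirichlet_density p f z) \<in> borel_measurable lborel"
    using borel_measurable_continuous_on_indicator[OF _ continuous_on_dirichlet_density[OF f p]] by simp
  have eq: "(\<integral>\<^sup>+z. ennreal (indicator (ball 0 1) z *\<^sub>R dirichlet_density p f z) \<partial>lborel) =
      dirichlet_energy p f (ball 0 1)"
    by (intro nn_integral_cong) (simp split: split_indicator)
  have "set_integrable lborel (ball 0 1) (dirichlet_density p f)"
    unfolding set_integrable_def
  proof (rule integrableI_nonneg[OF meas])
    show "AE z in lborel. 0 \<le> indicator (ball 0 1) z *\<^sub>R dirichlet_density p f z"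
      by (simp add: dirichlet_density_nonneg)
    show "(\<integral>\<^sup>+z. ennreal (indicator (ball 0 1) z *\<^sub>R dirichlet_density p f z) \<partial>lborel) < \<infinity>"
      unfolding eq using I by (rule le_less_trans) simp
  qed
  then show "f \<in> dirichlet_space p" using f by (simp add: dirichlet_space_def)
  have "(LINT z:ball 0 1|lborel. dirichlet_density p f z) =
      enn2real (dirichlet_energy p f (ball 0 1))"
    unfolding set_lebesgue_integral_def eq[symmetric]
    by (rule integral_eq_nn_integral[OF meas]) (simp add: dirichlet_density_nonneg)
  also have "\<dots> \<le> B" by (rule enn2real_leI[OF B I])
  finally show "(LINT z:ball 0 1|lborel. dirichlet_density p f z) \<le> B" .
qed

lemma kernel_power_dirichlet:
  assumes p: "0 < p" and m: "2 \<le> real m * p" and a: "norm a < 1"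
  defines "C \<equiv> (real m powr p * 3 powr ((real m + 1) * p - 1) / p + 1) powr (1 / p)"
  shows "kernel_power m a \<in> dirichlet_space p"
    and "dirichlet_norm p (kernel_power m a) \<le> C * (1 - norm a) powr (1 / p - real m)"
proof -
  let ?f = "kernel_power m a"
  have hol: "?f holomorphic_on ball 0 1" by (rule kernel_power_holomorphic[OF a])
  define s where "s = (real m + 1) * p"
  define K where "K = real m powr p * 3 powr (s - 1) / p"
  have s: "2 \<le> s" "p + 2 \<le> s" using m p by (auto simp: s_def algebra_simps)
  have K: "0 \<le> K" using p by (simp add: K_def)
  define \<delta> where "\<delta> = 1 - norm a"
  have \<delta>: "0 < \<delta>" "\<delta> \<le> 1" using a by (auto simp: \<delta>_def)
  have dens: "dirichlet_density p ?f z \<le> real m powr p * (norm (1 - cnj a * z) powr (- s) * (1 - (norm z)\<^sup>2) powr (p - 1))"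
    if z: "norm z < 1" for z
  proof -
    have "norm (deriv ?f z) powr p \<le> (real m * norm (1 - cnj a * z) powr (- (real m + 1))) powr p"
      using p by (intro powr_mono2 norm_deriv_kernel_power a z) auto
    also have "\<dots> = real m powr p * norm (1 - cnj a * z) powr (- s)"
      by (simp add: powr_mult powr_powr s_def algebra_simps)
    finally show ?thesis
      unfolding dirichlet_density_def by (simp add: mult_right_mono mult.assoc[symmetric])
  qed
  have "dirichlet_energy p ?f (ball 0 1) \<le>
      (\<integral>\<^sup>+z. ennreal (real m powr p) * (ennreal (norm (1 - cnj a * z) powr (- s) * (1 - (norm z)\<^sup>2) powr (p - 1)) * indicator (ball 0 1) z) \<partial>lborel)"
  proof (rule nn_integral_mono)
    fix z :: complex
    show "ennreal (dirichlet_density p ?f z) * indicator (ball 0 1) z \<le>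
      ennreal (real m powr p) * (ennreal (norm (1 - cnj a * z) powr (- s) * (1 - (norm z)\<^sup>2) powr (p - 1)) * indicator (ball 0 1) z)"
      using ennreal_leI[OF dens[of z]] by (cases "norm z < 1") (simp_all add: ennreal_mult)
  qed
  also have "\<dots> = ennreal (real m powr p) * (\<integral>\<^sup>+z\<in>ball 0 1. ennreal (norm (1 - cnj a * z) powr (- s) * (1 - (norm z)\<^sup>2) powr (p - 1)) \<partial>lborel)"
  proof (rule nn_integral_cmult)
    have [measurable]: "indicator (ball 0 1) \<in> borel_measurable (borel :: complex measure)"
      by (rule borel_measurable_indicator) simp
    have [measurable]: "(\<lambda>z. norm (1 - cnj a * z)) \<in> borel_measurable borel"
      by (intro borel_measurable_continuous_onI continuous_intros)
    show "(\<lambda>z. ennreal (norm (1 - cnj a * z) powr (- s) * (1 - (norm z)\<^sup>2) powr (p - 1)) * indicator (ball 0 1) z)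
        \<in> borel_measurable lborel" by measurable
  qed
  also have "\<dots> \<le> ennreal (real m powr p) * ennreal (3 powr (s - 1) * pi / p * \<delta> powr (p + 1 - s))"
    unfolding \<delta>_def by (intro mult_left_mono dirichlet_kernel_integral p s a) auto
  also have "\<dots> = ennreal (pi * (K * \<delta> powr (p + 1 - s)))"
    by (simp add: ennreal_mult'[symmetric] K_def mult_ac)
  finally have I: "dirichlet_energy p ?f (ball 0 1) \<le> ennreal (pi * (K * \<delta> powr (p + 1 - s)))" .
  have B: "0 \<le> pi * (K * \<delta> powr (p + 1 - s))" using K by simp
  note * = dirichlet_nn_integral[OF hol p I B]
  show "?f \<in> dirichlet_space p" by (rule *)
  have "1 / pi * (LINT z:ball 0 1|lborel. dirichlet_density p ?f z) \<le> K * \<delta> powr (p + 1 - s)"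
    using mult_left_mono[OF *(2), of "1 / pi"] by simp
  moreover have "norm (?f 0) powr p \<le> \<delta> powr (p + 1 - s)"
    using powr_mono2'[of "p + 1 - s" \<delta> 1] \<delta> s by (simp add: kernel_power_def)
  ultimately have "1 / pi * (LINT z:ball 0 1|lborel. dirichlet_density p ?f z) + norm (?f 0) powr p \<le> (K + 1) * \<delta> powr (p + 1 - s)"
    by (simp add: algebra_simps)
  moreover have "0 \<le> (LINT z:ball 0 1|lborel. dirichlet_density p ?f z)"
    unfolding set_lebesgue_integral_def by (intro integral_nonneg_AE) (simp add: dirichlet_density_nonneg)
  ultimately have "dirichlet_norm p ?f \<le> ((K + 1) * \<delta> powr (p + 1 - s)) powr (1 / p)"
    unfolding dirichlet_norm_def using p by (intro powr_mono2) auto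
  also have "\<dots> = C * \<delta> powr ((p + 1 - s) / p)"
    by (simp add: powr_mult powr_powr C_def K_def s_def)
  also have "(p + 1 - s) / p = 1 / p - real m"
    using p by (simp add: s_def field_simps)
  finally show "dirichlet_norm p ?f \<le> C * (1 - norm a) powr (1 / p - real m)" by (simp add: \<delta>_def)
qed

section \<open>Integration along a radius\<close>

text \<open>
  The integrand has a primitive on the disc, so that the line integral is a difference of its values.
\<close>

lemma T_op_has_derivative:
  assumes f: "f holomorphic_on ball 0 1" and g: "g holomorphic_on ball 0 1" and z: "z \<in> ball 0 1"
  shows "(T_op g f has_field_derivative f z * deriv g z) (at z)"
proof -
  have "(\<lambda>\<zeta>. f \<zeta> * deriv g \<zeta>) holomorphic_on ball 0 1"
    by (intro holomorphic_intros f holomorphic_deriv[OF g]) simp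
  then obtain F where F: "\<And>w. w \<in> ball 0 1 \<Longrightarrow> (F has_field_derivative f w * deriv g w) (at w within ball 0 1)"
    using holomorphic_convex_primitive'[of "ball 0 1" "\<lambda>\<zeta>. f \<zeta> * deriv g \<zeta>"] by auto
  have eq: "T_op g f w = F w - F 0" if "w \<in> ball 0 1" for w
  proof -
    have "closed_segment 0 w \<subseteq> ball 0 1"
      using that by (intro closed_segment_subset convex_ball) auto
    then have "((\<lambda>\<zeta>. f \<zeta> * deriv g \<zeta>) has_contour_integral F (pathfinish (linepath 0 w)) - F (pathstart (linepath 0 w))) (linepath 0 w)"
      by (intro contour_integral_primitive[OF F]) auto
    then show ?thesis by (simp add: T_op_def contour_integral_unique)
  qed
  have "(F has_field_derivative f z * deriv g z) (at z)"
    using F[OF z] z by (simp add: at_within_open[OF _ open_ball])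
  then have "((\<lambda>w. F w - F 0) has_field_derivative f z * deriv g z) (at z)"
    by (auto intro!: derivative_eq_intros)
  then show ?thesis
    by (rule has_field_derivative_transform_within_open[of _ _ _ "ball 0 1"]) (use eq z in auto)
qed

lemma T_op_holomorphic:
  assumes "f holomorphic_on ball 0 1" and "g holomorphic_on ball 0 1"
  shows "T_op g f holomorphic_on ball 0 1"
  using T_op_has_derivative[OF assms] holomorphic_on_open by blast

lemma T_op_0: "T_op g f 0 = 0"
  by (simp add: T_op_def)

lemma le_powr_interpolate:
  fixes y X Y \<eta> :: real
  assumes "0 \<le> y" "y \<le> X" "y \<le> Y" "0 \<le> \<eta>" "\<eta> \<le> 1"
  shows "y \<le> X powr (1 - \<eta>) * Y powr \<eta>"
proof (cases "y = 0")
  case False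
  then have "y = y powr (1 - \<eta>) * y powr \<eta>" using assms by (simp add: powr_add[symmetric])
  also have "\<dots> \<le> X powr (1 - \<eta>) * Y powr \<eta>"
    using assms by (intro mult_mono powr_mono2) auto
  finally show ?thesis .
qed simp

lemma has_vector_derivative_ray:
  assumes "(F has_field_derivative D) (at (of_real t * \<zeta>))"
  shows "((\<lambda>t. F (of_real t * \<zeta>)) has_vector_derivative D * \<zeta>) (at t)"
proof -
  have "((\<lambda>t. of_real t * \<zeta>) has_vector_derivative \<zeta>) (at t)"
    by (auto intro!: derivative_eq_intros simp: has_vector_derivative_def scaleR_conv_of_real)
  from field_vector_diff_chain_at[OF this assms] show ?thesis by (simp add: o_def mult.commute)
qed

text \<open>
  The two bounds for \<open>k'\<close> along a radius, one with the local factor \<open>x\<close> and one with a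
  worse power of the distance to the boundary, are interpolated with weights \<open>1 - \<eta>\<close> and \<open>\<eta>\<close> and then
  integrated. A positive \<open>\<eta>\<close> avoids the logarithm that the first bound alone would give.
\<close>

lemma ray_growth:
  fixes k :: "complex \<Rightarrow> complex" and A x P \<eta> :: real
  assumes k: "k holomorphic_on ball 0 1" and \<zeta>: "norm \<zeta> = 1"
    and "0 < P" "0 < A" "1 \<le> x" "0 < \<eta>" "\<eta> \<le> 1"
    and k0: "norm (k 0) \<le> A"
    and k1: "\<And>t. 0 \<le> t \<Longrightarrow> t < 1 \<Longrightarrow> norm (deriv k (of_real t * \<zeta>)) \<le> A * x * (1 - t) powr (- 1)"
    and k2: "\<And>t. 0 \<le> t \<Longrightarrow> t < 1 \<Longrightarrow> norm (deriv k (of_real t * \<zeta>)) \<le> A * (1 - t) powr (- 1 - 1 / P)"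
    and s: "0 \<le> s" "s < 1"
  shows "norm (k (of_real s * \<zeta>)) \<le> (1 + P / \<eta>) * A * x powr (1 - \<eta>) * (1 - s) powr (- \<eta> / P)"
proof -
  define c where "c = A * x powr (1 - \<eta>)"
  have x1: "1 \<le> x powr (1 - \<eta>)" using assms by (intro ge_one_powr_ge_zero) auto
  have c: "A \<le> c" "0 < c" using x1 \<open>0 < A\<close> unfolding c_def by (auto intro!: mult_pos_pos)
  have inball: "of_real t * \<zeta> \<in> ball 0 1" if "0 \<le> t" "t < 1" for t
    using that \<zeta> by (simp add: norm_mult)
  have bnd: "norm (deriv k (of_real t * \<zeta>)) \<le> c * (1 - t) powr (- \<eta> / P - 1)" if t: "0 \<le> t" "t < 1" for t
  proof -
    have "norm (deriv k (of_real t * \<zeta>)) \<le> (A * x * (1 - t) powr (- 1)) powr (1 - \<eta>) * (A * (1 - t) powr (- 1 - 1 / P)) powr \<eta>"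
      using assms by (intro le_powr_interpolate k1 k2 t) auto
    also have "\<dots> = (A powr (1 - \<eta>) * A powr \<eta>) * x powr (1 - \<eta>) * ((1 - t) powr (- 1 * (1 - \<eta>)) * (1 - t) powr ((- 1 - 1 / P) * \<eta>))"
      using assms t by (simp only: powr_mult powr_powr mult_ac)
    also have "A powr (1 - \<eta>) * A powr \<eta> = A" using \<open>0 < A\<close> by (simp add: powr_add[symmetric])
    also have "(1 - t) powr (- 1 * (1 - \<eta>)) * (1 - t) powr ((- 1 - 1 / P) * \<eta>) = (1 - t) powr (- \<eta> / P - 1)"
    proof -
      have "- 1 * (1 - \<eta>) + (- 1 - 1 / P) * \<eta> = - \<eta> / P - 1" by (simp add: algebra_simps)
      then show ?thesis by (simp only: powr_add[symmetric])
    qed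
    finally show ?thesis by (simp add: c_def)
  qed
  have "norm (k (of_real s * \<zeta>) - k 0) \<le> c * (P / \<eta>) * (1 - s) powr (- \<eta> / P)"
  proof (cases "s = 0")
    case True
    then show ?thesis using assms c by simp
  next
    case False
    have "norm (k (of_real s * \<zeta>) - k (of_real 0 * \<zeta>)) \<le>
        c * (P / \<eta>) * (1 - s) powr (- \<eta> / P) - c * (P / \<eta>) * (1 - 0) powr (- \<eta> / P)"
    proof (rule differentiable_bound_general)
      show "0 < s" using s False by simp
      show "continuous_on {0..s} (\<lambda>t. k (of_real t * \<zeta>))"
        by (intro continuous_on_compose2[OF holomorphic_on_imp_continuous_on[OF k]] continuous_intros)
          (use inball s in auto)
      show "continuous_on {0..s} (\<lambda>t. c * (P / \<eta>) * (1 - t) powr (- \<eta> / P))"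
        by (intro continuous_intros) (use s in auto)
      fix t assume t: "0 < t" "t < s"
      show "((\<lambda>t. k (of_real t * \<zeta>)) has_vector_derivative deriv k (of_real t * \<zeta>) * \<zeta>) (at t)"
        using holomorphic_derivI[OF k open_ball inball[of t]] t s by (intro has_vector_derivative_ray) auto
      show "((\<lambda>t. c * (P / \<eta>) * (1 - t) powr (- \<eta> / P)) has_vector_derivative c * (1 - t) powr (- \<eta> / P - 1)) (at t)"
        unfolding has_real_derivative_iff_has_vector_derivative[symmetric] using t s assms
        by (auto intro!: derivative_eq_intros)
      show "norm (deriv k (of_real t * \<zeta>) * \<zeta>) \<le> c * (1 - t) powr (- \<eta> / P - 1)"
        using bnd[of t] t s \<zeta> by (simp add: norm_mult)
    qed
    moreover have "0 \<le> c * (P / \<eta>)" using assms c by simp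
    ultimately show ?thesis by simp
  qed
  moreover have "norm (k 0) \<le> c * (1 - s) powr (- \<eta> / P)"
  proof -
    have "1 \<le> (1 - s) powr (- \<eta> / P)"
      using powr_mono2'[of "- \<eta> / P" "1 - s" 1] assms by simp
    then have "A * 1 \<le> c * (1 - s) powr (- \<eta> / P)"
      using c \<open>0 < A\<close> by (intro mult_mono) auto
    then show ?thesis using k0 by simp
  qed
  moreover have "norm (k (of_real s * \<zeta>)) \<le> norm (k (of_real s * \<zeta>) - k 0) + norm (k 0)"
    using norm_triangle_ineq[of "k (of_real s * \<zeta>) - k 0" "k 0"] by simp
  ultimately have "norm (k (of_real s * \<zeta>)) \<le> c * (P / \<eta>) * (1 - s) powr (- \<eta> / P) + c * (1 - s) powr (- \<eta> / P)"
    by linarith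
  then show ?thesis by (simp add: c_def algebra_simps)
qed

text \<open>
  The first bound is integrable away from \<open>t = 1\<close>, the second one near \<open>t = 1\<close>. Splitting at distance
  \<open>1 / y\<close> from the end point balances the two contributions: both are multiples of \<open>D y^b\<close>.
\<close>

lemma hedberg_bound:
  fixes G G' :: "real \<Rightarrow> complex" and a b D y :: real
  assumes "0 < a" "0 < b" "0 < D" "1 \<le> y"
    and G: "\<And>t. 0 \<le> t \<Longrightarrow> t < 1 \<Longrightarrow> (G has_vector_derivative G' t) (at t)"
    and b1: "\<And>t. 0 \<le> t \<Longrightarrow> t < 1 \<Longrightarrow> norm (G' t) \<le> D * (1 - t) powr (- b - 1)"
    and b2: "\<And>t. 0 \<le> t \<Longrightarrow> t < 1 \<Longrightarrow> norm (G' t) \<le> D * y powr (a + b) * (1 - t) powr (a - 1)"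
    and r: "0 \<le> r" "r < 1"
  shows "norm (G r - G 0) \<le> (1 / a + 1 / b) * D * y powr b"
proof -
  define \<delta> where "\<delta> = 1 / y"
  have \<delta>: "0 < \<delta>" "\<delta> \<le> 1" using assms by (auto simp: \<delta>_def)
  have cont: "continuous_on {u..v} G" if "0 \<le> u" "v < 1" for u v
    by (rule continuous_at_imp_continuous_on)
      (use that in \<open>auto intro!: has_vector_derivative_continuous[OF G]\<close>)
  have near0: "norm (G u - G 0) \<le> 1 / b * D * y powr b" if u: "0 \<le> u" "u < 1" "u \<le> 1 - \<delta>" for u
  proof (cases "u = 0")
    case True
    then show ?thesis using assms by simp
  next
    case False
    have "norm (G u - G 0) \<le> D * (1 / b) * (1 - u) powr (- b) - D * (1 / b) * (1 - 0) powr (- b)"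
    proof (rule differentiable_bound_general)
      show "0 < u" using u False by simp
      show "continuous_on {0..u} G" by (rule cont) (use u in auto)
      show "continuous_on {0..u} (\<lambda>t. D * (1 / b) * (1 - t) powr (- b))"
        by (intro continuous_intros) (use u in auto)
      fix t assume t: "0 < t" "t < u"
      show "(G has_vector_derivative G' t) (at t)" by (rule G) (use t u in auto)
      show "((\<lambda>t. D * (1 / b) * (1 - t) powr (- b)) has_vector_derivative D * (1 - t) powr (- b - 1)) (at t)"
        unfolding has_real_derivative_iff_has_vector_derivative[symmetric] using t u assms
        by (auto intro!: derivative_eq_intros)
      show "norm (G' t) \<le> D * (1 - t) powr (- b - 1)" by (rule b1) (use t u in auto)
    qed
    also have "\<dots> \<le> D * (1 / b) * (1 - u) powr (- b)" using assms by simp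
    also have "\<dots> \<le> D * (1 / b) * \<delta> powr (- b)"
      using assms u \<delta> by (intro mult_left_mono powr_mono2') auto
    also have "\<delta> powr (- b) = y powr b"
      using assms by (simp add: \<delta>_def powr_divide powr_minus_divide)
    finally show ?thesis by (simp add: mult_ac)
  qed
  have near1: "norm (G r - G (1 - \<delta>)) \<le> 1 / a * D * y powr b" if "1 - \<delta> < r"
  proof -
    let ?c = "D * y powr (a + b)"
    have "norm (G r - G (1 - \<delta>)) \<le> - (?c * (1 / a) * (1 - r) powr a) - (- (?c * (1 / a) * (1 - (1 - \<delta>)) powr a))"
    proof (rule differentiable_bound_general)
      show "1 - \<delta> < r" by fact
      show "continuous_on {1 - \<delta>..r} G" by (rule cont) (use \<delta> r in auto)
      show "continuous_on {1 - \<delta>..r} (\<lambda>t. - (?c * (1 / a) * (1 - t) powr a))"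
        by (intro continuous_intros) (use r in auto)
      fix t assume t: "1 - \<delta> < t" "t < r"
      show "(G has_vector_derivative G' t) (at t)" by (rule G) (use t \<delta> r in auto)
      show "((\<lambda>t. - (?c * (1 / a) * (1 - t) powr a)) has_vector_derivative ?c * (1 - t) powr (a - 1)) (at t)"
        unfolding has_real_derivative_iff_has_vector_derivative[symmetric] using t r assms
        by (auto intro!: derivative_eq_intros)
      show "norm (G' t) \<le> ?c * (1 - t) powr (a - 1)" by (rule b2) (use t \<delta> r in auto)
    qed
    also have "\<dots> \<le> ?c * (1 / a) * \<delta> powr a" using assms by simp
    also have "y powr (a + b) * \<delta> powr a = y powr b"
      using assms by (simp add: \<delta>_def powr_add powr_divide)
    then have "?c * (1 / a) * \<delta> powr a = 1 / a * D * y powr b" by (simp add: mult_ac)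
    finally show ?thesis .
  qed
  have nn: "0 \<le> 1 / a * D * y powr b" using assms by simp
  show ?thesis
  proof (cases "1 - \<delta> < r")
    case True
    have "norm (G r - G 0) \<le> norm (G r - G (1 - \<delta>)) + norm (G (1 - \<delta>) - G 0)"
      using norm_triangle_ineq[of "G r - G (1 - \<delta>)" "G (1 - \<delta>) - G 0"] by simp
    then show ?thesis using near1[OF True] near0[of "1 - \<delta>"] \<delta> by (simp add: algebra_simps)
  next
    case False
    then show ?thesis using near0[of r] nn r by (simp add: algebra_simps)
  qed
qed

text \<open>
  The growth estimate of \<open>k\<close> with \<open>\<eta> = 1\<close> serves away from the boundary and with \<open>\<eta> = \<alpha> p / 2\<close> close to
  it, since the exponent of \<open>1 - t\<close> in the derivative \<open>f g'\<close> is \<open>\<alpha> - 1 - \<eta> / p\<close> and passes through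
  \<open>-1\<close> at \<open>\<eta> = \<alpha> p\<close>. The parameter of the splitting is \<open>y = x^P\<close>.
\<close>

lemma T_op_ray_bound:
  fixes f g k :: "complex \<Rightarrow> complex" and p q P A x K :: real
  assumes "0 < p" "p < q" "0 < P" "0 < A" "1 \<le> x" "0 < K"
    and f: "f holomorphic_on ball 0 1" and g: "g holomorphic_on ball 0 1" and k: "k holomorphic_on ball 0 1"
    and fk: "\<And>z. norm z < 1 \<Longrightarrow> norm (f z) \<le> norm (k z) powr (P / p)"
    and g': "\<And>z. norm z < 1 \<Longrightarrow> norm (deriv g z) \<le> K * (1 - norm z) powr (1 / p - 1 / q - 1)"
    and \<zeta>: "norm \<zeta> = 1" and k0: "norm (k 0) \<le> A"
    and k1: "\<And>t. 0 \<le> t \<Longrightarrow> t < 1 \<Longrightarrow> norm (deriv k (of_real t * \<zeta>)) \<le> A * x * (1 - t) powr (- 1)"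
    and k2: "\<And>t. 0 \<le> t \<Longrightarrow> t < 1 \<Longrightarrow> norm (deriv k (of_real t * \<zeta>)) \<le> A * (1 - t) powr (- 1 - 1 / P)"
    and r: "0 \<le> r" "r < 1"
  shows "norm (T_op g f (of_real r * \<zeta>)) \<le>
    (2 / (1 / p - 1 / q) + q) * (1 + 2 * P / (1 - p / q)) powr (P / p) * K * A powr (P / p) * x powr (P / q)"
proof -
  define \<alpha> where "\<alpha> = 1 / p - 1 / q"
  have q: "0 < q" using assms by simp
  have \<alpha>: "0 < \<alpha>" "\<alpha> * p = 1 - p / q" "\<alpha> * p < 1"
    using assms by (auto simp: \<alpha>_def field_simps)
  define c where "c = (1 + 2 * P / (1 - p / q)) powr (P / p)"
  define D where "D = c * K * A powr (P / p)"
  have base: "0 < 1 + 2 * P / (1 - p / q)" using assms by (intro add_pos_nonneg divide_nonneg_nonneg) auto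
  have D: "0 < D" using assms base by (simp add: D_def c_def)
  have bnd: "norm (f (of_real t * \<zeta>) * deriv g (of_real t * \<zeta>) * \<zeta>) \<le> D * x powr ((1 - \<eta>) * P / p) * (1 - t) powr (\<alpha> - 1 - \<eta> / p)"
    if t: "0 \<le> t" "t < 1" and \<eta>: "\<alpha> * p / 2 \<le> \<eta>" "\<eta> \<le> 1" for t \<eta>
  proof -
    have nt: "norm (of_real t * \<zeta>) = t" using t \<zeta> by (simp add: norm_mult)
    have \<eta>0: "0 < \<eta>" using \<alpha> assms \<eta> by (smt (verit) divide_pos_pos mult_pos_pos)
    have "norm (k (of_real t * \<zeta>)) \<le> (1 + P / \<eta>) * A * x powr (1 - \<eta>) * (1 - t) powr (- \<eta> / P)"
      by (rule ray_growth[OF k \<zeta> assms(3-5) \<eta>0 \<eta>(2) k0 k1 k2 t])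
    also have "\<dots> \<le> (1 + 2 * P / (1 - p / q)) * A * x powr (1 - \<eta>) * (1 - t) powr (- \<eta> / P)"
    proof (intro mult_right_mono add_left_mono)
      have "P / \<eta> \<le> P / (\<alpha> * p / 2)"
        using assms \<alpha> \<eta> \<eta>0 by (intro divide_left_mono mult_pos_pos) auto
      then show "P / \<eta> \<le> 2 * P / (1 - p / q)" using \<alpha>(2) by (simp add: mult.commute)
    qed (use assms in auto)
    finally have "norm (k (of_real t * \<zeta>)) powr (P / p) \<le>
        ((1 + 2 * P / (1 - p / q)) * A * x powr (1 - \<eta>) * (1 - t) powr (- \<eta> / P)) powr (P / p)"
      using assms by (intro powr_mono2) auto
    also have "\<dots> = c * A powr (P / p) * x powr ((1 - \<eta>) * P / p) * (1 - t) powr (- \<eta> / p)"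
      using assms base t by (simp add: powr_mult powr_powr c_def)
    finally have ff: "norm (f (of_real t * \<zeta>)) \<le> c * A powr (P / p) * x powr ((1 - \<eta>) * P / p) * (1 - t) powr (- \<eta> / p)"
      using fk[of "of_real t * \<zeta>"] nt t by simp
    have gg: "norm (deriv g (of_real t * \<zeta>)) \<le> K * (1 - t) powr (\<alpha> - 1)"
      using g'[of "of_real t * \<zeta>"] nt t by (simp add: \<alpha>_def)
    have "norm (f (of_real t * \<zeta>)) * norm (deriv g (of_real t * \<zeta>)) \<le>
        (c * A powr (P / p) * x powr ((1 - \<eta>) * P / p) * (1 - t) powr (- \<eta> / p)) * (K * (1 - t) powr (\<alpha> - 1))"
      using base by (intro mult_mono ff gg) (auto simp: c_def intro!: mult_nonneg_nonneg less_imp_le[OF \<open>0 < A\<close>])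
    also have "\<dots> = D * x powr ((1 - \<eta>) * P / p) * ((1 - t) powr (- \<eta> / p) * (1 - t) powr (\<alpha> - 1))"
      by (simp add: D_def mult_ac)
    also have "(1 - t) powr (- \<eta> / p) * (1 - t) powr (\<alpha> - 1) = (1 - t) powr (\<alpha> - 1 - \<eta> / p)"
      by (simp add: powr_add[symmetric])
    finally show ?thesis using \<zeta> by (simp add: norm_mult)
  qed
  have "norm (T_op g f (of_real r * \<zeta>) - T_op g f (of_real 0 * \<zeta>)) \<le>
      (1 / (\<alpha> / 2) + 1 / (1 / q)) * D * (x powr P) powr (1 / q)"
  proof (rule hedberg_bound[OF _ _ D, where G = "\<lambda>t. T_op g f (of_real t * \<zeta>)" and G' = "\<lambda>t. f (of_real t * \<zeta>) * deriv g (of_real t * \<zeta>) * \<zeta>"])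
    show "1 \<le> x powr P" using assms by (intro ge_one_powr_ge_zero) auto
    fix t :: real assume t: "0 \<le> t" "t < 1"
    show "((\<lambda>t. T_op g f (of_real t * \<zeta>)) has_vector_derivative f (of_real t * \<zeta>) * deriv g (of_real t * \<zeta>) * \<zeta>) (at t)"
      by (intro has_vector_derivative_ray T_op_has_derivative f g) (use t \<zeta> in \<open>simp add: norm_mult\<close>)
    show "norm (f (of_real t * \<zeta>) * deriv g (of_real t * \<zeta>) * \<zeta>) \<le> D * (1 - t) powr (- (1 / q) - 1)"
      using bnd[OF t, of 1] \<alpha> assms(5) by (simp add: \<alpha>_def)
    have e1: "(1 - \<alpha> * p / 2) * P / p = P * (\<alpha> / 2 + 1 / q)"
      using assms q by (simp add: \<alpha>_def field_simps)
    have e2: "\<alpha> - 1 - (\<alpha> * p / 2) / p = \<alpha> / 2 - 1" using assms by (simp add: field_simps)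
    have "norm (f (of_real t * \<zeta>) * deriv g (of_real t * \<zeta>) * \<zeta>) \<le>
        D * x powr ((1 - \<alpha> * p / 2) * P / p) * (1 - t) powr (\<alpha> - 1 - (\<alpha> * p / 2) / p)"
      by (rule bnd[OF t]) (use \<alpha> in auto)
    then show "norm (f (of_real t * \<zeta>) * deriv g (of_real t * \<zeta>) * \<zeta>) \<le>
        D * (x powr P) powr (\<alpha> / 2 + 1 / q) * (1 - t) powr (\<alpha> / 2 - 1)"
      unfolding e1 e2 powr_powr .
  qed (use \<alpha> q r in auto)
  then show ?thesis using q by (simp add: T_op_0 powr_powr D_def c_def \<alpha>_def mult_ac)
qed

section \<open>The Dirichlet density swept to the circle\<close>

text \<open>
  Weights with an exponent of either sign change by a bounded factor only between comparable arguments.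
\<close>

lemma powr_comparable:
  fixes d X e :: real
  assumes "0 < d" "d \<le> 3 * X" "X \<le> 3 * d"
  shows "X powr e \<le> 3 powr \<bar>e\<bar> * d powr e"
proof (cases "0 \<le> e")
  case True
  have "X powr e \<le> (3 * d) powr e" using assms True by (intro powr_mono2) auto
  then show ?thesis using assms True by (simp add: powr_mult)
next
  case False
  have "X powr e \<le> (d / 3) powr e" using assms False by (intro powr_mono2') auto
  also have "(d / 3) powr e = d powr e / 3 powr e" using assms by (simp add: powr_divide)
  also have "\<dots> = 3 powr (- e) * d powr e" by (simp add: powr_minus_divide)
  finally show ?thesis using False by simp
qed

text \<open>
  The sub-mean-value inequality in a disc on which the weight \<open>1 - |w|\<^sup>2\<close> is comparable to \<open>1 - |z|\<close>.
\<close>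

lemma deriv_area_estimate:
  assumes k: "k holomorphic_on ball 0 1" and P: "0 < P" and z: "norm z < 1"
  shows "ennreal (norm (deriv k z) powr P * (1 - norm z) powr (P + 1)) \<le>
    ennreal (4 * 3 powr \<bar>1 - P\<bar> / pi) *
      dirichlet_energy P k (ball z ((1 - norm z) / 2))"
proof -
  define d where "d = 1 - norm z"
  define c where "c = 3 powr \<bar>1 - P\<bar> * d powr (1 - P)"
  have d: "0 < d" using z by (simp add: d_def)
  have c: "0 < c" using d by (simp add: c_def)
  have near: "norm w < 1 \<and> d \<le> 3 * (1 - (norm w)\<^sup>2) \<and> 1 - (norm w)\<^sup>2 \<le> 3 * d" if "w \<in> ball z (d / 2)" for w
  proof -
    have "norm (w - z) < d / 2" using that by (simp add: dist_norm norm_minus_commute)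
    then have w: "norm w < 1 - d / 2" "1 - 3 / 2 * d < norm w"
    proof -
      have "norm z = 1 - d" by (simp add: d_def)
      moreover have "norm (w - z) = norm (z - w)" by (rule norm_minus_commute)
      ultimately show "norm w < 1 - d / 2" "1 - 3 / 2 * d < norm w"
        using norm_triangle_ineq2[of w z] norm_triangle_ineq2[of z w] \<open>norm (w - z) < d / 2\<close> by linarith+
    qed
    have "1 - norm w \<le> 1 - (norm w)\<^sup>2" using w d by (simp add: power2_eq_square mult_left_le)
    moreover have "1 - (norm w)\<^sup>2 \<le> 2 * (1 - norm w)"
      using zero_le_power2[of "1 - norm w"] by (simp add: power2_eq_square algebra_simps)
    ultimately show ?thesis using w d by simp
  qed
  have sub: "ball z (d / 2) \<subseteq> ball 0 1" using near by auto
  have hol: "deriv k holomorphic_on ball z (d / 2)"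
    using holomorphic_deriv[OF k open_ball] sub by (rule holomorphic_on_subset)
  have cont: "continuous_on (ball z (d / 2)) (dirichlet_density P k)"
    using continuous_on_dirichlet_density[OF k P] sub by (rule continuous_on_subset)
  have "ennreal (pi * (d / 2)\<^sup>2 * norm (deriv k z) powr P) \<le> (\<integral>\<^sup>+w\<in>ball z (d / 2). ennreal (norm (deriv k w) powr P) \<partial>lborel)"
    by (rule submean_area[OF hol P]) (use d in simp)
  also have "\<dots> \<le> (\<integral>\<^sup>+w. ennreal c * (ennreal (dirichlet_density P k w) * indicator (ball z (d / 2)) w) \<partial>lborel)"
  proof (rule nn_integral_mono)
    fix w
    show "ennreal (norm (deriv k w) powr P) * indicator (ball z (d / 2)) w \<le>
      ennreal c * (ennreal (dirichlet_density P k w) * indicator (ball z (d / 2)) w)"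
    proof (cases "w \<in> ball z (d / 2)")
      case True
      note w = near[OF True]
      have pos: "0 < 1 - (norm w)\<^sup>2" using w d by auto
      have "norm (deriv k w) powr P = dirichlet_density P k w * (1 - (norm w)\<^sup>2) powr (1 - P)"
        using pos by (simp add: dirichlet_density_def mult.assoc powr_add[symmetric])
      also have "\<dots> \<le> dirichlet_density P k w * c"
        unfolding c_def using w d by (intro mult_left_mono powr_comparable dirichlet_density_nonneg) auto
      finally show ?thesis
        using True c by (simp add: ennreal_mult'[symmetric] mult.commute ennreal_leI)
    qed simp
  qed
  also have "\<dots> = ennreal c * dirichlet_energy P k (ball z (d / 2))"
    by (rule nn_integral_cmult) (use measurable_indicator_continuous[OF cont] in simp)
  finally have "ennreal (4 / pi * d powr (P - 1)) * ennreal (pi * (d / 2)\<^sup>2 * norm (deriv k z) powr P) \<le>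
     ennreal (4 / pi * d powr (P - 1)) * (ennreal c * dirichlet_energy P k (ball z (d / 2)))"
    by (intro mult_left_mono) auto
  moreover have "4 / pi * d powr (P - 1) * (pi * (d / 2)\<^sup>2 * norm (deriv k z) powr P) = norm (deriv k z) powr P * d powr (P + 1)"
  proof -
    have "P + 1 = (P - 1) + 2" by simp
    then have "d powr (P + 1) = d powr (P - 1) * d powr 2" by (simp only: powr_add)
    then show ?thesis using d by (simp add: power2_eq_square powr_numeral field_simps)
  qed
  moreover have "4 / pi * d powr (P - 1) * c = 4 * 3 powr \<bar>1 - P\<bar> / pi"
    using d powr_add[of d "P - 1" "1 - P"] by (simp add: c_def)
  moreover have "ennreal (4 / pi * d powr (P - 1)) * ennreal X = ennreal (4 / pi * d powr (P - 1) * X)" for X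
    by (rule ennreal_mult'[symmetric]) simp
  ultimately show ?thesis
    unfolding d_def[symmetric] by (simp only: mult.assoc[symmetric])
qed

abbreviation poisson_kernel :: "complex \<Rightarrow> complex \<Rightarrow> real" where
  "poisson_kernel w \<zeta> \<equiv> (1 - (norm w)\<^sup>2) * norm (1 - cnj w * \<zeta>) powr (- 2)"

text \<open>
  The integral of the Poisson kernel at the boundary point \<open>\<zeta>\<close> against the Dirichlet density. The
  kernel is written with \<open>|1 - cnj w \<zeta>|\<close>, which equals \<open>|\<zeta> - w|\<close> because \<open>|\<zeta>| = 1\<close>.
\<close>

definition dirichlet_balayage :: "real \<Rightarrow> (complex \<Rightarrow> complex) \<Rightarrow> complex \<Rightarrow> ennreal" where
  "dirichlet_balayage P k \<zeta> = (\<integral>\<^sup>+w\<in>ball 0 1. ennreal (dirichlet_density P k w) *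
     ennreal (poisson_kernel w \<zeta>) \<partial>lborel)"

text \<open>
  On the disc of radius \<open>(1 - s) / 2\<close> about \<open>s \<zeta>\<close> the Poisson kernel at \<open>\<zeta>\<close> is bounded below by a multiple
  of \<open>1 / (1 - s)\<close>. The right-hand side does not depend on \<open>s\<close>, so the balayage takes the place of a
  maximal function.
\<close>

lemma deriv_le_balayage:
  assumes k: "k holomorphic_on ball 0 1" and P: "0 < P" and \<zeta>: "norm \<zeta> = 1" and s: "0 \<le> s" "s < 1"
  shows "ennreal (norm (deriv k (of_real s * \<zeta>)) powr P * (1 - s) powr P) \<le>
    ennreal (4 * 3 powr \<bar>1 - P\<bar> / pi * (9 / 2)) * dirichlet_balayage P k \<zeta>"
proof -
  define z where "z = of_real s * \<zeta>"
  define d where "d = 1 - s"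
  define c where "c = 4 * 3 powr \<bar>1 - P\<bar> / pi"
  have nz: "norm z = s" using s \<zeta> by (simp add: z_def norm_mult)
  have d: "0 < d" "d = 1 - norm z" using s nz by (auto simp: d_def)
  have c: "0 < c" by (simp add: c_def)
  have I: "dirichlet_energy P k (ball z (d / 2)) \<le> 
      (\<integral>\<^sup>+w. ennreal (9 / 2 * d) * (ennreal (dirichlet_density P k w) *
     ennreal (poisson_kernel w \<zeta>) * indicator (ball 0 1) w) \<partial>lborel)"
  proof (rule nn_integral_mono)
    fix w
    show "ennreal (dirichlet_density P k w) * indicator (ball z (d / 2)) w \<le>
       ennreal (9 / 2 * d) * (ennreal (dirichlet_density P k w) *
     ennreal (poisson_kernel w \<zeta>) * indicator (ball 0 1) w)"
    proof (cases "w \<in> ball z (d / 2)")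
      case True
      then have wz: "norm (w - z) < d / 2" by (simp add: dist_norm norm_minus_commute)
      then have w: "norm w < 1 - d / 2"
        using norm_triangle_ineq2[of w z] d(2) by linarith
      have W: "d / 2 \<le> 1 - (norm w)\<^sup>2"
        using w d(1) mult_left_le[of "norm w" "norm w"] by (simp add: power2_eq_square)
      have "norm (\<zeta> - z) = d"
      proof -
        have "\<zeta> - z = of_real d * \<zeta>" by (simp add: z_def d_def algebra_simps)
        then show ?thesis using \<zeta> d by (simp add: norm_mult del: of_real_diff)
      qed
      then have "norm (\<zeta> - w) \<le> 3 / 2 * d"
        using norm_triangle_ineq[of "\<zeta> - z" "z - w"] wz by (simp add: norm_minus_commute)
      moreover have "norm (1 - cnj w * \<zeta>) = norm (\<zeta> - w)"
        using norm_blaschke[of w \<zeta>] \<zeta> by (simp add: power2_eq_iff_nonneg)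
      ultimately have up: "norm (1 - cnj w * \<zeta>) \<le> 3 / 2 * d" by simp
      have pos: "0 < norm (1 - cnj w * \<zeta>)"
      proof -
        have "norm w < 1" using w d(1) by linarith
        then have "norm (cnj w * \<zeta>) < 1" using \<zeta> by (simp add: norm_mult)
        then show ?thesis by (metis eq_iff_diff_eq_0 less_irrefl norm_one zero_less_norm_iff)
      qed
      have d0: "0 \<le> d" and W0: "0 \<le> 1 - (norm w)\<^sup>2" using d(1) W by linarith+
      have "1 = 9 / 2 * d * (d / 2 * (3 / 2 * d) powr (- 2))"
        using d(1) by (simp add: powr_minus powr_numeral power2_eq_square field_simps)
      also have "\<dots> \<le> 9 / 2 * d * (poisson_kernel w \<zeta>)"
      proof (rule mult_left_mono)
        show "d / 2 * (3 / 2 * d) powr (- 2) \<le> (1 - (norm w)\<^sup>2) * norm (1 - cnj w * \<zeta>) powr (- 2)"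
          by (rule mult_mono[OF W powr_mono2'[OF _ pos up] W0]) simp_all
        show "0 \<le> 9 / 2 * d" using d0 by simp
      qed
      finally have "dirichlet_density P k w * 1 \<le> dirichlet_density P k w * (9 / 2 * d * (poisson_kernel w \<zeta>))"
        by (rule mult_left_mono) (rule dirichlet_density_nonneg)
      then have "ennreal (dirichlet_density P k w) \<le> ennreal (9 / 2 * d * (dirichlet_density P k w * (poisson_kernel w \<zeta>)))"
        by (intro ennreal_leI) (simp only: mult.right_neutral mult_ac)
      also have "\<dots> = ennreal (9 / 2 * d) * (ennreal (dirichlet_density P k w) *
         ennreal (poisson_kernel w \<zeta>))"
      proof -
        have "ennreal (9 / 2 * d * X) = ennreal (9 / 2 * d) * ennreal X" for X
          using d0 by (intro ennreal_mult') simp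
        then show ?thesis by (simp only: ennreal_mult'[OF dirichlet_density_nonneg])
      qed
      finally have fin: "ennreal (dirichlet_density P k w) \<le> ennreal (9 / 2 * d) * (ennreal (dirichlet_density P k w) *
         ennreal (poisson_kernel w \<zeta>))" .
      have "w \<in> ball 0 1" using w d0 by simp
      then show ?thesis using fin True by (simp only: indicator_simps mult_1_right)
    qed simp
  qed
  have meas: "(\<lambda>w. ennreal (dirichlet_density P k w) * ennreal (poisson_kernel w \<zeta>) * indicator (ball 0 1) w)
      \<in> borel_measurable lborel"
  proof -
    have [measurable]: "(\<lambda>w. ennreal (dirichlet_density P k w) * indicator (ball 0 1) w) \<in> borel_measurable borel"
      by (rule measurable_indicator_continuous[OF continuous_on_dirichlet_density[OF k P]]) simp
    have [measurable]: "(\<lambda>w. norm (1 - cnj w * \<zeta>)) \<in> borel_measurable borel"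
      by (intro borel_measurable_continuous_onI continuous_intros)
    have "(\<lambda>w. ennreal (dirichlet_density P k w) * indicator (ball 0 1) w * ennreal (poisson_kernel w \<zeta>))
      \<in> borel_measurable lborel" by measurable
    then show ?thesis by (simp add: mult_ac)
  qed
  have "ennreal (norm (deriv k z) powr P * d powr (P + 1)) \<le> ennreal c * dirichlet_energy P k (ball z (d / 2))"
    using deriv_area_estimate[OF k P, of z] nz s by (simp add: d c_def)
  also have "\<dots> \<le> ennreal c * (ennreal (9 / 2 * d) * dirichlet_balayage P k \<zeta>)"
    using I unfolding dirichlet_balayage_def nn_integral_cmult[OF meas] by (rule mult_left_mono) simp
  finally have "ennreal (1 / d) * ennreal (norm (deriv k z) powr P * d powr (P + 1)) \<le>
     ennreal (1 / d) * (ennreal c * (ennreal (9 / 2 * d) * dirichlet_balayage P k \<zeta>))"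
    by (rule mult_left_mono) simp
  moreover have "1 / d * (norm (deriv k z) powr P * d powr (P + 1)) = norm (deriv k z) powr P * d powr P"
    using d(1) by (simp add: powr_add)
  moreover have "1 / d * (c * (9 / 2 * d)) = c * (9 / 2)" using d(1) by simp
  ultimately show ?thesis
    using d(1) c unfolding z_def[symmetric] d_def[symmetric] c_def[symmetric]
    by (simp add: ennreal_mult'[symmetric] mult.assoc[symmetric])
qed

text \<open>
  The order of integration is exchanged, and the Poisson kernel has mean one.
\<close>

lemma balayage_circle_integral:
  assumes k: "k holomorphic_on ball 0 1" and P: "0 < P"
  shows "(\<integral>\<^sup>+\<theta>\<in>{0..2*pi}. dirichlet_balayage P k (cis \<theta>) \<partial>lborel) =
    ennreal (2 * pi) * dirichlet_energy P k (ball 0 1)"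
    and "(\<lambda>\<theta>. dirichlet_balayage P k (cis \<theta>)) \<in> borel_measurable lborel"
proof -
  define Q where "Q w = ennreal (dirichlet_density P k w) * indicator (ball 0 1) w" for w
  have [measurable]: "Q \<in> borel_measurable borel" unfolding Q_def
    by (rule measurable_indicator_continuous[OF continuous_on_dirichlet_density[OF k P]]) simp
  have [measurable]: "(\<lambda>(\<theta>, w). norm (1 - cnj w * cis \<theta>)) \<in> borel_measurable (borel \<Otimes>\<^sub>M borel)"
    unfolding borel_prod case_prod_beta by (intro borel_measurable_continuous_onI continuous_intros)
  have bal: "dirichlet_balayage P k (cis \<theta>) = (\<integral>\<^sup>+w. Q w * ennreal (poisson_kernel w (cis \<theta>)) \<partial>lborel)" for \<theta>
    unfolding dirichlet_balayage_def Q_def by (intro nn_integral_cong) (simp add: mult_ac)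
  have m: "(\<lambda>(\<theta>, w). Q w * ennreal (poisson_kernel w (cis \<theta>)))
      \<in> borel_measurable (lborel \<Otimes>\<^sub>M lborel)" by measurable
  show "(\<lambda>\<theta>. dirichlet_balayage P k (cis \<theta>)) \<in> borel_measurable lborel"
    unfolding bal using lborel.borel_measurable_nn_integral_fst[OF m] by simp
  have inner: "(\<integral>\<^sup>+\<theta>. Q w * ennreal (poisson_kernel w (cis \<theta>)) * indicator {0..2*pi} \<theta> \<partial>lborel)
      = ennreal (2 * pi) * Q w" for w
  proof (cases "w \<in> ball 0 1")
    case True
    then have w: "norm (cnj w) < 1" "0 < 1 - (norm w)\<^sup>2" by (auto simp: abs_square_less_1)
    have "((\<lambda>\<theta>. (1 - (norm w)\<^sup>2) * norm (1 - cnj w * cis \<theta>) powr (- 2)) has_integral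
        (1 - (norm w)\<^sup>2) * (2 * pi / (1 - (norm (cnj w))\<^sup>2))) {0..2*pi}"
      by (intro has_integral_mult_right poisson_mean w)
    then have h: "((\<lambda>\<theta>. (1 - (norm w)\<^sup>2) * norm (1 - cnj w * cis \<theta>) powr (- 2)) has_integral 2 * pi) {0..2*pi}"
      using w by simp
    have "(\<integral>\<^sup>+\<theta>\<in>{0..2*pi}. ennreal (poisson_kernel w (cis \<theta>)) \<partial>lborel) = ennreal (2 * pi)"
      by (rule nn_integral_has_integral_lebesgue'[OF _ h]) (use w in auto)
    moreover have "(\<integral>\<^sup>+\<theta>. Q w * (ennreal (poisson_kernel w (cis \<theta>)) * indicator {0..2*pi} \<theta>) \<partial>lborel)
        = Q w * (\<integral>\<^sup>+\<theta>\<in>{0..2*pi}. ennreal (poisson_kernel w (cis \<theta>)) \<partial>lborel)"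
      by (rule nn_integral_cmult) measurable
    ultimately show ?thesis by (simp only: mult.assoc) (simp only: mult.commute)
  next
    case False
    then show ?thesis by (simp add: Q_def)
  qed
  have "(\<integral>\<^sup>+\<theta>\<in>{0..2*pi}. dirichlet_balayage P k (cis \<theta>) \<partial>lborel) =
     (\<integral>\<^sup>+\<theta>. (\<integral>\<^sup>+w. Q w * ennreal (poisson_kernel w (cis \<theta>)) * indicator {0..2*pi} \<theta> \<partial>lborel) \<partial>lborel)"
    unfolding bal by (intro nn_integral_cong nn_integral_multc[symmetric]) measurable
  also have "\<dots> = (\<integral>\<^sup>+w. (\<integral>\<^sup>+\<theta>. Q w * ennreal (poisson_kernel w (cis \<theta>)) * indicator {0..2*pi} \<theta> \<partial>lborel) \<partial>lborel)"
    by (rule lborel_pair.Fubini'[symmetric]) measurable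
  also have "\<dots> = ennreal (2 * pi) * (\<integral>\<^sup>+w. Q w \<partial>lborel)"
    unfolding inner by (rule nn_integral_cmult) measurable
  finally show "(\<integral>\<^sup>+\<theta>\<in>{0..2*pi}. dirichlet_balayage P k (cis \<theta>) \<partial>lborel) =
    ennreal (2 * pi) * dirichlet_energy P k (ball 0 1)"
    by (simp add: Q_def)
qed


text \<open>
  Boundedness needs a constant that does not depend on the functions involved, so it is made explicit.
\<close>

definition core_constant :: "real \<Rightarrow> real \<Rightarrow> real \<Rightarrow> real" where
  "core_constant p q P = (11 / 2) powr (1 / q) *
    ((2 / (1 / p - 1 / q) + q) * (1 + 2 * P / (1 - p / q)) powr (P / p)) *
    (1 + 4 * 3 powr \<bar>1 - P\<bar>) powr (1 / p)"

text \<open>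
  The common core of both sufficiency statements. On the radius of \<open>\<zeta>\<close> the estimate
  is applied with \<open>A\<close> a fixed multiple of \<open>N\<close> and with \<open>x\<close> chosen such that \<open>(A x)^P\<close> is \<open>A^P\<close>
  plus a multiple of the balayage at \<open>\<zeta>\<close>. The resulting bound contains \<open>x^(P/q)\<close>, whose \<open>q\<close>-th
  power is affine in the balayage and can be integrated over the circle.
\<close>

lemma T_op_mean_bound:
  fixes f g k :: "complex \<Rightarrow> complex" and p q P K N :: real
  assumes pq: "0 < p" "p < q" and "0 < P" "0 < K" "0 < N"
    and f: "f holomorphic_on ball 0 1" and g: "g holomorphic_on ball 0 1" and k: "k holomorphic_on ball 0 1"
    and fk: "\<And>z. norm z < 1 \<Longrightarrow> norm (f z) \<le> norm (k z) powr (P / p)"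
    and g': "\<And>z. norm z < 1 \<Longrightarrow> norm (deriv g z) \<le> K * (1 - norm z) powr (1 / p - 1 / q - 1)"
    and k0: "norm (k 0) \<le> N"
    and I: "dirichlet_energy P k (ball 0 1) \<le> ennreal (pi * N powr P)"
    and r: "0 \<le> r" "r < 1"
  shows "hardy_mean q (T_op g f) r \<le> core_constant p q P * K * N powr (P / p)"
proof -
  have q: "0 < q" using pq by simp
  define c where "c = 4 * 3 powr \<bar>1 - P\<bar> / pi"
  \<comment> \<open>The summand \<open>1\<close> ensures \<open>N \<le> A\<close>, so that \<open>A\<close> also bounds \<open>k\<close> at the origin.\<close>
  define A where "A = (1 + c * pi) powr (1 / P) * N"
  define C0 where "C0 = (2 / (1 / p - 1 / q) + q) * (1 + 2 * P / (1 - p / q)) powr (P / p)"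
  define E where "E = (C0 * K * A powr (P / p)) powr q"
  have c: "0 < c" by (simp add: c_def)
  have cp: "0 < c * pi" using c by simp
  have C0: "0 < C0"
  proof -
    have "2 / (1 / p - 1 / q) + q > 0" using pq q by (intro add_nonneg_pos) (auto simp: field_simps)
    moreover have "1 + 2 * P / (1 - p / q) > 0" using pq \<open>0 < P\<close> by (intro add_pos_nonneg divide_nonneg_nonneg) auto
    ultimately show ?thesis by (simp add: C0_def)
  qed
  have AP: "A powr P = (1 + c * pi) * N powr P"
    using cp \<open>0 < P\<close> \<open>0 < N\<close> by (simp add: A_def powr_mult powr_powr)
  have AN: "N \<le> A"
  proof -
    have "1 \<le> (1 + c * pi) powr (1 / P)" using cp \<open>0 < P\<close> by (intro ge_one_powr_ge_zero) auto
    then have "1 * N \<le> (1 + c * pi) powr (1 / P) * N" using \<open>0 < N\<close> by (intro mult_right_mono) auto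
    then show ?thesis by (simp add: A_def)
  qed
  have A: "0 < A" using AN \<open>0 < N\<close> by simp
  have Fhol: "T_op g f holomorphic_on ball 0 1" by (rule T_op_holomorphic[OF f g])
  have growth: "norm (deriv k z) \<le> A * (1 - norm z) powr (- 1 - 1 / P)" if z: "norm z < 1" for z
  proof -
    have sub: "ball z ((1 - norm z) / 2) \<subseteq> ball 0 1"
    proof
      fix w assume "w \<in> ball z ((1 - norm z) / 2)"
      then have "norm (w - z) < (1 - norm z) / 2" by (simp add: dist_norm norm_minus_commute)
      moreover have "norm w \<le> norm z + norm (w - z)" using norm_triangle_ineq[of z "w - z"] by simp
      ultimately have "norm w < 1" using z by (simp add: field_simps)
      then show "w \<in> ball 0 1" by simp
    qed
    have "ennreal (norm (deriv k z) powr P * (1 - norm z) powr (P + 1)) \<le>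
        ennreal c * dirichlet_energy P k (ball z ((1 - norm z) / 2))"
      unfolding c_def by (rule deriv_area_estimate[OF k \<open>0 < P\<close> z])
    also have "\<dots> \<le> ennreal c * dirichlet_energy P k (ball 0 1)"
      using sub by (intro mult_left_mono nn_integral_mono) (auto split: split_indicator)
    also have "\<dots> \<le> ennreal c * ennreal (pi * N powr P)" by (intro mult_left_mono I) simp
    also have "\<dots> = ennreal (c * (pi * N powr P))" using c by (simp add: ennreal_mult')
    finally have "norm (deriv k z) powr P * (1 - norm z) powr (P + 1) \<le> c * pi * N powr P"
      using c by (simp add: ennreal_le_iff mult.assoc)
    also have "\<dots> \<le> A powr P" unfolding AP by (intro mult_right_mono) auto
    finally have "norm (deriv k z) powr P \<le> A powr P * (1 - norm z) powr (- (P + 1))"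
      using z unfolding powr_minus_divide by (subst times_divide_eq_right, subst pos_le_divide_eq) auto
    then have "(norm (deriv k z) powr P) powr (1 / P) \<le> (A powr P * (1 - norm z) powr (- (P + 1))) powr (1 / P)"
      using \<open>0 < P\<close> by (intro powr_mono2) auto
    moreover have "(A powr P * (1 - norm z) powr (- (P + 1))) powr (1 / P) = A * (1 - norm z) powr (- (P + 1) * (1 / P))"
      unfolding powr_mult powr_powr using \<open>0 < P\<close> A by simp
    moreover have "- (P + 1) * (1 / P) = - 1 - 1 / P" using \<open>0 < P\<close> by (simp add: field_simps)
    ultimately show ?thesis using \<open>0 < P\<close> by (simp add: powr_powr)
  qed
  have C0K: "0 \<le> C0 * K * A powr (P / p)" using C0 \<open>0 < K\<close> by simp
  have point: "ennreal (norm (T_op g f (of_real r * cis \<theta>)) powr q) \<le>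
      ennreal E + ennreal (E * (c * (9 / 2)) / A powr P) * dirichlet_balayage P k (cis \<theta>)" for \<theta>
  proof (cases "dirichlet_balayage P k (cis \<theta>) = top")
    case True
    \<comment> \<open>Where the balayage is infinite the bound is trivial, its coefficient being positive.\<close>
    have "0 < E" using C0 \<open>0 < K\<close> A by (simp add: E_def)
    then have pos: "0 < E * (c * (9 / 2)) / A powr P" using c A by simp
    have "ennreal X * top = top" if "0 < X" for X :: real
      using that by (simp only: ennreal_mult_eq_top_iff) (simp add: ennreal_eq_0_iff)
    from this[OF pos] show ?thesis unfolding True by simp
  next
    case False
    then obtain v where v: "dirichlet_balayage P k (cis \<theta>) = ennreal v" "0 \<le> v"
      by (cases "dirichlet_balayage P k (cis \<theta>)") auto
    \<comment> \<open>Chosen such that \<open>(A x)^P\<close> exceeds the bound for \<open>((1 - t) |k'|)^P\<close> and \<open>x \<ge> 1\<close>.\<close>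
    define x where "x = (1 + c * (9 / 2) * v / A powr P) powr (1 / P)"
    have base: "1 \<le> 1 + c * (9 / 2) * v / A powr P" using c v by simp
    have x: "1 \<le> x" unfolding x_def using base \<open>0 < P\<close> by (intro ge_one_powr_ge_zero) auto
    have xP: "x powr P = 1 + c * (9 / 2) * v / A powr P"
      using base \<open>0 < P\<close> by (simp add: x_def powr_powr)
    have AxP: "(A * x) powr P = A powr P + c * (9 / 2) * v"
      unfolding powr_mult xP using A by (simp add: field_simps)
    have k1: "norm (deriv k (of_real t * cis \<theta>)) \<le> A * x * (1 - t) powr (- 1)" if t: "0 \<le> t" "t < 1" for t
    proof -
      have "ennreal (norm (deriv k (of_real t * cis \<theta>)) powr P * (1 - t) powr P) \<le> ennreal (c * (9 / 2)) * ennreal v"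
        using deriv_le_balayage[OF k \<open>0 < P\<close> _ t, of "cis \<theta>"] by (simp add: v c_def)
      also have "\<dots> = ennreal (c * (9 / 2) * v)" using c by (intro ennreal_mult'[symmetric]) simp
      finally have "norm (deriv k (of_real t * cis \<theta>)) powr P * (1 - t) powr P \<le> c * (9 / 2) * v"
        using c v by (subst (asm) ennreal_le_iff) auto
      also have "\<dots> \<le> (A * x) powr P" unfolding AxP by simp
      finally have "(norm (deriv k (of_real t * cis \<theta>)) * (1 - t)) powr P \<le> (A * x) powr P"
        by (simp only: powr_mult)
      then have "norm (deriv k (of_real t * cis \<theta>)) * (1 - t) \<le> A * x"
        using A x t \<open>0 < P\<close> by (meson mult_nonneg_nonneg not_le powr_less_mono2 order.strict_trans2 less_imp_le zero_le_one order_trans)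
      then show ?thesis using t by (simp add: powr_minus_divide field_simps)
    qed
    have k2: "norm (deriv k (of_real t * cis \<theta>)) \<le> A * (1 - t) powr (- 1 - 1 / P)" if t: "0 \<le> t" "t < 1" for t
      using growth[of "of_real t * cis \<theta>"] t by (simp add: norm_mult)
    have "norm (T_op g f (of_real r * cis \<theta>)) \<le> C0 * K * A powr (P / p) * x powr (P / q)"
      unfolding C0_def
      by (rule T_op_ray_bound[OF pq \<open>0 < P\<close> A x \<open>0 < K\<close> f g k fk g' _ _ k1 k2 r]) (use k0 AN in auto)
    then have "norm (T_op g f (of_real r * cis \<theta>)) powr q \<le> (C0 * K * A powr (P / p) * x powr (P / q)) powr q"
      using q by (intro powr_mono2) auto
    also have "\<dots> = E * x powr P"
      unfolding powr_mult[of "C0 * K * A powr (P / p)"] E_def using q by (simp add: powr_powr)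
    also have "\<dots> = E + E * (c * (9 / 2)) / A powr P * v" by (simp add: xP algebra_simps)
    finally have "ennreal (norm (T_op g f (of_real r * cis \<theta>)) powr q) \<le> ennreal (E + E * (c * (9 / 2)) / A powr P * v)"
      by (rule ennreal_leI)
    then show ?thesis
      using c v by (simp add: v(1) ennreal_mult'[symmetric] ennreal_plus[symmetric] E_def del: ennreal_plus)
  qed
  define M where "M = integral {0..2*pi} (\<lambda>\<theta>. norm (T_op g f (of_real r * cis \<theta>)) powr q)"
  have contF: "continuous_on {0..2*pi} (\<lambda>\<theta>. norm (T_op g f (of_real r * cis \<theta>)) powr q)"
    by (intro continuous_on_powr' continuous_on_norm continuous_on_compose2[OF holomorphic_on_imp_continuous_on[OF Fhol]] continuous_intros)
      (use r q in \<open>auto simp: norm_mult\<close>)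
  have E: "0 \<le> E" by (simp add: E_def)
  have "ennreal M = (\<integral>\<^sup>+\<theta>\<in>{0..2*pi}. ennreal (norm (T_op g f (of_real r * cis \<theta>)) powr q) \<partial>lborel)"
    unfolding M_def by (rule nn_integral_interval[OF contF, symmetric]) simp
  also have "\<dots> \<le> (\<integral>\<^sup>+\<theta>. ennreal E * indicator {0..2*pi} \<theta> +
      ennreal (E * (c * (9 / 2)) / A powr P) * (dirichlet_balayage P k (cis \<theta>) * indicator {0..2*pi} \<theta>) \<partial>lborel)"
  proof (rule nn_integral_mono)
    fix \<theta>
    show "ennreal (norm (T_op g f (of_real r * cis \<theta>)) powr q) * indicator {0..2*pi} \<theta> \<le>
       ennreal E * indicator {0..2*pi} \<theta> +
      ennreal (E * (c * (9 / 2)) / A powr P) * (dirichlet_balayage P k (cis \<theta>) * indicator {0..2*pi} \<theta>)"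
      using point[of \<theta>] by (simp split: split_indicator)
  qed
  also have "\<dots> = ennreal E * ennreal (2 * pi) +
      ennreal (E * (c * (9 / 2)) / A powr P) * (\<integral>\<^sup>+\<theta>\<in>{0..2*pi}. dirichlet_balayage P k (cis \<theta>) \<partial>lborel)"
  proof -
    have [measurable]: "(\<lambda>\<theta>. dirichlet_balayage P k (cis \<theta>)) \<in> borel_measurable lborel"
      by (rule balayage_circle_integral[OF k \<open>0 < P\<close>])
    show ?thesis by (simp add: nn_integral_add nn_integral_cmult)
  qed
  also have "\<dots> \<le> ennreal E * ennreal (2 * pi) +
      ennreal (E * (c * (9 / 2)) / A powr P) * (ennreal (2 * pi) * ennreal (pi * N powr P))"
    unfolding balayage_circle_integral[OF k \<open>0 < P\<close>]
    by (intro add_left_mono mult_left_mono I) auto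
  also have "\<dots> = ennreal (E * (2 * pi) + E * (c * (9 / 2)) / A powr P * (2 * pi * (pi * N powr P)))"
    using E c by (simp add: ennreal_mult'[symmetric] ennreal_plus[symmetric] del: ennreal_plus)
  finally have "M \<le> E * (2 * pi) + E * (c * (9 / 2)) / A powr P * (2 * pi * (pi * N powr P))"
    using E c by (subst (asm) ennreal_le_iff) auto
  also have "\<dots> \<le> 2 * pi * (11 / 2 * E)"
  proof -
    have "c * pi * N powr P / A powr P \<le> 1"
    proof -
      have "c * pi * N powr P \<le> A powr P" unfolding AP by (intro mult_right_mono) auto
      then show ?thesis using A by simp
    qed
    then have "E * (9 / 2) * (2 * pi) * (c * pi * N powr P / A powr P) \<le> E * (9 / 2) * (2 * pi) * 1"
      using E by (intro mult_left_mono) auto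
    then show ?thesis by (simp add: algebra_simps)
  qed
  finally have "circle_mean q (T_op g f) r \<le> 11 / 2 * E"
    unfolding circle_mean_def M_def[symmetric] by (simp add: field_simps)
  then have "hardy_mean q (T_op g f) r \<le> (11 / 2 * E) powr (1 / q)"
    unfolding hardy_mean_eq using q by (intro powr_mono2 circle_mean_nonneg) auto
  also have "\<dots> = (11 / 2) powr (1 / q) * (C0 * K * A powr (P / p))"
    unfolding powr_mult[of "11 / 2"] E_def using q C0K by (simp add: powr_powr)
  also have "A powr (P / p) = (1 + c * pi) powr (1 / p) * N powr (P / p)"
    unfolding A_def powr_mult powr_powr using \<open>0 < P\<close> by simp
  also have "c * pi = 4 * 3 powr \<bar>1 - P\<bar>" by (simp add: c_def)
  finally show ?thesis by (simp add: core_constant_def C0_def mult_ac)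
qed

section \<open>Lipschitz spaces and the growth of the derivative\<close>

text \<open>
  Both points are moved towards the centre by the factor \<open>1 - d\<close> with \<open>d = |z - w|\<close>, at a cost of
  order \<open>d^\<alpha>\<close> each, and joined by a segment on which \<open>|g'|\<close> is at most \<open>K d^(\<alpha> - 1)\<close>. If
  \<open>d \<ge> 1\<close>, they are moved to the centre itself.
\<close>

lemma holder_of_deriv_bound:
  assumes g: "g holomorphic_on ball 0 1" and \<alpha>: "0 < \<alpha>" "\<alpha> \<le> 1" and K: "0 \<le> K"
    and bound: "\<And>z. norm z < 1 \<Longrightarrow> norm (deriv g z) \<le> K * (1 - norm z) powr (\<alpha> - 1)"
    and z: "norm z < 1" and w: "norm w < 1"
  shows "norm (g z - g w) \<le> (2 / \<alpha> + 1) * K * norm (z - w) powr \<alpha>"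
proof -
  have radial: "norm (g u - g (of_real (1 - d) * u)) \<le> K / \<alpha> * d powr \<alpha>"
    if u: "norm u < 1" and d: "0 < d" "d \<le> 1" for u d
  proof -
    have inb: "of_real t * u \<in> ball 0 1" if "0 \<le> t" "t \<le> 1" for t
      using that u mult_left_le_one_le[of "norm u" t] by (simp add: norm_mult)
    have "norm (g (of_real 1 * u) - g (of_real (1 - d) * u)) \<le>
        - (K / \<alpha> * (1 - 1) powr \<alpha>) - (- (K / \<alpha> * (1 - (1 - d)) powr \<alpha>))"
    proof (rule differentiable_bound_general)
      show "1 - d < 1" using d by simp
      show "continuous_on {1 - d..1} (\<lambda>t. g (of_real t * u))"
        by (intro continuous_on_compose2[OF holomorphic_on_imp_continuous_on[OF g]] continuous_intros)
          (use inb d in auto)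
      show "continuous_on {1 - d..1} (\<lambda>t. - (K / \<alpha> * (1 - t) powr \<alpha>))"
        using \<alpha> by (intro continuous_intros continuous_on_powr') auto
      fix t assume t: "1 - d < t" "t < 1"
      then have t0: "0 \<le> t" "t < 1" using d by auto
      show "((\<lambda>t. g (of_real t * u)) has_vector_derivative deriv g (of_real t * u) * u) (at t)"
        using holomorphic_derivI[OF g open_ball inb[of t]] t0 by (intro has_vector_derivative_ray) auto
      show "((\<lambda>t. - (K / \<alpha> * (1 - t) powr \<alpha>)) has_vector_derivative K * (1 - t) powr (\<alpha> - 1)) (at t)"
        unfolding has_real_derivative_iff_has_vector_derivative[symmetric] using t0 \<alpha>
        by (auto intro!: derivative_eq_intros)
      have "t * norm u \<le> t" using t0 u by (simp add: mult_left_le)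
      then have nt: "norm (of_real t * u) \<le> t" "norm (of_real t * u) < 1" using t0 by (auto simp: norm_mult)
      have "norm (deriv g (of_real t * u)) \<le> K * (1 - norm (of_real t * u)) powr (\<alpha> - 1)"
        by (rule bound[OF nt(2)])
      also have "\<dots> \<le> K * (1 - t) powr (\<alpha> - 1)"
        using nt t0 \<alpha> K by (intro mult_left_mono powr_mono2') auto
      finally have "norm (deriv g (of_real t * u)) * norm u \<le> K * (1 - t) powr (\<alpha> - 1) * 1"
        using u K by (intro mult_mono) auto
      then show "norm (deriv g (of_real t * u) * u) \<le> K * (1 - t) powr (\<alpha> - 1)"
        by (simp add: norm_mult)
    qed
    then show ?thesis using \<alpha> by simp
  qed
  show ?thesis
  proof (cases "z = w")
    case False
    define d where "d = min 1 (norm (z - w))"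
    have d: "0 < d" "d \<le> 1" using False by (auto simp: d_def)
    define z' w' where "z' = of_real (1 - d) * z" and "w' = of_real (1 - d) * w"
    have mid: "norm (g z' - g w') \<le> K * d powr \<alpha>"
    proof (cases "d = 1")
      case True
      then show ?thesis using K by (simp add: z'_def w'_def)
    next
      case False
      then have deq: "d = norm (z - w)" "d < 1" using d by (auto simp: d_def)
      have "norm (g z' - g w') \<le> K * d powr (\<alpha> - 1) * norm (z' - w')"
      proof (rule field_differentiable_bound)
        show "convex (cball (0::complex) (1 - d))" by simp
        fix x :: complex assume x: "x \<in> cball 0 (1 - d)"
        then have nx: "norm x < 1" "d \<le> 1 - norm x" using d by auto
        show "(g has_field_derivative deriv g x) (at x within cball 0 (1 - d))"
          using holomorphic_derivI[OF g open_ball, of x] nx by simp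
        have "norm (deriv g x) \<le> K * (1 - norm x) powr (\<alpha> - 1)" by (rule bound[OF nx(1)])
        also have "\<dots> \<le> K * d powr (\<alpha> - 1)"
          using nx d \<alpha> K by (intro mult_left_mono powr_mono2') auto
        finally show "norm (deriv g x) \<le> K * d powr (\<alpha> - 1)" .
      next
        show "z' \<in> cball 0 (1 - d)" "w' \<in> cball 0 (1 - d)"
          using deq z w by (auto simp: z'_def w'_def norm_mult mult_left_le simp del: of_real_diff)
      qed
      also have "\<dots> \<le> K * d powr (\<alpha> - 1) * d"
      proof -
        have "z' - w' = of_real (1 - d) * (z - w)" by (simp add: z'_def w'_def algebra_simps)
        then have "norm (z' - w') = (1 - d) * d" using deq by (simp add: norm_mult del: of_real_diff)
        also have "\<dots> \<le> d" using d by (simp add: algebra_simps)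
        finally show ?thesis using K by (intro mult_left_mono) auto
      qed
      also have "\<dots> = K * d powr \<alpha>" using d(1) by (simp add: powr_diff)
      finally show ?thesis .
    qed
    have "norm (g z - g w) \<le> norm (g z - g z') + norm (g z' - g w') + norm (g w' - g w)"
      using norm_triangle_ineq[of "g z - g z'" "g z' - g w"] norm_triangle_ineq[of "g z' - g w'" "g w' - g w"] by simp
    also have "\<dots> \<le> K / \<alpha> * d powr \<alpha> + K * d powr \<alpha> + K / \<alpha> * d powr \<alpha>"
      using radial[OF z d] radial[OF w d] mid unfolding z'_def w'_def
      by (intro add_mono) (auto simp: norm_minus_commute)
    also have "\<dots> = (2 / \<alpha> + 1) * K * d powr \<alpha>" by (simp add: algebra_simps)
    also have "\<dots> \<le> (2 / \<alpha> + 1) * K * norm (z - w) powr \<alpha>"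
      using \<alpha> K d by (intro mult_left_mono powr_mono2 mult_nonneg_nonneg) (auto simp: d_def)
    finally show ?thesis .
  qed (use K \<alpha> in auto)
qed

lemma norm_cis_diff: "norm (cis (\<theta> + t) - cis \<theta>) = 2 * \<bar>sin (t / 2)\<bar>"
proof -
  have "cis (\<theta> + t) - cis \<theta> = cis \<theta> * (exp (\<i> * of_real t) - 1)"
    by (simp add: cis_conv_exp[symmetric] cis_mult right_diff_distrib)
  then have "norm (cis (\<theta> + t) - cis \<theta>) = norm (exp (\<i> * of_real t) - 1)"
    by (simp only: norm_mult norm_cis mult_1)
  then show ?thesis by (simp only: dist_exp_i_1)
qed

text \<open>
  The Hoelder estimate makes \<open>g\<close> uniformly continuous, hence extensible to the closed disc, and it
  passes to boundary points along radii.
\<close>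

lemma lipschitz_space_of_deriv_bound:
  assumes g: "g holomorphic_on ball 0 1" and \<alpha>: "0 < \<alpha>" "\<alpha> \<le> 1" and K: "0 \<le> K"
    and bound: "\<And>z. norm z < 1 \<Longrightarrow> norm (deriv g z) \<le> K * (1 - norm z) powr (\<alpha> - 1)"
  shows "g \<in> lipschitz_space \<alpha>"
proof -
  define C where "C = (2 / \<alpha> + 1) * K"
  have C: "0 \<le> C" using K \<alpha> by (simp add: C_def)
  have hol: "norm (g z - g w) \<le> C * norm (z - w) powr \<alpha>" if "z \<in> ball 0 1" "w \<in> ball 0 1" for z w
    unfolding C_def using holder_of_deriv_bound[OF g \<alpha> K bound, of z w] that by simp
  have uc: "uniformly_continuous_on (ball 0 1) g"
    unfolding uniformly_continuous_on_def
  proof (intro allI impI)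
    fix e :: real assume e: "0 < e"
    define d where "d = (e / (C + 1)) powr (1 / \<alpha>)"
    have d: "0 < d" using e C by (simp add: d_def)
    have "dist (g w) (g z) < e" if "z \<in> ball 0 1" "w \<in> ball 0 1" "dist w z < d" for z w
    proof -
      have "norm (w - z) powr \<alpha> \<le> d powr \<alpha>"
        using that \<alpha> by (intro powr_mono2) (auto simp: dist_norm)
      also have "d powr \<alpha> = e / (C + 1)" using \<alpha> e C by (simp add: d_def powr_powr)
      finally have "C * norm (w - z) powr \<alpha> \<le> C * (e / (C + 1))" using C by (rule mult_left_mono)
      also have "\<dots> < e" using e C by (simp add: field_simps)
      finally show ?thesis using hol[OF that(2,1)] by (simp add: dist_norm)
    qed
    then show "\<exists>d>0. \<forall>x\<in>ball 0 1. \<forall>x'\<in>ball 0 1. dist x' x < d \<longrightarrow> dist (g x') (g x) < e"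
      using d by blast
  qed
  obtain G where G: "uniformly_continuous_on (closure (ball 0 1)) G" "\<And>x. x \<in> ball 0 1 \<Longrightarrow> g x = G x"
    using uniformly_continuous_on_extension_on_closure[OF uc] by metis
  have Gc: "continuous_on (cball 0 1) G"
    using uniformly_continuous_imp_continuous[OF G(1)] by simp
  have lip: "norm (G \<zeta> - G \<xi>) \<le> C * norm (\<zeta> - \<xi>) powr \<alpha>" if "norm \<zeta> = 1" "norm \<xi> = 1" for \<zeta> \<xi>
  proof -
    have lim: "((\<lambda>r. G (of_real r * u)) \<longlongrightarrow> G u) (at_left 1)" if "norm u = 1" for u
    proof -
      have "continuous_on {0..1} (\<lambda>r. G (of_real r * u))"
        by (intro continuous_on_compose2[OF Gc] continuous_intros) (use that in \<open>auto simp: norm_mult\<close>)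
      then have "((\<lambda>r. G (of_real r * u)) \<longlongrightarrow> G (of_real 1 * u)) (at 1 within {0..1})"
        unfolding continuous_on_def by (rule bspec) simp
      then show ?thesis by (simp add: at_within_Icc_at_left)
    qed
    show ?thesis
    proof (rule tendsto_le)
      show "((\<lambda>r. norm (G (of_real r * \<zeta>) - G (of_real r * \<xi>))) \<longlongrightarrow> norm (G \<zeta> - G \<xi>)) (at_left 1)"
        by (intro tendsto_intros lim that)
      show "((\<lambda>r. C * norm (\<zeta> - \<xi>) powr \<alpha>) \<longlongrightarrow> C * norm (\<zeta> - \<xi>) powr \<alpha>) (at_left (1::real))" by simp
      have "\<forall>\<^sub>F r::real in at_left 1. r \<in> {0<..<1}" by (rule eventually_at_left_real) simp
      then show "\<forall>\<^sub>F r in at_left 1. norm (G (of_real r * \<zeta>) - G (of_real r * \<xi>)) \<le> C * norm (\<zeta> - \<xi>) powr \<alpha>"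
      proof eventually_elim
        case (elim r)
        have inb: "of_real r * \<zeta> \<in> ball 0 1" "of_real r * \<xi> \<in> ball 0 1" using elim that by (auto simp: norm_mult)
        have "norm (of_real r * \<zeta> - of_real r * \<xi>) = r * norm (\<zeta> - \<xi>)"
          using elim by (simp add: norm_mult right_diff_distrib[symmetric])
        then have le: "norm (of_real r * \<zeta> - of_real r * \<xi>) \<le> norm (\<zeta> - \<xi>)"
          using elim by (simp add: mult_left_le_one_le)
        have "norm (G (of_real r * \<zeta>) - G (of_real r * \<xi>)) \<le> C * norm (of_real r * \<zeta> - of_real r * \<xi>) powr \<alpha>"
          using hol[OF inb] inb by (simp add: G(2))
        also have "\<dots> \<le> C * norm (\<zeta> - \<xi>) powr \<alpha>"
          using le C \<alpha> by (intro mult_left_mono powr_mono2) auto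
        finally show ?case .
      qed
    qed simp
  qed
  have "bdd_above {norm (G (cis (\<theta> + t)) - G (cis \<theta>)) / t powr \<alpha> |\<theta> t. \<theta> \<in> {0..2 * pi} \<and> t \<in> {0<..<1}}"
  proof (rule bdd_aboveI)
    fix y assume "y \<in> {norm (G (cis (\<theta> + t)) - G (cis \<theta>)) / t powr \<alpha> |\<theta> t. \<theta> \<in> {0..2 * pi} \<and> t \<in> {0<..<1}}"
    then obtain \<theta> t where y: "y = norm (G (cis (\<theta> + t)) - G (cis \<theta>)) / t powr \<alpha>" and t: "0 < t" by auto
    have "norm (cis (\<theta> + t) - cis \<theta>) \<le> t"
      using abs_sin_x_le_abs_x[of "t / 2"] t by (simp add: norm_cis_diff)
    then have "C * norm (cis (\<theta> + t) - cis \<theta>) powr \<alpha> \<le> C * t powr \<alpha>"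
      using C \<alpha> by (intro mult_left_mono powr_mono2) auto
    then have "norm (G (cis (\<theta> + t)) - G (cis \<theta>)) \<le> C * t powr \<alpha>"
      using lip[of "cis (\<theta> + t)" "cis \<theta>"] by simp
    then show "y \<le> C" using t by (simp add: y field_simps)
  qed
  then show ?thesis unfolding lipschitz_space_def using g Gc G(2) by auto
qed

lemma sin_half_lower:
  fixes t :: real
  assumes "0 \<le> t" "t \<le> 1"
  shows "t / 4 \<le> sin (t / 2)"
proof -
  have "\<exists>y. ((\<lambda>y. sin y - y / 2) has_real_derivative y) (at x) \<and> 0 \<le> y" if x: "0 \<le> x" "x \<le> t / 2" for x :: real
  proof -
    have "x \<le> pi / 3" using x assms pi_gt3 by simp
    then have "cos (pi / 3) \<le> cos x" using x by (intro cos_monotone_0_pi_le) auto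
    then have "0 \<le> cos x - 1 / 2" by (simp add: cos_60)
    moreover have "((\<lambda>y. sin y - y / 2) has_real_derivative cos x - 1 / 2) (at x)"
      by (auto intro!: derivative_eq_intros)
    ultimately show ?thesis by blast
  qed
  then have "sin 0 - 0 / 2 \<le> sin (t / 2) - (t / 2) / 2"
    using assms DERIV_nonneg_imp_nondecreasing[of 0 "t / 2" "\<lambda>y. sin y - y / 2"] by simp
  then show ?thesis by simp
qed

text \<open>
  The defining condition compares points whose arguments differ by less than one; here it is restated
  for chords. Distant points are covered by the boundedness of \<open>G\<close>.
\<close>

lemma boundary_holder:
  assumes G: "continuous_on (cball 0 1) G" and \<alpha>: "0 < \<alpha>" "\<alpha> \<le> 1"
    and B: "\<And>\<theta> t. \<theta> \<in> {0..2 * pi} \<Longrightarrow> 0 < t \<Longrightarrow> t < 1 \<Longrightarrow> norm (G (cis (\<theta> + t)) - G (cis \<theta>)) \<le> B * t powr \<alpha>"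
  shows "\<exists>L\<ge>0. \<forall>\<zeta> \<xi>. norm \<zeta> = 1 \<longrightarrow> norm \<xi> = 1 \<longrightarrow> norm (G \<zeta> - G \<xi>) \<le> L * norm (\<zeta> - \<xi>) powr \<alpha>"
proof -
  have "compact (G ` cball 0 1)" using G by (intro compact_continuous_image) auto
  then obtain M where M: "\<And>z. z \<in> cball 0 1 \<Longrightarrow> norm (G z) \<le> M"
    using compact_imp_bounded bounded_iff by (metis (no_types, lifting) image_eqI)
  have M0: "0 \<le> M" using M[of 0] norm_ge_zero[of "G 0"] by (simp del: norm_ge_zero)
  define B' where "B' = max B 0"
  have B': "0 \<le> B'" by (simp add: B'_def)
  \<comment> \<open>The argument increases from \<open>\<xi>\<close> to \<open>\<zeta>\<close>; if it decreases, the two points are exchanged.\<close>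
  have near: "norm (G \<zeta> - G \<xi>) \<le> 4 * B' * norm (\<zeta> - \<xi>) powr \<alpha>"
    if \<xi>: "norm \<xi> = 1" and \<zeta>: "\<zeta> = \<xi> * cis t" and t: "0 < t" "t < 1" for \<zeta> \<xi> t
  proof -
    obtain b where b: "\<xi> = cis b" "b \<in> {0..2 * pi}"
      using \<xi> Arg2pi_eq[of \<xi>] Arg2pi_ge_0[of \<xi>] Arg2pi_lt_2pi[of \<xi>]
      by (intro that[of "Arg2pi \<xi>"]) (auto simp: cis_conv_exp)
    have \<zeta>': "\<zeta> = cis (b + t)" by (simp add: \<zeta> b cis_mult)
    have "t / 4 \<le> sin (t / 2)" using t by (intro sin_half_lower) auto
    then have "t \<le> 2 * norm (\<zeta> - \<xi>)" unfolding \<zeta>' b(1) norm_cis_diff by simp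
    then have "t powr \<alpha> \<le> (2 * norm (\<zeta> - \<xi>)) powr \<alpha>" using t \<alpha> by (intro powr_mono2) auto
    also have "\<dots> = 2 powr \<alpha> * norm (\<zeta> - \<xi>) powr \<alpha>" by (simp add: powr_mult)
    also have "\<dots> \<le> 2 * norm (\<zeta> - \<xi>) powr \<alpha>"
      using \<alpha> powr_mono[of \<alpha> 1 2] by (intro mult_right_mono) auto
    finally have t\<alpha>: "t powr \<alpha> \<le> 2 * norm (\<zeta> - \<xi>) powr \<alpha>" .
    have "norm (G \<zeta> - G \<xi>) \<le> B * t powr \<alpha>" unfolding \<zeta>' b(1) by (rule B[OF b(2) t])
    also have "\<dots> \<le> B' * t powr \<alpha>" by (intro mult_right_mono) (auto simp: B'_def)
    also have "\<dots> \<le> B' * (2 * norm (\<zeta> - \<xi>) powr \<alpha>)" by (rule mult_left_mono[OF t\<alpha> B'])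
    also have "\<dots> \<le> 4 * B' * norm (\<zeta> - \<xi>) powr \<alpha>" using B' by (simp add: mult_right_mono)
    finally show ?thesis .
  qed
  define L where "L = 4 * B' + 4 * M"
  have "norm (G \<zeta> - G \<xi>) \<le> L * norm (\<zeta> - \<xi>) powr \<alpha>" if \<zeta>: "norm \<zeta> = 1" and \<xi>: "norm \<xi> = 1" for \<zeta> \<xi>
  proof (cases "norm (\<zeta> - \<xi>) < 1 / 2")
    case False
    have "norm (G \<zeta> - G \<xi>) \<le> 2 * M"
      using norm_triangle_ineq4[of "G \<zeta>" "G \<xi>"] M[of \<zeta>] M[of \<xi>] \<zeta> \<xi> by simp
    also have "\<dots> \<le> 4 * M * norm (\<zeta> - \<xi>) powr \<alpha>"
    proof -
      have "1 / 2 \<le> (1 / 2) powr \<alpha>" using powr_mono'[of \<alpha> 1 "1 / 2"] \<alpha> by simp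
      also have "\<dots> \<le> norm (\<zeta> - \<xi>) powr \<alpha>" using False \<alpha> by (intro powr_mono2) auto
      finally have "4 * M * (1 / 2) \<le> 4 * M * norm (\<zeta> - \<xi>) powr \<alpha>" using M0 by (intro mult_left_mono) auto
      then show ?thesis by simp
    qed
    also have "\<dots> \<le> L * norm (\<zeta> - \<xi>) powr \<alpha>" using B' by (intro mult_right_mono) (auto simp: L_def)
    finally show ?thesis .
  next
    case True
    define t where "t = Arg (\<zeta> / \<xi>)"
    have t: "\<zeta> / \<xi> = cis t" "- pi < t" "t \<le> pi"
    proof -
      have "\<zeta> / \<xi> \<noteq> 0" "norm (\<zeta> / \<xi>) = 1" using \<zeta> \<xi> by (auto simp: norm_divide)
      then show "\<zeta> / \<xi> = cis t" "- pi < t" "t \<le> pi"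
        using Arg_bounded[of "\<zeta> / \<xi>"] cis_Arg[of "\<zeta> / \<xi>"] unfolding t_def by (simp_all add: sgn_eq)
    qed
    have \<zeta>\<xi>: "\<zeta> = \<xi> * cis t" using t(1) \<xi> by (metis nonzero_mult_div_cancel_left norm_zero times_divide_eq_right zero_neq_one)
    have \<xi>\<zeta>: "\<xi> = \<zeta> * cis (- t)" unfolding \<zeta>\<xi> mult.assoc cis_mult by simp
    have small: "\<bar>t\<bar> < 1"
    proof (rule ccontr)
      assume "\<not> \<bar>t\<bar> < 1"
      then have "sin (1 / 2) \<le> sin (\<bar>t\<bar> / 2)"
        using t by (intro sin_monotone_2pi_le) auto
      moreover have "1 / 4 \<le> sin (1 / 2 :: real)" using sin_half_lower[of 1] by simp
      moreover have "norm (\<zeta> - \<xi>) = 2 * sin (\<bar>t\<bar> / 2)"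
      proof -
        have "\<zeta> - \<xi> = \<xi> * (cis (0 + t) - cis 0)" by (simp add: \<zeta>\<xi> right_diff_distrib)
        then have "norm (\<zeta> - \<xi>) = 2 * \<bar>sin (t / 2)\<bar>" using \<xi> by (simp only: norm_mult norm_cis_diff)
        moreover have "0 \<le> sin (\<bar>t\<bar> / 2)" using t by (intro sin_ge_zero) auto
        ultimately show ?thesis by (cases "0 \<le> t") auto
      qed
      ultimately show False using True by simp
    qed
    have L: "4 * B' * norm (\<zeta> - \<xi>) powr \<alpha> \<le> L * norm (\<zeta> - \<xi>) powr \<alpha>"
      using M0 by (intro mult_right_mono) (auto simp: L_def)
    consider "t = 0" | "0 < t" | "t < 0" by linarith
    then show ?thesis
    proof cases
      case 1
      then show ?thesis using \<zeta>\<xi> M0 B' by (simp add: L_def)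
    next
      case 2
      then show ?thesis using near[OF \<xi> \<zeta>\<xi>] small L by auto
    next
      case 3
      then show ?thesis using near[OF \<zeta> \<xi>\<zeta>] small L by (auto simp: norm_minus_commute)
    qed
  qed
  then show ?thesis using B' M0 by (intro exI[of _ L]) (auto simp: L_def)
qed

text \<open>
  Cauchy's formula for \<open>G'(z)\<close>, applied to \<open>G - G(\<zeta>0)\<close> with \<open>\<zeta>0\<close> the boundary point nearest to \<open>z\<close>,
  would lose a logarithm for \<open>\<alpha> = 1\<close>. The factor \<open>2 e - e\<^sup>2\<close> with
  \<open>e(\<zeta>) = (1 - |z|\<^sup>2) / (1 - cnj z \<zeta>)\<close> agrees with \<open>1\<close> to first order at \<open>z\<close>, so it does not change the
  derivative there, and it is of size \<open>(1 - |z|) / |\<zeta> - z|\<close> on the circle. The additional decay reduces the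
  integral to that of the Poisson kernel for all \<open>\<alpha> \<le> 1\<close>.
\<close>

lemma deriv_bound_of_boundary_holder:
  assumes G: "continuous_on (cball 0 1) G" and hol: "G holomorphic_on ball 0 1" and \<alpha>: "0 < \<alpha>" "\<alpha> \<le> 1"
    and L: "0 \<le> L" "\<And>\<zeta> \<xi>. norm \<zeta> = 1 \<Longrightarrow> norm \<xi> = 1 \<Longrightarrow> norm (G \<zeta> - G \<xi>) \<le> L * norm (\<zeta> - \<xi>) powr \<alpha>"
    and z: "norm z < 1"
  shows "norm (deriv G z) \<le> 16 * L * (1 - norm z) powr (\<alpha> - 1)"
proof -
  define r where "r = norm z"
  have r: "0 \<le> r" "r < 1" using z by (auto simp: r_def)
  have r2: "0 < 1 - r\<^sup>2" using r by (simp add: abs_square_less_1)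
  \<comment> \<open>The boundary point nearest to \<open>z\<close>; for \<open>z = 0\<close> every point of the circle qualifies.\<close>
  define \<zeta>0 where "\<zeta>0 = (if z = 0 then 1 else sgn z)"
  have \<zeta>0: "norm \<zeta>0 = 1" "norm (z - \<zeta>0) = 1 - r"
  proof -
    show "norm \<zeta>0 = 1" by (simp add: \<zeta>0_def norm_sgn)
    show "norm (z - \<zeta>0) = 1 - r"
    proof (cases "z = 0")
      case False
      then have "z = of_real r * \<zeta>0" by (simp add: r_def \<zeta>0_def sgn_eq)
      then have "z - \<zeta>0 = of_real (r - 1) * \<zeta>0" by (simp add: algebra_simps)
      then show ?thesis using \<open>norm \<zeta>0 = 1\<close> r by (simp add: norm_mult del: of_real_diff)
    qed (simp add: r_def \<zeta>0_def)
  qed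
  have nz: "1 - cnj z * \<zeta> \<noteq> 0" if "norm \<zeta> \<le> 1" for \<zeta>
  proof -
    have "norm (cnj z * \<zeta>) \<le> norm z * 1" using that by (simp add: norm_mult mult_left_le)
    then have "norm (cnj z * \<zeta>) < 1" using z by simp
    then show ?thesis by (metis eq_iff_diff_eq_0 less_irrefl norm_one)
  qed
  define e where "e \<zeta> = of_real (1 - r\<^sup>2) / (1 - cnj z * \<zeta>)" for \<zeta>
  define \<Phi> where "\<Phi> \<zeta> = (G \<zeta> - G \<zeta>0) * (2 * e \<zeta> - (e \<zeta>)\<^sup>2)" for \<zeta>
  have ez: "e z = 1"
  proof -
    have "of_real (r\<^sup>2) = z * cnj z" unfolding r_def by (rule complex_norm_square)
    then have "1 - cnj z * z = of_real (1 - r\<^sup>2)" by (simp only: of_real_diff of_real_1 mult.commute)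
    moreover have "complex_of_real (1 - r\<^sup>2) \<noteq> 0" using r2 by (simp only: of_real_eq_0_iff)
    ultimately show ?thesis unfolding e_def by simp
  qed
  have \<Phi>c: "continuous_on (cball 0 1) \<Phi>"
    unfolding \<Phi>_def e_def by (intro continuous_intros G) (use nz in auto)
  have \<Phi>h: "\<Phi> holomorphic_on ball 0 1"
    unfolding \<Phi>_def e_def by (intro holomorphic_intros hol) (use nz in auto)
  have d\<Phi>: "deriv \<Phi> z = deriv G z"
  proof (rule DERIV_imp_deriv)
    have dG: "(G has_field_derivative deriv G z) (at z)"
      using holomorphic_derivI[OF hol open_ball, of z] z by simp
    obtain D where De: "(e has_field_derivative D) (at z)"
    proof
      show "(e has_field_derivative of_real (1 - r\<^sup>2) * cnj z / (1 - cnj z * z)\<^sup>2) (at z)"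
        unfolding e_def using nz[of z] z
        by (auto intro!: derivative_eq_intros simp: power2_eq_square)
    qed
    show "(\<Phi> has_field_derivative deriv G z) (at z)"
      unfolding \<Phi>_def by (rule derivative_eq_intros dG De refl)+ (simp add: ez)
  qed
  have "((\<lambda>u. \<Phi> u / (u - z) ^ Suc 1) has_contour_integral ((2 * pi * \<i>) / (fact 1) * (deriv ^^ 1) \<Phi> z)) (circlepath 0 1)"
    by (rule Cauchy_has_contour_integral_higher_derivative_circlepath[OF \<Phi>c \<Phi>h]) (use z in simp)
  then have int: "((\<lambda>t. \<Phi> (cis t) / (cis t - z)\<^sup>2 * \<i> * cis t) has_integral (2 * pi * \<i> * deriv G z)) {0..2 * pi}"
    by (simp add: circlepath_def has_contour_integral_part_circlepath_iff d\<Phi> power2_eq_square)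
  have int2: "((\<lambda>t. 16 * L * (1 - r) powr \<alpha> * norm (1 - cnj z * cis t) powr (- 2)) has_integral
      16 * L * (1 - r) powr \<alpha> * (2 * pi / (1 - (norm (cnj z))\<^sup>2))) {0..2 * pi}"
    by (intro has_integral_mult_right poisson_mean) (use z in simp)
  have bound: "norm (\<Phi> (cis t) / (cis t - z)\<^sup>2 * \<i> * cis t) \<le> 16 * L * (1 - r) powr \<alpha> * norm (1 - cnj z * cis t) powr (- 2)" for t
  proof -
    define m where "m = norm (cis t - z)"
    have m1: "1 - r \<le> m" using norm_triangle_ineq2[of "cis t" z] by (simp add: m_def r_def)
    have m0: "0 < m" using m1 r by simp
    have meq: "norm (1 - cnj z * cis t) = m"
      using norm_blaschke[of z "cis t"] by (simp add: power2_eq_iff_nonneg m_def)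
    have dist: "norm (cis t - \<zeta>0) \<le> 2 * m"
      using norm_triangle_ineq[of "cis t - z" "z - \<zeta>0"] \<zeta>0(2) m1 by (simp add: m_def)
    have en: "norm (e (cis t)) = (1 - r\<^sup>2) / m" using r2 by (simp add: e_def norm_divide meq del: of_real_diff)
    have r2le: "1 - r\<^sup>2 \<le> 2 * (1 - r)"
      using zero_le_power2[of "1 - r"] by (simp add: power2_eq_square algebra_simps)
    have e2: "norm (e (cis t)) \<le> 2" unfolding en using m1 m0 r2le by (simp add: field_simps)
    have "norm (2 * e (cis t) - (e (cis t))\<^sup>2) = norm (e (cis t)) * norm (2 - e (cis t))"
      unfolding norm_mult[symmetric] by (simp add: power2_eq_square algebra_simps)
    also have "\<dots> \<le> (2 * (1 - r) / m) * 4"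
    proof (rule mult_mono)
      show "norm (e (cis t)) \<le> 2 * (1 - r) / m" unfolding en using r2le m0 by (simp add: divide_right_mono)
      show "norm (2 - e (cis t)) \<le> 4" using norm_triangle_ineq4[of 2 "e (cis t)"] e2 by simp
    qed (use m0 r in auto)
    finally have e3: "norm (2 * e (cis t) - (e (cis t))\<^sup>2) \<le> 8 * (1 - r) / m" by simp
    have "norm (G (cis t) - G \<zeta>0) \<le> L * norm (cis t - \<zeta>0) powr \<alpha>" by (rule L(2)) (simp_all add: \<zeta>0)
    also have "\<dots> \<le> L * (2 * m powr \<alpha>)"
    proof (rule mult_left_mono[OF _ L(1)])
      have "norm (cis t - \<zeta>0) powr \<alpha> \<le> (2 * m) powr \<alpha>" using dist \<alpha> by (intro powr_mono2) auto
      also have "\<dots> = 2 powr \<alpha> * m powr \<alpha>" by (simp add: powr_mult)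
      also have "\<dots> \<le> 2 * m powr \<alpha>" using \<alpha> powr_mono[of \<alpha> 1 2] by (intro mult_right_mono) auto
      finally show "norm (cis t - \<zeta>0) powr \<alpha> \<le> 2 * m powr \<alpha>" .
    qed
    finally have G3: "norm (G (cis t) - G \<zeta>0) \<le> L * (2 * m powr \<alpha>)" .
    have "norm (\<Phi> (cis t)) \<le> (L * (2 * m powr \<alpha>)) * (8 * (1 - r) / m)"
      unfolding \<Phi>_def norm_mult by (rule mult_mono[OF G3 e3]) (use L in auto)
    also have "\<dots> = 16 * L * (1 - r) * m powr (\<alpha> - 1)" using m0 by (simp add: powr_diff)
    also have "\<dots> \<le> 16 * L * (1 - r) * (1 - r) powr (\<alpha> - 1)"
      using L r \<alpha> m1 by (intro mult_left_mono powr_mono2') auto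
    also have "\<dots> = 16 * L * (1 - r) powr \<alpha>" using r by (simp add: powr_diff)
    finally have "norm (\<Phi> (cis t)) / m\<^sup>2 \<le> 16 * L * (1 - r) powr \<alpha> / m\<^sup>2" by (intro divide_right_mono) auto
    moreover have "m powr (- 2) = 1 / m\<^sup>2" using m0 by (simp add: powr_minus_divide powr_numeral)
    ultimately show ?thesis by (simp add: norm_mult norm_divide norm_power meq m_def[symmetric])
  qed
  have "norm (2 * pi * \<i> * deriv G z) \<le> 16 * L * (1 - r) powr \<alpha> * (2 * pi / (1 - (norm (cnj z))\<^sup>2))"
    using integral_norm_bound_integral[OF has_integral_integrable[OF int] has_integral_integrable[OF int2] bound]
    unfolding integral_unique[OF int] integral_unique[OF int2] .
  then have "2 * pi * norm (deriv G z) \<le> 2 * pi * (16 * L * ((1 - r) powr \<alpha> / (1 - r\<^sup>2)))"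
    by (simp add: norm_mult r_def[symmetric] mult_ac)
  then have "norm (deriv G z) \<le> 16 * L * ((1 - r) powr \<alpha> / (1 - r\<^sup>2))"
    by (rule mult_left_le_imp_le) simp
  also have "\<dots> \<le> 16 * L * ((1 - r) powr \<alpha> / (1 - r))"
  proof -
    have "r * r \<le> r" using r by (simp add: mult_left_le)
    then have "1 - r \<le> 1 - r\<^sup>2" by (simp add: power2_eq_square)
    then show ?thesis using L r r2 by (intro mult_left_mono divide_left_mono mult_pos_pos) auto
  qed
  also have "(1 - r) powr \<alpha> / (1 - r) = (1 - r) powr (\<alpha> - 1)" using r by (simp add: powr_diff)
  finally show ?thesis by (simp add: r_def)
qed

lemma deriv_bound_of_lipschitz_space:
  assumes g: "g \<in> lipschitz_space \<alpha>" and \<alpha>: "0 < \<alpha>" "\<alpha> \<le> 1"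
  shows "\<exists>K\<ge>0. \<forall>z. norm z < 1 \<longrightarrow> norm (deriv g z) \<le> K * (1 - norm z) powr (\<alpha> - 1)"
proof -
  obtain G where hol: "g holomorphic_on ball 0 1" and G: "continuous_on (cball 0 1) G" "\<And>z. z \<in> ball 0 1 \<Longrightarrow> G z = g z"
    and bdd: "bdd_above {norm (G (cis (\<theta> + t)) - G (cis \<theta>)) / t powr \<alpha> |\<theta> t. \<theta> \<in> {0..2 * pi} \<and> t \<in> {0<..<1}}"
    using g by (auto simp: lipschitz_space_def)
  obtain B where B: "\<And>y. y \<in> {norm (G (cis (\<theta> + t)) - G (cis \<theta>)) / t powr \<alpha> |\<theta> t. \<theta> \<in> {0..2 * pi} \<and> t \<in> {0<..<1}} \<Longrightarrow> y \<le> B"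
    using bdd unfolding bdd_above_def by blast
  have B': "norm (G (cis (\<theta> + t)) - G (cis \<theta>)) \<le> B * t powr \<alpha>" if "\<theta> \<in> {0..2 * pi}" "0 < t" "t < 1" for \<theta> t
  proof -
    have "norm (G (cis (\<theta> + t)) - G (cis \<theta>)) / t powr \<alpha> \<le> B"
    proof (rule B)
      have "\<theta> \<in> {0..2 * pi} \<and> t \<in> {0<..<1}" using that by simp
      then show "norm (G (cis (\<theta> + t)) - G (cis \<theta>)) / t powr \<alpha> \<in>
          {norm (G (cis (\<theta> + t)) - G (cis \<theta>)) / t powr \<alpha> |\<theta> t. \<theta> \<in> {0..2 * pi} \<and> t \<in> {0<..<1}}" by blast
    qed
    then show ?thesis using that by (simp add: field_simps)
  qed
  obtain L where L: "0 \<le> L" "\<And>\<zeta> \<xi>. norm \<zeta> = 1 \<Longrightarrow> norm \<xi> = 1 \<Longrightarrow> norm (G \<zeta> - G \<xi>) \<le> L * norm (\<zeta> - \<xi>) powr \<alpha>"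
    using boundary_holder[OF G(1) \<alpha> B'] by blast
  have Gh: "G holomorphic_on ball 0 1" using hol by (rule holomorphic_transform) (simp add: G(2))
  have "norm (deriv g z) \<le> 16 * L * (1 - norm z) powr (\<alpha> - 1)" if z: "norm z < 1" for z
  proof -
    have "\<forall>\<^sub>F w in nhds z. g w = G w"
      using eventually_nhds_in_open[of "ball 0 1" z] z by (auto simp: G(2) elim!: eventually_mono)
    then have eq: "deriv g z = deriv G z" by (rule deriv_cong_ev) (rule refl)
    show ?thesis unfolding eq by (rule deriv_bound_of_boundary_holder[OF G(1) Gh \<alpha> L z])
  qed
  then show ?thesis using L(1) by (intro exI[of _ "16 * L"]) auto
qed

section \<open>Bounded operators\<close>

text \<open>
  The case \<open>k = f\<close>, \<open>P = p\<close> of the mean bound. That bound needs a positive \<open>N\<close>, so it is used for all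
  \<open>N\<close> above the norm, which may vanish.
\<close>

lemma dirichlet_to_hardy_bounded:
  assumes pq: "0 < p" "p < q" and g: "g holomorphic_on ball 0 1" and K: "0 < K"
    and g': "\<And>z. norm z < 1 \<Longrightarrow> norm (deriv g z) \<le> K * (1 - norm z) powr (1 / p - 1 / q - 1)"
  shows "bounded_operator (dirichlet_space p) (dirichlet_norm p) (hardy_space q) (hardy_norm q) (T_op g)"
proof -
  have q: "0 < q" using pq by simp
  have "T_op g f \<in> hardy_space q \<and> hardy_norm q (T_op g f) \<le> core_constant p q p * K * dirichlet_norm p f"
    if f: "f \<in> dirichlet_space p" for f
  proof -
    have hol: "f holomorphic_on ball 0 1" and int: "set_integrable lborel (ball 0 1) (dirichlet_density p f)"
      using f by (auto simp: dirichlet_space_def)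
    define I where "I = (LINT z:ball 0 1|lborel. dirichlet_density p f z)"
    have I0: "0 \<le> I"
      unfolding I_def set_lebesgue_integral_def by (intro integral_nonneg_AE) (simp add: dirichlet_density_nonneg)
    define N0 where "N0 = dirichlet_norm p f"
    have N0: "N0 powr p = 1 / pi * I + norm (f 0) powr p" "0 \<le> N0"
      using pq I0 by (simp_all add: N0_def dirichlet_norm_def I_def powr_powr)
    have nn: "dirichlet_energy p f (ball 0 1) = ennreal I"
    proof -
      have "dirichlet_energy p f (ball 0 1) =
          (\<integral>\<^sup>+z. ennreal (indicator (ball 0 1) z *\<^sub>R dirichlet_density p f z) \<partial>lborel)"
        by (intro nn_integral_cong) (simp split: split_indicator)
      also have "\<dots> = ennreal I"
        unfolding I_def set_lebesgue_integral_def
        by (rule nn_integral_eq_integral) (use int in \<open>auto simp: set_integrable_def dirichlet_density_nonneg\<close>)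
      finally show ?thesis .
    qed
    have f0: "norm (f 0) \<le> N0"
    proof (rule ccontr)
      assume "\<not> norm (f 0) \<le> N0"
      then have "N0 powr p < norm (f 0) powr p" using N0(2) pq by (intro powr_less_mono2) auto
      moreover have "0 \<le> I / pi" using I0 by simp
      ultimately show False using N0(1) by simp
    qed
    have mean: "hardy_mean q (T_op g f) r \<le> core_constant p q p * K * N0" if r: "0 < r" "r < 1" for r
    proof (rule tendsto_lowerbound)
      show "((\<lambda>N. core_constant p q p * K * N) \<longlongrightarrow> core_constant p q p * K * N0) (at_right N0)"
        by (intro tendsto_intros)
      have "\<forall>\<^sub>F N in at_right N0. N \<in> {N0<..<N0 + 1}" by (rule eventually_at_right_real) simp
      then show "\<forall>\<^sub>F N in at_right N0. hardy_mean q (T_op g f) r \<le> core_constant p q p * K * N"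
      proof eventually_elim
        case (elim N)
        have "N0 powr p \<le> N powr p" using elim N0(2) pq by (intro powr_mono2) auto
        then have "I \<le> pi * N powr p" using N0(1) by (simp add: field_simps) (smt (verit) powr_ge_zero pi_gt_zero mult_nonneg_nonneg)
        then have "hardy_mean q (T_op g f) r \<le> core_constant p q p * K * N powr (p / p)"
          using pq K elim N0 hol g g' f0 r
          by (intro T_op_mean_bound[where k = f]) (auto simp: nn intro!: ennreal_leI)
        then show ?case using pq elim N0 by simp
      qed
    qed simp
    show ?thesis
      using hardy_spaceI[OF T_op_holomorphic[OF hol g] q mean] by (simp add: N0_def)
  qed
  then show ?thesis unfolding bounded_operator_def by blast
qed

lemma eq_at_0_of_zero_deriv:
  fixes D :: "complex \<Rightarrow> complex"
  assumes "\<And>w. w \<in> ball 0 1 \<Longrightarrow> (D has_field_derivative 0) (at w)" and "z \<in> ball 0 1"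
  shows "D z = D 0"
proof -
  have "\<exists>c. \<forall>w\<in>ball 0 1. D w = c"
    by (rule has_field_derivative_zero_constant) (simp, rule has_field_derivative_at_within, rule assms(1))
  then show ?thesis using assms(2) by auto
qed

lemma T_op_dilation:
  assumes f: "f holomorphic_on ball 0 1" and g: "g holomorphic_on ball 0 1" and R: "0 < R" "R < 1" and z: "norm z < 1"
  shows "T_op (\<lambda>w. g (of_real R * w)) (\<lambda>w. f (of_real R * w)) z = T_op g f (of_real R * z)"
proof -
  have inb: "of_real R * w \<in> ball 0 1" if "w \<in> ball 0 1" for w :: complex
    using that R mult_left_le_one_le[of "norm w" R] by (simp add: norm_mult)
  have hf: "(\<lambda>w. f (of_real R * w)) holomorphic_on ball 0 1"
    by (intro holomorphic_on_compose_gen[OF _ f, unfolded o_def] holomorphic_intros) (use inb in auto)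
  have hg: "(\<lambda>w. g (of_real R * w)) holomorphic_on ball 0 1"
    by (intro holomorphic_on_compose_gen[OF _ g, unfolded o_def] holomorphic_intros) (use inb in auto)
  have dg: "deriv (\<lambda>w. g (of_real R * w)) w = of_real R * deriv g (of_real R * w)" if "w \<in> ball 0 1" for w
  proof (rule DERIV_imp_deriv)
    have "(g has_field_derivative deriv g (of_real R * w)) (at (of_real R * w))"
      using holomorphic_derivI[OF g open_ball inb[OF that]] by simp
    then have "((\<lambda>w. g (of_real R * w)) has_field_derivative deriv g (of_real R * w) * of_real R) (at w)"
      by (rule DERIV_chain2) (auto intro!: derivative_eq_intros)
    then show "((\<lambda>w. g (of_real R * w)) has_field_derivative of_real R * deriv g (of_real R * w)) (at w)"
      by (simp only: mult.commute)
  qed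
  define D where "D w = T_op (\<lambda>w. g (of_real R * w)) (\<lambda>w. f (of_real R * w)) w - T_op g f (of_real R * w)" for w
  have "D z = D 0"
  proof (rule eq_at_0_of_zero_deriv)
    fix w :: complex assume w: "w \<in> ball 0 1"
    have 1: "((\<lambda>w. T_op (\<lambda>w. g (of_real R * w)) (\<lambda>w. f (of_real R * w)) w) has_field_derivative
        f (of_real R * w) * (of_real R * deriv g (of_real R * w))) (at w)"
      using T_op_has_derivative[OF hf hg w] dg[OF w] by simp
    have 2: "((\<lambda>w. T_op g f (of_real R * w)) has_field_derivative
        f (of_real R * w) * deriv g (of_real R * w) * of_real R) (at w)"
      using T_op_has_derivative[OF f g inb[OF w]]
      by (rule DERIV_chain2) (auto intro!: derivative_eq_intros)
    show "(D has_field_derivative 0) (at w)"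
      using DERIV_diff[OF 1 2] by (simp add: D_def[abs_def] mult_ac)
  qed (use z in auto)
  then show ?thesis by (simp add: D_def T_op_0)
qed

text \<open>
  The case \<open>P = 2\<close> of the mean bound, for the dilations of \<open>f\<close> and \<open>g\<close> by a radius \<open>R\<close> that admits a
  majorant \<open>k\<close>. The dilated \<open>g\<close> inherits the growth condition because the exponent \<open>\<alpha> - 1\<close> is not
  positive.
\<close>

lemma hardy_to_hardy_bounded:
  assumes pq: "0 < p" "p < q" and \<alpha>: "1 / p - 1 / q \<le> 1" and g: "g holomorphic_on ball 0 1" and K: "0 < K"
    and g': "\<And>z. norm z < 1 \<Longrightarrow> norm (deriv g z) \<le> K * (1 - norm z) powr (1 / p - 1 / q - 1)"
  shows "bounded_operator (hardy_space p) (hardy_norm p) (hardy_space q) (hardy_norm q) (T_op g)"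
proof -
  have q: "0 < q" using pq by simp
  have "T_op g f \<in> hardy_space q \<and> hardy_norm q (T_op g f) \<le> core_constant p q 2 * K * 2 powr (1 / p) * hardy_norm p f"
    if f: "f \<in> hardy_space p" for f
  proof -
    have hol: "f holomorphic_on ball 0 1" using f by (simp add: hardy_space_def)
    define N0 where "N0 = hardy_norm p f"
    have N00: "0 \<le> N0" unfolding N0_def by (rule hardy_norm_nonneg[OF f pq(1)])
    have main: "hardy_mean q (T_op g f) r \<le> core_constant p q 2 * K * 2 powr (1 / p) * N"
      if r: "0 < r" "r < 1" and N: "N0 < N" for r N
    proof -
      have N0: "0 < N" using N N00 by simp
      obtain R k \<rho> where R: "r < R" "R < 1" and \<rho>: "1 < \<rho>" and k: "k holomorphic_on ball 0 \<rho>"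
        and le: "\<And>z. z \<in> cball 0 1 \<Longrightarrow> norm (f (of_real R * z)) powr p \<le> (norm (k z))\<^sup>2"
        and eq: "\<And>z. z \<in> sphere 0 1 \<Longrightarrow> norm (f (of_real R * z)) powr p = (norm (k z))\<^sup>2"
        using eventually_happens[OF eventually_power_majorant[OF hol pq(1) less_imp_le[OF r(1)] r(2)]]
        by (auto simp: trivial_limit_at_right_real)
      have R0: "0 < R" using r R by simp
      have inb: "of_real R * w \<in> ball 0 1" if "w \<in> ball 0 1" for w :: complex
        using that R R0 mult_left_le_one_le[of "norm w" R] by (simp add: norm_mult)
      let ?f = "\<lambda>w. f (of_real R * w)" and ?g = "\<lambda>w. g (of_real R * w)"
      have hf: "?f holomorphic_on ball 0 1"
        by (intro holomorphic_on_compose_gen[OF _ hol, unfolded o_def] holomorphic_intros) (use inb in auto)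
      have hg: "?g holomorphic_on ball 0 1"
        by (intro holomorphic_on_compose_gen[OF _ g, unfolded o_def] holomorphic_intros) (use inb in auto)
      have k1: "k holomorphic_on ball 0 1" using k by (rule holomorphic_on_subset) (use \<rho> in auto)
      have fk: "norm (f (of_real R * z)) \<le> norm (k z) powr (2 / p)" if "norm z < 1" for z
      proof -
        have "(norm (f (of_real R * z)) powr p) powr (1 / p) \<le> ((norm (k z))\<^sup>2) powr (1 / p)"
          using le[of z] that pq by (intro powr_mono2) auto
        also have "((norm (k z))\<^sup>2) powr (1 / p) = norm (k z) powr (2 / p)"
        proof (cases "k z = 0")
          case False
          then have "(norm (k z))\<^sup>2 = norm (k z) powr 2" by (simp add: powr_numeral)
          then show ?thesis by (simp only: powr_powr) simp
        qed (use pq in simp)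
        finally show ?thesis using pq by (simp add: powr_powr)
      qed
      have gb: "norm (deriv ?g z) \<le> K * (1 - norm z) powr (1 / p - 1 / q - 1)" if z: "norm z < 1" for z
      proof -
        have "(g has_field_derivative deriv g (of_real R * z)) (at (of_real R * z))"
          using holomorphic_derivI[OF g open_ball inb[of z]] z by simp
        then have "(?g has_field_derivative deriv g (of_real R * z) * of_real R) (at z)"
          by (rule DERIV_chain2) (auto intro!: derivative_eq_intros)
        then have "deriv ?g z = deriv g (of_real R * z) * of_real R" by (rule DERIV_imp_deriv)
        then have "norm (deriv ?g z) \<le> norm (deriv g (of_real R * z))"
          using R R0 by (simp add: norm_mult mult_left_le)
        also have "\<dots> \<le> K * (1 - norm (of_real R * z)) powr (1 / p - 1 / q - 1)"
          using g'[of "of_real R * z"] inb[of z] z by simp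
        also have "\<dots> \<le> K * (1 - norm z) powr (1 / p - 1 / q - 1)"
          using K \<alpha> z R R0 by (intro mult_left_mono powr_mono2') (auto simp: norm_mult mult_left_le_one_le)
        finally show ?thesis .
      qed
      have kint: "1 / (2 * pi) * integral {0..2 * pi} (\<lambda>\<theta>. (norm (k (cis \<theta>)))\<^sup>2) \<le> N powr p"
      proof -
        have "1 / (2 * pi) * integral {0..2 * pi} (\<lambda>\<theta>. (norm (k (cis \<theta>)))\<^sup>2) = circle_mean p f R"
          using eq by (simp add: circle_mean_def)
        also have "\<dots> \<le> N0 powr p" unfolding N0_def by (rule circle_mean_le_norm[OF f pq(1)]) (use R R0 in auto)
        also have "\<dots> \<le> N powr p" using N N00 pq by (intro powr_mono2) auto
        finally show ?thesis .
      qed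
      \<comment> \<open>A bound both for \<open>k(0)\<close> and for the square root of the Dirichlet integral of \<open>k\<close> over \<open>\<pi>\<close>.\<close>
      define M where "M = (2 * N powr p) powr (1 / 2)"
      have M: "0 < M" "M powr 2 = 2 * N powr p" using N0 by (simp_all add: M_def powr_powr)
      have M2: "M powr (2 / p) = 2 powr (1 / p) * N"
      proof -
        have "M powr (2 / p) = (M powr 2) powr (1 / p)" by (simp add: powr_powr)
        also have "\<dots> = 2 powr (1 / p) * N" unfolding M(2) powr_mult powr_powr using pq N0 by simp
        finally show ?thesis .
      qed
      have dens: "ennreal (dirichlet_density 2 k w) * indicator (ball 0 1) w =
          ennreal ((norm (deriv k w))\<^sup>2 * (1 - (norm w)\<^sup>2)) * indicator (ball 0 1) w" for w
      proof (cases "w \<in> ball 0 1")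
        case True
        then have "0 < 1 - (norm w)\<^sup>2" by (simp add: abs_square_less_1)
        moreover have "norm (deriv k w) powr 2 = (norm (deriv k w))\<^sup>2"
          by (cases "deriv k w = 0") (simp_all add: powr_numeral)
        ultimately show ?thesis by (simp add: dirichlet_density_def)
      qed simp
      have I: "dirichlet_energy 2 k (ball 0 1) \<le> ennreal (pi * M powr 2)"
      proof -
        have "dirichlet_energy 2 k (ball 0 1) \<le>
            ennreal (1 / 2 * integral {0..2 * pi} (\<lambda>\<theta>. (norm (k (cis \<theta>)))\<^sup>2))"
          unfolding dens by (rule dirichlet_integral_le_hardy[OF \<rho> k])
        also have "\<dots> \<le> ennreal (pi * M powr 2)"
        proof (rule ennreal_leI)
          have "1 / 2 * integral {0..2 * pi} (\<lambda>\<theta>. (norm (k (cis \<theta>)))\<^sup>2) =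
             pi * (1 / (2 * pi) * integral {0..2 * pi} (\<lambda>\<theta>. (norm (k (cis \<theta>)))\<^sup>2))" by simp
          also have "\<dots> \<le> pi * N powr p" by (rule mult_left_mono[OF kint]) simp
          also have "\<dots> \<le> pi * M powr 2" unfolding M(2) by simp
          finally show "1 / 2 * integral {0..2 * pi} (\<lambda>\<theta>. (norm (k (cis \<theta>)))\<^sup>2) \<le> pi * M powr 2" .
        qed
        finally show ?thesis .
      qed
      have k0: "norm (k 0) \<le> M"
      proof -
        have "2 * pi * norm (k 0) powr 2 \<le> integral {0..2 * pi} (\<lambda>\<theta>. norm (k (0 + 1 * cis \<theta>)) powr 2)"
          by (rule submean_circle[OF k]) (use \<rho> in auto)
        also have "\<dots> = integral {0..2 * pi} (\<lambda>\<theta>. (norm (k (cis \<theta>)))\<^sup>2)"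
          by (intro integral_cong) (metis add_0 mult_1 norm_ge_zero powr_numeral power2_eq_square powr_0 order_le_less zero_less_norm_iff mult_zero_left norm_zero)
        also have "\<dots> \<le> 2 * pi * N powr p" using kint by (simp add: field_simps)
        finally have "norm (k 0) powr 2 \<le> N powr p" by (rule mult_left_le_imp_le) simp
        then have "norm (k 0) powr 2 \<le> M powr 2" unfolding M(2) using powr_ge_zero[of N p] by linarith
        then show ?thesis using M(1) by (smt (verit) powr_less_mono2 norm_ge_zero)
      qed
      have rR: "0 \<le> r / R" "r / R < 1" using r R R0 by auto
      have "hardy_mean q (T_op ?g ?f) (r / R) \<le> core_constant p q 2 * K * M powr (2 / p)"
        by (rule T_op_mean_bound[OF pq _ K M(1) hf hg k1 fk gb k0 I rR]) simp_all
      moreover have "hardy_mean q (T_op ?g ?f) (r / R) = hardy_mean q (T_op g f) r"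
      proof -
        have "T_op ?g ?f (of_real (r / R) * cis \<theta>) = T_op g f (of_real r * cis \<theta>)" for \<theta>
        proof -
          have "norm (of_real (r / R) * cis \<theta>) < 1" using rR by (simp only: norm_mult norm_of_real norm_cis)
          then have "T_op ?g ?f (of_real (r / R) * cis \<theta>) = T_op g f (of_real R * (of_real (r / R) * cis \<theta>))"
            by (rule T_op_dilation[OF hol g R0 R(2)])
          also have "complex_of_real R * (of_real (r / R) * cis \<theta>) = of_real r * cis \<theta>" using R0 by simp
          finally show ?thesis .
        qed
        then show ?thesis by (simp add: hardy_mean_def)
      qed
      ultimately show ?thesis by (simp add: M2 mult.assoc)
    qed
    have mean: "hardy_mean q (T_op g f) r \<le> core_constant p q 2 * K * 2 powr (1 / p) * N0" if r: "0 < r" "r < 1" for r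
    proof (rule tendsto_lowerbound)
      show "((\<lambda>N. core_constant p q 2 * K * 2 powr (1 / p) * N) \<longlongrightarrow> core_constant p q 2 * K * 2 powr (1 / p) * N0) (at_right N0)"
        by (intro tendsto_intros)
      have "\<forall>\<^sub>F N in at_right N0. N \<in> {N0<..<N0 + 1}" by (rule eventually_at_right_real) simp
      then show "\<forall>\<^sub>F N in at_right N0. hardy_mean q (T_op g f) r \<le> core_constant p q 2 * K * 2 powr (1 / p) * N"
        by eventually_elim (use main[OF r] in auto)
    qed simp
    show ?thesis
      using hardy_spaceI[OF T_op_holomorphic[OF hol g] q mean] by (simp add: N0_def)
  qed
  then show ?thesis unfolding bounded_operator_def by blast
qed

text \<open>
  At the point \<open>a\<close>, the derivative of the image of the test function with parameter \<open>a\<close> is that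
  function times \<open>g'\<close>. The test function has modulus \<open>(1 - |a|\<^sup>2)^(-m)\<close> there, and the exponents \<open>m\<close> cancel.
\<close>

lemma deriv_bound_of_bounded:
  fixes X :: "(complex \<Rightarrow> complex) set" and normX :: "(complex \<Rightarrow> complex) \<Rightarrow> real"
  assumes q: "0 < q" and g: "g holomorphic_on ball 0 1"
    and bdd: "bounded_operator X normX (hardy_space q) (hardy_norm q) (T_op g)"
    and test: "\<And>a. norm a < 1 \<Longrightarrow> kernel_power m a \<in> X \<and> 0 \<le> normX (kernel_power m a) \<and>
      normX (kernel_power m a) \<le> C0 * (1 - norm a) powr (1 / p - real m)"
  shows "\<exists>K>0. \<forall>z. norm z < 1 \<longrightarrow> norm (deriv g z) \<le> K * (1 - norm z) powr (1 / p - 1 / q - 1)"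
proof -
  obtain C where C: "\<And>f. f \<in> X \<Longrightarrow> T_op g f \<in> hardy_space q \<and> hardy_norm q (T_op g f) \<le> C * normX f"
    using bdd by (auto simp: bounded_operator_def)
  define K where "K = \<bar>C\<bar> * \<bar>C0\<bar> * 2 powr (1 + 1 / q) * 2 ^ m + 1"
  have "norm (deriv g a) \<le> K * (1 - norm a) powr (1 / p - 1 / q - 1)" if a: "norm a < 1" for a
  proof -
    let ?f = "kernel_power m a"
    define d where "d = 1 - norm a"
    have d: "0 < d" using a by (simp add: d_def)
    have hf: "?f holomorphic_on ball 0 1" by (rule kernel_power_holomorphic[OF a])
    have F: "T_op g ?f \<in> hardy_space q" "hardy_norm q (T_op g ?f) \<le> C * normX ?f"
      using C test[OF a] by auto
    have "hardy_norm q (T_op g ?f) \<le> \<bar>C\<bar> * normX ?f"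
      using F(2) test[OF a] mult_right_mono[of C "\<bar>C\<bar>" "normX ?f"] by linarith
    also have "\<dots> \<le> \<bar>C\<bar> * (\<bar>C0\<bar> * d powr (1 / p - real m))"
    proof (rule mult_left_mono)
      have "normX ?f \<le> C0 * d powr (1 / p - real m)" using test[OF a] by (simp add: d_def)
      also have "\<dots> \<le> \<bar>C0\<bar> * d powr (1 / p - real m)" by (rule mult_right_mono) auto
      finally show "normX ?f \<le> \<bar>C0\<bar> * d powr (1 / p - real m)" .
    qed simp
    finally have norm: "hardy_norm q (T_op g ?f) \<le> \<bar>C\<bar> * \<bar>C0\<bar> * d powr (1 / p - real m)" by (simp add: mult.assoc)
    have "deriv (T_op g ?f) a = ?f a * deriv g a"
      by (rule DERIV_imp_deriv[OF T_op_has_derivative[OF hf g]]) (use a in simp)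
    then have "norm (?f a) * norm (deriv g a) \<le> hardy_norm q (T_op g ?f) * (d / 2) powr (- (1 + 1 / q))"
      using hardy_deriv_growth[OF F(1) q a] by (simp add: norm_mult d_def)
    also have "\<dots> \<le> (\<bar>C\<bar> * \<bar>C0\<bar> * d powr (1 / p - real m)) * (d / 2) powr (- (1 + 1 / q))"
      by (rule mult_right_mono[OF norm]) simp
    finally have 1: "norm (?f a) * norm (deriv g a) \<le> (\<bar>C\<bar> * \<bar>C0\<bar> * d powr (1 / p - real m)) * (d / 2) powr (- (1 + 1 / q))" .
    have fa: "(2 * d) powr (- real m) \<le> norm (?f a)"
    proof -
      have "1 - cnj a * a = of_real (1 - (norm a)\<^sup>2)"
        using complex_norm_square[of a] by (simp add: mult.commute)
      then have e: "norm (1 - cnj a * a) = 1 - (norm a)\<^sup>2"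
        using a by (simp only: norm_of_real) (simp add: abs_square_le_1 power_le_one)
      have "0 < 1 - (norm a)\<^sup>2" using a by (simp add: abs_square_less_1)
      moreover have "1 - (norm a)\<^sup>2 \<le> 2 * d"
        using zero_le_power2[of "1 - norm a"] by (simp add: d_def power2_eq_square algebra_simps)
      ultimately show ?thesis unfolding norm_kernel_power[OF a a] e by (intro powr_mono2') auto
    qed
    have "(2 * d) powr (- real m) * norm (deriv g a) \<le> norm (?f a) * norm (deriv g a)"
      by (rule mult_right_mono[OF fa]) simp
    with 1 have "(2 * d) powr (- real m) * norm (deriv g a) \<le> (\<bar>C\<bar> * \<bar>C0\<bar> * d powr (1 / p - real m)) * (d / 2) powr (- (1 + 1 / q))"
      by (rule order_trans[rotated])
    then have "(2 * d) powr real m * ((2 * d) powr (- real m) * norm (deriv g a)) \<le>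
        (2 * d) powr real m * ((\<bar>C\<bar> * \<bar>C0\<bar> * d powr (1 / p - real m)) * (d / 2) powr (- (1 + 1 / q)))"
      by (rule mult_left_mono) simp
    moreover have "(2 * d) powr real m * ((2 * d) powr (- real m) * norm (deriv g a)) = norm (deriv g a)"
      using d by (simp add: mult.assoc[symmetric] powr_add[symmetric])
    moreover have "(2 * d) powr real m * ((\<bar>C\<bar> * \<bar>C0\<bar> * d powr (1 / p - real m)) * (d / 2) powr (- (1 + 1 / q)))
        = \<bar>C\<bar> * \<bar>C0\<bar> * 2 powr (1 + 1 / q) * 2 ^ m * d powr (1 / p - 1 / q - 1)"
    proof -
      have "(d / 2) powr (- s) = d powr (- s) * 2 powr s" for s
        using d powr_minus_divide[of 2 "- s"] by (simp add: powr_divide)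
      then have e1: "(d / 2) powr (- (1 + 1 / q)) = d powr (- (1 + 1 / q)) * 2 powr (1 + 1 / q)" .
      have e2: "(2 * d) powr real m = 2 ^ m * d powr real m" using d by (simp add: powr_mult powr_realpow)
      have "real m + (1 / p - real m) + (- (1 + 1 / q)) = 1 / p - 1 / q - 1" by simp
      then have e3: "d powr real m * d powr (1 / p - real m) * d powr (- (1 + 1 / q)) = d powr (1 / p - 1 / q - 1)"
        by (simp only: powr_add[symmetric])
      show ?thesis unfolding e1 e2 e3[symmetric] by (simp only: mult_ac)
    qed
    ultimately have "norm (deriv g a) \<le> \<bar>C\<bar> * \<bar>C0\<bar> * 2 powr (1 + 1 / q) * 2 ^ m * d powr (1 / p - 1 / q - 1)"
      by (simp only:)
    also have "\<dots> \<le> K * d powr (1 / p - 1 / q - 1)" by (intro mult_right_mono) (auto simp: K_def)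
    finally show ?thesis by (simp add: d_def)
  qed
  moreover have "0 < K" unfolding K_def by (intro add_nonneg_pos mult_nonneg_nonneg) auto
  ultimately show ?thesis by blast
qed

text \<open>
  On the circle of radius \<open>r\<close> the derivative is at most \<open>K (1 - r)^e\<close>, which tends to \<open>0\<close> as \<open>r\<close> tends to
  \<open>1\<close>; by the maximum principle so does its value at every fixed point.
\<close>

lemma constant_of_deriv_decay:
  assumes g: "g holomorphic_on ball 0 1" and e: "0 < e" and K: "0 < K"
    and bound: "\<And>z. norm z < 1 \<Longrightarrow> norm (deriv g z) \<le> K * (1 - norm z) powr e"
  shows "g constant_on ball 0 1"
proof -
  have hd: "deriv g holomorphic_on ball 0 1" by (rule holomorphic_deriv[OF g open_ball])
  have zero: "deriv g z = 0" if z: "norm z < 1" for z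
  proof -
    have "norm (deriv g z) \<le> 0"
    proof (rule tendsto_lowerbound)
      have "((\<lambda>r. K * (1 - r) powr e) \<longlongrightarrow> K * (1 - 1) powr e) (at_left 1)"
        using e by (intro tendsto_mult tendsto_const tendsto_powr' tendsto_diff tendsto_ident_at)
          (auto simp: eventually_at_filter intro!: always_eventually eventually_mono[OF eventually_at_left_real[of 0 1]])
      then show "((\<lambda>r. K * (1 - r) powr e) \<longlongrightarrow> 0) (at_left 1)" using e by simp
      have "\<forall>\<^sub>F r in at_left 1. r \<in> {norm z<..<1}" using z by (rule eventually_at_left_real)
      then show "\<forall>\<^sub>F r in at_left 1. norm (deriv g z) \<le> K * (1 - r) powr e"
      proof eventually_elim
        case (elim r)
        have r: "0 < r" "r < 1" using elim le_less_trans[OF norm_ge_zero, of z r] by auto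
        show ?case
        proof (rule maximum_modulus_frontier[of "deriv g" "ball 0 r"])
          show "deriv g holomorphic_on interior (ball 0 r)"
            using hd by (rule holomorphic_on_subset) (use r in auto)
          show "continuous_on (closure (ball 0 r)) (deriv g)"
            using holomorphic_on_imp_continuous_on[OF hd] by (rule continuous_on_subset) (use r in auto)
          show "norm (deriv g w) \<le> K * (1 - r) powr e" if "w \<in> frontier (ball 0 r)" for w
            using that bound[of w] r by simp
        qed (use elim in auto)
      qed
    qed simp
    then show ?thesis by simp
  qed
  have "(g has_field_derivative 0) (at z within ball 0 1)" if "z \<in> ball 0 1" for z
    using holomorphic_derivI[OF g open_ball that] zero[of z] that by (simp add: has_field_derivative_at_within)
  then show ?thesis unfolding constant_on_def
    by (metis convex_ball has_field_derivative_zero_constant)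
qed

lemma constant_imp_bounded:
  assumes "g constant_on ball 0 1" and q: "0 < q" and nonneg: "\<And>f. f \<in> X \<Longrightarrow> 0 \<le> normX f"
    and hol: "\<And>f. f \<in> X \<Longrightarrow> f holomorphic_on ball 0 1"
  shows "bounded_operator X normX (hardy_space q) (hardy_norm q) (T_op g)"
proof -
  obtain c where c: "\<And>z. z \<in> ball 0 1 \<Longrightarrow> g z = c" using assms(1) by (auto simp: constant_on_def)
  have g: "g holomorphic_on ball 0 1"
    by (rule holomorphic_transform[of "\<lambda>_. c"]) (use c in auto)
  have "T_op g f \<in> hardy_space q \<and> hardy_norm q (T_op g f) \<le> 1 * normX f" if f: "f \<in> X" for f
  proof -
    have "deriv g z = 0" if "z \<in> ball 0 1" for z
    proof -
      have "\<forall>\<^sub>F w in nhds z. g w = c"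
        using eventually_nhds_in_open[of "ball 0 1" z] that by (auto simp: c elim!: eventually_mono)
      then have "deriv g z = deriv (\<lambda>_. c) z" by (rule deriv_cong_ev) (rule refl)
      then show ?thesis by simp
    qed
    then have "(T_op g f has_field_derivative 0) (at z)" if "z \<in> ball 0 1" for z
      using T_op_has_derivative[OF hol[OF f] g that] that by simp
    then have T0: "T_op g f z = 0" if "z \<in> ball 0 1" for z
      using eq_at_0_of_zero_deriv[of "T_op g f" z] that by (simp add: T_op_0)
    have "hardy_mean q (T_op g f) r \<le> 0" if "0 < r" "r < 1" for r
      using T0 that q by (simp add: hardy_mean_def norm_mult)
    from hardy_spaceI[OF T_op_holomorphic[OF hol[OF f] g] q this] nonneg[OF f] show ?thesis by simp
  qed
  then show ?thesis unfolding bounded_operator_def by blast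
qed

lemma dirichlet_norm_nonneg: "0 \<le> dirichlet_norm p f"
  by (simp add: dirichlet_norm_def)

lemma deriv_bound_of_bounded_dirichlet:
  assumes p: "0 < p" and q: "0 < q" and g: "g holomorphic_on ball 0 1"
    and bdd: "bounded_operator (dirichlet_space p) (dirichlet_norm p) (hardy_space q) (hardy_norm q) (T_op g)"
  shows "\<exists>K>0. \<forall>z. norm z < 1 \<longrightarrow> norm (deriv g z) \<le> K * (1 - norm z) powr (1 / p - 1 / q - 1)"
proof -
  obtain m :: nat where "2 / p \<le> real m" using real_arch_simple by blast
  then have m: "2 \<le> real m * p" using p by (simp add: field_simps)
  show ?thesis
  proof (rule deriv_bound_of_bounded[OF q g bdd])
    fix a :: complex assume a: "norm a < 1"
    show "kernel_power m a \<in> dirichlet_space p \<and> 0 \<le> dirichlet_norm p (kernel_power m a) \<and>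
        dirichlet_norm p (kernel_power m a) \<le>
          (real m powr p * 3 powr ((real m + 1) * p - 1) / p + 1) powr (1 / p) * (1 - norm a) powr (1 / p - real m)"
      by (intro conjI kernel_power_dirichlet[OF p m a] dirichlet_norm_nonneg)
  qed
qed

lemma deriv_bound_of_bounded_hardy:
  assumes p: "0 < p" and q: "0 < q" and g: "g holomorphic_on ball 0 1"
    and bdd: "bounded_operator (hardy_space p) (hardy_norm p) (hardy_space q) (hardy_norm q) (T_op g)"
  shows "\<exists>K>0. \<forall>z. norm z < 1 \<longrightarrow> norm (deriv g z) \<le> K * (1 - norm z) powr (1 / p - 1 / q - 1)"
proof -
  obtain m :: nat where "2 / p \<le> real m" using real_arch_simple by blast
  then have m: "2 \<le> real m * p" using p by (simp add: field_simps)
  show ?thesis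
  proof (rule deriv_bound_of_bounded[OF q g bdd])
    fix a :: complex assume a: "norm a < 1"
    show "kernel_power m a \<in> hardy_space p \<and> 0 \<le> hardy_norm p (kernel_power m a) \<and>
        hardy_norm p (kernel_power m a) \<le> 1 * (1 - norm a) powr (1 / p - real m)"
      using kernel_power_hardy[OF p m a] hardy_norm_nonneg[OF _ p] by simp
  qed
qed

theorem theorem3:
  fixes p q :: real and g :: "complex \<Rightarrow> complex"
  assumes "0 < p" and "p < q" and "g holomorphic_on ball 0 1"
  shows "(1 / p - 1 / q \<le> 1 \<longrightarrow>
      (bounded_operator (dirichlet_space p) (dirichlet_norm p) (hardy_space q) (hardy_norm q) (T_op g)
        \<longleftrightarrow> bounded_operator (hardy_space p) (hardy_norm p) (hardy_space q) (hardy_norm q) (T_op g))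
      \<and> (bounded_operator (hardy_space p) (hardy_norm p) (hardy_space q) (hardy_norm q) (T_op g)
        \<longleftrightarrow> g \<in> lipschitz_space (1 / p - 1 / q)))
    \<and> (1 / p - 1 / q > 1 \<longrightarrow>
      (bounded_operator (dirichlet_space p) (dirichlet_norm p) (hardy_space q) (hardy_norm q) (T_op g)
        \<longleftrightarrow> g constant_on ball 0 1))"
proof -
  define \<alpha> where "\<alpha> = 1 / p - 1 / q"
  have q: "0 < q" using assms by simp
  have \<alpha>: "0 < \<alpha>" using assms by (simp add: \<alpha>_def field_simps)
  define growth where "growth \<longleftrightarrow> (\<exists>K>0. \<forall>z. norm z < 1 \<longrightarrow> norm (deriv g z) \<le> K * (1 - norm z) powr (\<alpha> - 1))"
  have D: "bounded_operator (dirichlet_space p) (dirichlet_norm p) (hardy_space q) (hardy_norm q) (T_op g) \<longleftrightarrow> growth"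
    using deriv_bound_of_bounded_dirichlet[OF assms(1) q assms(3)] dirichlet_to_hardy_bounded[OF assms]
    unfolding growth_def \<alpha>_def by blast
  have H: "bounded_operator (hardy_space p) (hardy_norm p) (hardy_space q) (hardy_norm q) (T_op g) \<longleftrightarrow> growth"
    if "\<alpha> \<le> 1"
    using deriv_bound_of_bounded_hardy[OF assms(1) q assms(3)]
      hardy_to_hardy_bounded[OF assms(1,2) that[unfolded \<alpha>_def] assms(3)]
    unfolding growth_def \<alpha>_def by blast
  have L: "g \<in> lipschitz_space \<alpha> \<longleftrightarrow> growth" if "\<alpha> \<le> 1"
  proof
    assume "g \<in> lipschitz_space \<alpha>"
    then obtain K where K: "0 \<le> K" "\<And>z. norm z < 1 \<Longrightarrow> norm (deriv g z) \<le> K * (1 - norm z) powr (\<alpha> - 1)"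
      using deriv_bound_of_lipschitz_space[OF _ \<alpha> \<open>\<alpha> \<le> 1\<close>] by blast
    have "norm (deriv g z) \<le> (K + 1) * (1 - norm z) powr (\<alpha> - 1)" if "norm z < 1" for z
      by (rule order_trans[OF K(2)[OF that]]) (intro mult_right_mono, auto)
    then show growth unfolding growth_def using K(1) by (intro exI[of _ "K + 1"]) auto
  next
    assume growth
    then show "g \<in> lipschitz_space \<alpha>"
      unfolding growth_def using lipschitz_space_of_deriv_bound[OF assms(3) \<alpha> that] by (meson less_imp_le)
  qed
  have C: "growth \<longleftrightarrow> g constant_on ball 0 1" if "1 < \<alpha>"
  proof
    assume growth
    then show "g constant_on ball 0 1"
      unfolding growth_def using constant_of_deriv_decay[OF assms(3), of "\<alpha> - 1"] that by auto
  next
    assume "g constant_on ball 0 1"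
    then have "bounded_operator (dirichlet_space p) (dirichlet_norm p) (hardy_space q) (hardy_norm q) (T_op g)"
      by (rule constant_imp_bounded[OF _ q dirichlet_norm_nonneg]) (simp add: dirichlet_space_def)
    then show growth unfolding D .
  qed
  show ?thesis
    using D H L C unfolding \<alpha>_def[symmetric] by blast
qed

end
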